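(* Let $\phi\colon U_S\to W$ be a representation over a field $\Bbbk$ of a matroid $\mathbf M$ on a finite set $S$, let $\lambda=|S|-r_S-1$, and let $Y\subseteq S$. For $n\ge-1$ put $T_n\big|_Y=T_n(\phi)\big|_Y=\bigoplus_{I\in\mathcal T_n(\mathbf M),\,I\subseteq Y}T_I(\phi)$; put $T_0^+\big|_Y=T_0^+=W$, and for $n\ge1$ put $T_n^+\big|_Y=T_{n-2}\big|_Y$. Then: (a) The sequence $T_\bullet(\phi)\big|_Y=\bigl(0\to T_\lambda\big|_Y\xrightarrow{\phi_\lambda}T_{\lambda-1}\big|_Y\to\dots\to T_1\big|_Y\xrightarrow{\phi_1}T_0\big|_Y\to0\bigr)$ is a subcomplex of $T_\bullet(\phi)$, and $T_\bullet(\phi|Y)=T_\bullet(\phi)\big|_Y$. (b) The sequence $T_\bullet(\phi)^+\big|_Y=\bigl(0\to T_{\lambda+2}^+\big|_Y\xrightarrow{\phi_{\lambda+2}^+}T_{\lambda+1}^+\big|_Y\to\dots\to T_2^+\big|_Y\xrightarrow{\phi_2^+}T_1^+\big|_Y\xrightarrow{\phi_1^+}T_0^+\big|_Y\to0\bigr)$ is a subcomplex of $T_\bullet(\phi)^+$, and $T_\bullet(\phi|Y)^+=T_\bullet(\phi)^+\big|_Y$.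
   Context: Conventions. For a finite dimensional $\Bbbk$-vector space $X$, $\Lambda(X)=\wedge^{\dim X}X$ ($\Lambda(0)=\Bbbk$). Tensor products are over $\Bbbk$; $\Lambda(X^* )$ and $\Lambda(X)$ are paired by $\langle f_1\wedge\dots\wedge f_d,\,x_1\wedge\dots\wedge x_d\rangle=\det(f_i(x_j))$. Matroid and representation. $U_S$ is the $\Bbbk$-vector space with basis $\{e_a: a\in S\}$, $W$ is a $\Bbbk$-vector space, $\phi$ is linear; for $I\subseteq S$, $U_I$ is the span of $\{e_a:a\in I\}$ and $V_I=\phi(U_I)$. $\phi$ is a representation of $\mathbf M$ if $A\subseteq S$ is independent in $\mathbf M$ iff $\dim V_A=|A|$. For $Y\subseteq S$, $\phi|Y\colon U_Y\to W$ is the restriction of $\phi$; it is a representation of the restricted matroid $\mathbf M|Y$. $r_A$ is the rank and $\ell_A=|A|-r_A-1$ the level of $A$. A T-flat of $\mathbf M$ is a subset $A\subseteq S$ such that $S\setminus A$ is a proper flat of the dual matroid $\mathbf M^*$ (equivalently, $A$ is a nonempty union of circuits). For $n\ge0$, $\mathcal T_n(\mathbf M)$ is the set of T-flats of level $n$ ($\mathcal T_0$ is the set of circuits); $\mathcal T_{-1}(\mathbf M)$ is the set of one-element subsets of $S$. Multiplicity spaces and T-spaces. For a T-flat $I$ of level $n$, $C(I)$ is the set of chains $\mathbb I=(I^{(0)}\subsetneq\dots\subsetneq I^{(n)}=I)$ with $I^{(i)}\in\mathcal T_i(\mathbf M)$; $V(\mathbb I)=\Bbbk=S_0W$ if $n=0$,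 and $V(\mathbb I)=\prod_{i=1}^n\bigl(V_{I^{(i)}\setminus I^{(i-1)}}\cap V_{I^{(i-1)}}\bigr)\subseteq S_nW$ (product in the symmetric algebra) if $n\ge1$. $S_I=S_I(\phi)=\sum_{\mathbb I\in C(I)}V(\mathbb I)$. $T_I=T_I(\phi)=S_I^*\otimes\Lambda(U_I)\otimes\Lambda(V_I^* )$. For $\{a\}\in\mathcal T_{-1}(\mathbf M)$, $T_{\{a\}}=U_a=\Bbbk e_a$. Maps $\phi_n^{IJ}$. (i) $n=0$: for a circuit $I$ and $a\in I$, $\phi_0^{I,a}\colon T_I=\Lambda(U_I)\otimes\Lambda(V_I^* )\to U_a$ sends $(e_a\wedge u)\otimes f\mapsto\langle f,(\wedge\phi)(u)\rangle e_a$ for $u\in\Lambda(U_{I\setminus a})$ (note $V_I=V_{I\setminus a}$). (ii) $n\ge1$: for T-flats $J\subset I$ of levels $n-1$ and $n$, put $D=V_J\cap V_{I\setminus J}$ (of dimension at most $1$) and $K=V_I/V_J=V_{I\setminus J}/D$. Let $\Delta\colon S_I^*\to D^*\otimes S_J^*$ be dual to the multiplication $D\otimes S_J\to S_I$; $\boldsymbol\delta\colon\Lambda(U_I)\to\Lambda(U_{I\setminus J})\otimes\Lambda(U_J)$ the inverse of $u\otimes u'\mapsto u\wedge u'$; $\mathbf a\colon\Lambda(V_I^* )\to\Lambda(K^* )\otimes\Lambda(V_J^* )$ the inverse of $k\otimes f\mapsto k\wedge\tilde f$ ($\tilde f$ any lift of $f$ to $V_I^*$); $\mathbf b\colon D^*\otimes\Lambda(K^*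 )\to\Lambda(V_{I\setminus J}^* )$, $g\otimes k\mapsto\tilde g\wedge k$ (zero if $D=0$); $\wedge\phi\colon\Lambda(U_{I\setminus J})\to\Lambda(V_{I\setminus J})$ the map induced by $\phi$ if $I\setminus J$ is independent and $0$ otherwise; $\mu\colon\Lambda(V_{I\setminus J}^* )\otimes\Lambda(V_{I\setminus J})\to\Bbbk$ the pairing. $\phi_n^{IJ}\colon T_I\to T_J$ is the composition of $\Delta\otimes\boldsymbol\delta\otimes\mathbf a$, the permutation (without sign) of tensor factors to $[D^*\otimes\Lambda(K^* )]\otimes\Lambda(U_{I\setminus J})\otimes[S_J^*\otimes\Lambda(U_J)\otimes\Lambda(V_J^* )]$, the map $\mathbf b\otimes\wedge\phi\otimes1$, and $\mu\otimes1$. Complexes. $T_n=T_n(\phi)=\bigoplus_{I\in\mathcal T_n(\mathbf M)}T_I$ for $n\ge-1$ (so $T_{-1}=U_S$). For $n\ge0$, $\phi_n\colon T_n\to T_{n-1}$ restricts on $T_I$ to $\sum_{J\in\mathcal T_{n-1}(\mathbf M),\,J\subseteq I}(-1)^{|J|}\phi_n^{IJ}$. $T_\bullet(\phi)$ is $0\to T_\lambda\xrightarrow{\phi_\lambda}\dots\xrightarrow{\phi_1}T_0\to0$. Put $T_0^+=W$, $T_n^+=T_{n-2}$ for $n\ge1$, $\phi_1^+=\phi\colon U_S\to W$, $\phi_n^+=\phi_{n-2}$ for $n\ge2$; $T_\bullet(\phi)^+$ is $0\to T_{\lambda+2}^+\to\dots\to T_2^+\xrightarrow{\phi_2^+}T_1^+\xrightarrow{\phi_1^+}T_0^+\to0$.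 The maps in the restricted sequences are the restrictions of $\phi_n$, $\phi_n^+$; the complexes $T_\bullet(\phi|Y)$, $T_\bullet(\phi|Y)^+$ are obtained by the same construction from $\phi|Y$ and $\mathbf M|Y$. *)

theory Defs
  imports
    "HOL-Library.FuncSet"
    "HOL-Library.Function_Algebras"
    "HOL-Library.Product_Plus"
    "Jordan_Normal_Form.Determinant"
begin

section \<open>Matroids\<close>

text \<open>A matroid on a finite set \<open>S\<close> is given by its family \<open>\<I>\<close> of independent sets.\<close>

definition matroid :: "'a set \<Rightarrow> 'a set set \<Rightarrow> bool" where
  "matroid S \<I> \<longleftrightarrow> finite S \<and> \<I> \<subseteq> Pow S \<and> {} \<in> \<I> \<and>
     (\<forall>A\<in>\<I>. \<forall>B. B \<subseteq> A \<longrightarrow> B \<in> \<I>) \<and>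
     (\<forall>A\<in>\<I>. \<forall>B\<in>\<I>. card A < card B \<longrightarrow> (\<exists>x\<in>B - A. insert x A \<in> \<I>))"

definition mbases :: "'a set set \<Rightarrow> 'a set set" where
  "mbases \<I> = {B \<in> \<I>. \<forall>A\<in>\<I>. B \<subseteq> A \<longrightarrow> A = B}"

definition mdual :: "'a set \<Rightarrow> 'a set set \<Rightarrow> 'a set set" where
  "mdual S \<I> = {A. \<exists>B\<in>mbases \<I>. A \<subseteq> S - B}"

definition mrestrict :: "'a set set \<Rightarrow> 'a set \<Rightarrow> 'a set set" where
  "mrestrict \<I> Y = {A \<in> \<I>. A \<subseteq> Y}"

definition mrank :: "'a set set \<Rightarrow> 'a set \<Rightarrow> nat" where
  "mrank \<I> A = Max (card ` {B \<in> \<I>. B \<subseteq> A})"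

definition mflat :: "'a set \<Rightarrow> 'a set set \<Rightarrow> 'a set \<Rightarrow> bool" where
  "mflat S \<I> F \<longleftrightarrow> F \<subseteq> S \<and> (\<forall>x\<in>S - F. mrank \<I> F < mrank \<I> (insert x F))"

definition Tflat :: "'a set \<Rightarrow> 'a set set \<Rightarrow> 'a set \<Rightarrow> bool" where
  "Tflat S \<I> A \<longleftrightarrow> A \<subseteq> S \<and> mflat S (mdual S \<I>) (S - A) \<and> S - A \<noteq> S"

definition level :: "'a set set \<Rightarrow> 'a set \<Rightarrow> int" where
  "level \<I> A = int (card A) - int (mrank \<I> A) - 1"

definition Tflats :: "'a set \<Rightarrow> 'a set set \<Rightarrow> nat \<Rightarrow> 'a set set" where
  "Tflats S \<I> n = {A. Tflat S \<I> A \<and> level \<I> A = int n}"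

text \<open>Level \<open>-1\<close>: the one-element subsets of \<open>S\<close> (which need not be T-flats).\<close>

definition singles :: "'a set \<Rightarrow> 'a set set" where
  "singles S = {{a} | a. a \<in> S}"


section \<open>Linear algebra on subspaces\<close>

text \<open>
  Spaces are subspaces of an ambient type with scalar multiplication \<open>s\<close>.  For a type
  \<open>'x \<Rightarrow> 'k\<close> of functions into the field the scalar multiplication is the pointwise one.
\<close>

definition fscale :: "'k::field \<Rightarrow> ('x \<Rightarrow> 'k) \<Rightarrow> 'x \<Rightarrow> 'k" where
  "fscale c f = (\<lambda>x. c * f x)"

abbreviation fspan :: "('x \<Rightarrow> 'k::field) set \<Rightarrow> ('x \<Rightarrow> 'k) set" where
  "fspan \<equiv> Modules.module.span fscale"

definition linear_on ::
  "('k::field \<Rightarrow> 'x::ab_group_add \<Rightarrow> 'x) \<Rightarrow> ('k \<Rightarrow> 'y::ab_group_add \<Rightarrow> 'y) \<Rightarrow>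
     'x set \<Rightarrow> ('x \<Rightarrow> 'y) \<Rightarrow> bool" where
  "linear_on s s' X f \<longleftrightarrow>
     (\<forall>x\<in>X. \<forall>y\<in>X. f (x + y) = f x + f y) \<and> (\<forall>c. \<forall>x\<in>X. f (s c x) = s' c (f x))"

text \<open>
  The dual \<open>X\<^sup>*\<close>.  A functional on \<open>X\<close> is extended by \<open>0\<close> outside \<open>X\<close>, so that \<open>X\<^sup>*\<close> is a
  subspace of \<open>'x \<Rightarrow> 'k\<close>; the extension is not linear and carries no information.
\<close>

definition dual :: "('k::field \<Rightarrow> 'x::ab_group_add \<Rightarrow> 'x) \<Rightarrow> 'x set \<Rightarrow> ('x \<Rightarrow> 'k) set" where
  "dual s X = {f. linear_on s (*) X f \<and> (\<forall>x. x \<notin> X \<longrightarrow> f x = 0)}"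

definition res :: "'x set \<Rightarrow> ('x \<Rightarrow> 'k::field) \<Rightarrow> 'x \<Rightarrow> 'k" where
  "res X f = (\<lambda>x. if x \<in> X then f x else 0)"

text \<open>
  The dual of the quotient \<open>X / N\<close>, whose elements are the cosets \<open>x + N\<close>: linearity on the
  quotient means linearity after composition with the projection \<open>X \<rightarrow> X / N\<close>.
\<close>

definition coset :: "'x::ab_group_add set \<Rightarrow> 'x \<Rightarrow> 'x set" where
  "coset N x = (+) x ` N"

definition quot_dual ::
  "('k::field \<Rightarrow> 'x::ab_group_add \<Rightarrow> 'x) \<Rightarrow> 'x set \<Rightarrow> 'x set \<Rightarrow> ('x set \<Rightarrow> 'k) set" where
  "quot_dual s X N =
     {\<kappa>. linear_on s (*) X (\<lambda>x. \<kappa> (coset N x)) \<and> (\<forall>C. C \<notin> coset N ` X \<longrightarrow> \<kappa> C = 0)}"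

definition quot_pull :: "'x set \<Rightarrow> 'x::ab_group_add set \<Rightarrow> ('x set \<Rightarrow> 'k::field) \<Rightarrow> 'x \<Rightarrow> 'k" where
  "quot_pull X N \<kappa> = (\<lambda>x. if x \<in> X then \<kappa> (coset N x) else 0)"


subsection \<open>Tensor products\<close>

text \<open>
  Over a field, \<open>X \<otimes> Y\<close> embeds into the dual of the space of bilinear forms on \<open>X \<times> Y\<close>, a pure
  tensor \<open>x \<otimes> y\<close> being evaluation at \<open>(x, y)\<close>.  This is the model used here: the tensor product
  is the span of the evaluations.  Exterior and symmetric powers are modelled in the same way,
  by evaluation of alternating resp. symmetric multilinear forms (in any characteristic these
  are the linear forms on \<open>\<Lambda>\<^sup>d X\<close> resp. \<open>S\<^sub>n W\<close>).
\<close>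

type_synonym ('k, 'x, 'y) tens = "(('x \<Rightarrow> 'k) \<Rightarrow> ('y \<Rightarrow> 'k) \<Rightarrow> 'k) \<Rightarrow> 'k"

definition bilinear_form ::
  "('x \<Rightarrow> 'k::field) set \<Rightarrow> ('y \<Rightarrow> 'k) set \<Rightarrow> (('x \<Rightarrow> 'k) \<Rightarrow> ('y \<Rightarrow> 'k) \<Rightarrow> 'k) \<Rightarrow> bool" where
  "bilinear_form X Y \<beta> \<longleftrightarrow>
     (\<forall>x\<in>X. linear_on fscale (*) Y (\<beta> x)) \<and> (\<forall>y\<in>Y. linear_on fscale (*) X (\<lambda>x. \<beta> x y))"

definition pure ::
  "('x \<Rightarrow> 'k::field) set \<Rightarrow> ('y \<Rightarrow> 'k) set \<Rightarrow> ('x \<Rightarrow> 'k) \<Rightarrow> ('y \<Rightarrow> 'k) \<Rightarrow> ('k, 'x, 'y) tens" where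
  "pure X Y x y = (\<lambda>\<beta>. if bilinear_form X Y \<beta> then \<beta> x y else 0)"

definition tensor ::
  "('x \<Rightarrow> 'k::field) set \<Rightarrow> ('y \<Rightarrow> 'k) set \<Rightarrow> ('k, 'x, 'y) tens set" where
  "tensor X Y = fspan {pure X Y x y | x y. x \<in> X \<and> y \<in> Y}"

text \<open>
  The linear map \<open>x \<otimes> y \<mapsto> \<beta> x y\<close> induced by a bilinear map \<open>\<beta>\<close> into a space of functions;
  for a bilinear form \<open>\<beta>\<close> the induced linear form is \<open>\<lambda>t. t \<beta>\<close>.
\<close>

definition tlift ::
  "(('x \<Rightarrow> 'k::field) \<Rightarrow> ('y \<Rightarrow> 'k) \<Rightarrow> ('z \<Rightarrow> 'k)) \<Rightarrow> ('k, 'x, 'y) tens \<Rightarrow> ('z \<Rightarrow> 'k)" where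
  "tlift \<beta> t = (\<lambda>z. t (\<lambda>x y. \<beta> x y z))"

text \<open>The map \<open>f \<otimes> g\<close> with target \<open>X' \<otimes> Y'\<close>.\<close>

definition tmap ::
  "('x1 \<Rightarrow> 'k::field) set \<Rightarrow> ('y1 \<Rightarrow> 'k) set \<Rightarrow> (('x \<Rightarrow> 'k) \<Rightarrow> 'x1 \<Rightarrow> 'k) \<Rightarrow>
     (('y \<Rightarrow> 'k) \<Rightarrow> 'y1 \<Rightarrow> 'k) \<Rightarrow> ('k, 'x, 'y) tens \<Rightarrow> ('k, 'x1, 'y1) tens" where
  "tmap X' Y' f g = tlift (\<lambda>x y. pure X' Y' (f x) (g y))"


subsection \<open>Exterior powers\<close>

type_synonym ('k, 'x) ext = "('x list \<Rightarrow> 'k) \<Rightarrow> 'k"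

definition multilinear_form ::
  "('k::field \<Rightarrow> 'x::ab_group_add \<Rightarrow> 'x) \<Rightarrow> 'x set \<Rightarrow> nat \<Rightarrow> ('x list \<Rightarrow> 'k) \<Rightarrow> bool" where
  "multilinear_form s X d \<alpha> \<longleftrightarrow>
     (\<forall>xs i. length xs = d \<and> set xs \<subseteq> X \<and> i < d \<longrightarrow> linear_on s (*) X (\<lambda>x. \<alpha> (xs[i := x])))"

definition alternating_form ::
  "('k::field \<Rightarrow> 'x::ab_group_add \<Rightarrow> 'x) \<Rightarrow> 'x set \<Rightarrow> nat \<Rightarrow> ('x list \<Rightarrow> 'k) \<Rightarrow> bool" where
  "alternating_form s X d \<alpha> \<longleftrightarrow> multilinear_form s X d \<alpha> \<and>
     (\<forall>xs. length xs = d \<and> set xs \<subseteq> X \<and> \<not> distinct xs \<longrightarrow> \<alpha> xs = 0)"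

definition wedge ::
  "('k::field \<Rightarrow> 'x::ab_group_add \<Rightarrow> 'x) \<Rightarrow> 'x set \<Rightarrow> 'x list \<Rightarrow> ('k, 'x) ext" where
  "wedge s X xs = (\<lambda>\<alpha>. if alternating_form s X (length xs) \<alpha> then \<alpha> xs else 0)"

definition ext_power ::
  "('k::field \<Rightarrow> 'x::ab_group_add \<Rightarrow> 'x) \<Rightarrow> nat \<Rightarrow> 'x set \<Rightarrow> ('k, 'x) ext set" where
  "ext_power s d X = fspan {wedge s X xs | xs. length xs = d \<and> set xs \<subseteq> X}"

definition Lam :: "('k::field \<Rightarrow> 'x::ab_group_add \<Rightarrow> 'x) \<Rightarrow> 'x set \<Rightarrow> ('k, 'x) ext set" where
  "Lam s X = ext_power s (vector_space.dim s X) X"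

text \<open>The induced map \<open>\<Lambda>\<^sup>d X \<rightarrow> \<Lambda>\<^sup>d Z\<close>, \<open>x\<^sub>1 \<and> \<dots> \<and> x\<^sub>d \<mapsto> f x\<^sub>1 \<and> \<dots> \<and> f x\<^sub>d\<close>; \<open>s\<close> belongs to \<open>Z\<close>.\<close>

definition ext_map ::
  "('k::field \<Rightarrow> 'z::ab_group_add \<Rightarrow> 'z) \<Rightarrow> 'z set \<Rightarrow> nat \<Rightarrow> ('x \<Rightarrow> 'z) \<Rightarrow>
     ('k, 'x) ext \<Rightarrow> ('k, 'z) ext" where
  "ext_map s Z d f \<omega> =
     (\<lambda>\<alpha>. if alternating_form s Z d \<alpha> then \<omega> (\<lambda>xs. \<alpha> (map f xs)) else 0)"

text \<open>
  The exterior product in \<open>\<Lambda>\<^sup>p\<^sup>+\<^sup>q X\<close> of an element of \<open>\<Lambda>\<^sup>p A\<close> and an element of \<open>\<Lambda>\<^sup>q B\<close>, for subspaces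
  \<open>A, B\<close> of \<open>X\<close>.
\<close>

definition ext_mult ::
  "('k::field \<Rightarrow> 'x::ab_group_add \<Rightarrow> 'x) \<Rightarrow> 'x set \<Rightarrow> nat \<Rightarrow> nat \<Rightarrow>
     ('k, 'x) ext \<Rightarrow> ('k, 'x) ext \<Rightarrow> ('k, 'x) ext" where
  "ext_mult s X p q \<omega> \<eta> =
     (\<lambda>\<alpha>. if alternating_form s X (p + q) \<alpha> then \<omega> (\<lambda>xs. \<eta> (\<lambda>ys. \<alpha> (xs @ ys))) else 0)"

text \<open>The pairing of \<open>\<Lambda>\<^sup>d(X\<^sup>*)\<close> and \<open>\<Lambda>\<^sup>d X\<close>.\<close>

definition ext_pair ::
  "nat \<Rightarrow> ('k::field, 'x \<Rightarrow> 'k) ext \<Rightarrow> ('k, 'x) ext \<Rightarrow> 'k" where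
  "ext_pair d F \<omega> = F (\<lambda>fs. \<omega> (\<lambda>xs. det (mat d d (\<lambda>(i, j). (fs ! i) (xs ! j)))))"


subsection \<open>Symmetric powers of the whole space\<close>

type_synonym ('k, 'w) sym = "('w list \<Rightarrow> 'k) \<Rightarrow> 'k"

definition symmetric_form ::
  "('k::field \<Rightarrow> 'w::ab_group_add \<Rightarrow> 'w) \<Rightarrow> nat \<Rightarrow> ('w list \<Rightarrow> 'k) \<Rightarrow> bool" where
  "symmetric_form s n \<sigma> \<longleftrightarrow> multilinear_form s UNIV n \<sigma> \<and>
     (\<forall>xs ys. length xs = n \<and> mset xs = mset ys \<longrightarrow> \<sigma> xs = \<sigma> ys)"

definition sym_prod ::
  "('k::field \<Rightarrow> 'w::ab_group_add \<Rightarrow> 'w) \<Rightarrow> 'w list \<Rightarrow> ('k, 'w) sym" where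
  "sym_prod s xs = (\<lambda>\<sigma>. if symmetric_form s (length xs) \<sigma> then \<sigma> xs else 0)"

text \<open>The multiplication \<open>W \<times> S\<^sub>m W \<rightarrow> S\<^sub>m\<^sub>+\<^sub>1 W\<close>.\<close>

definition sym_mult ::
  "('k::field \<Rightarrow> 'w::ab_group_add \<Rightarrow> 'w) \<Rightarrow> nat \<Rightarrow> 'w \<Rightarrow> ('k, 'w) sym \<Rightarrow> ('k, 'w) sym" where
  "sym_mult s m x p =
     (\<lambda>\<sigma>. if symmetric_form s (Suc m) \<sigma> then p (\<lambda>xs. \<sigma> (x # xs)) else 0)"


section \<open>Representations\<close>

definition unit_vec :: "'a \<Rightarrow> 'a \<Rightarrow> 'k::field" where
  "unit_vec a = (\<lambda>x. if x = a then 1 else 0)"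

definition U :: "'a set \<Rightarrow> ('a \<Rightarrow> 'k::field) set" where
  "U A = fspan (unit_vec ` A)"

definition V :: "(('a \<Rightarrow> 'k::field) \<Rightarrow> 'w) \<Rightarrow> 'a set \<Rightarrow> 'w set" where
  "V \<phi> A = \<phi> ` U A"

definition is_representation ::
  "('k::field \<Rightarrow> 'w::ab_group_add \<Rightarrow> 'w) \<Rightarrow> 'a set \<Rightarrow> 'a set set \<Rightarrow>
     (('a \<Rightarrow> 'k) \<Rightarrow> 'w) \<Rightarrow> bool" where
  "is_representation s S \<I> \<phi> \<longleftrightarrow> linear_on fscale s (U S) \<phi> \<and>
     (\<forall>A. A \<subseteq> S \<longrightarrow> (A \<in> \<I> \<longleftrightarrow> vector_space.dim s (V \<phi> A) = card A))"


section \<open>Multiplicity spaces and T-spaces\<close>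

text \<open>
  Chains \<open>I\<^sup>0 \<subset> \<dots> \<subset> I\<^sup>n = I\<close> of T-flats with \<open>I\<^sup>i\<close> of level \<open>i\<close>, as lists; the length is forced to be
  one more than the level of \<open>I\<close>.
\<close>

definition Tchains :: "'a set \<Rightarrow> 'a set set \<Rightarrow> 'a set \<Rightarrow> 'a set list set" where
  "Tchains S \<I> I = {Is. Is \<noteq> [] \<and> last Is = I \<and>
     (\<forall>i<length Is. Is ! i \<in> Tflats S \<I> i) \<and>
     (\<forall>i. Suc i < length Is \<longrightarrow> Is ! i \<subset> Is ! Suc i)}"

text \<open>For a chain of length one only the empty product occurs, which spans \<open>S\<^sub>0 W\<close>.\<close>

definition chain_space ::
  "('k::field \<Rightarrow> 'w::ab_group_add \<Rightarrow> 'w) \<Rightarrow> (('a \<Rightarrow> 'k) \<Rightarrow> 'w) \<Rightarrow> 'a set list \<Rightarrow>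
     ('k, 'w) sym set" where
  "chain_space s \<phi> Is = fspan {sym_prod s xs | xs. length xs = length Is - 1 \<and>
     (\<forall>i<length xs. xs ! i \<in> V \<phi> (Is ! Suc i - Is ! i) \<inter> V \<phi> (Is ! i))}"

definition mult_space ::
  "('k::field \<Rightarrow> 'w::ab_group_add \<Rightarrow> 'w) \<Rightarrow> 'a set \<Rightarrow> 'a set set \<Rightarrow> (('a \<Rightarrow> 'k) \<Rightarrow> 'w) \<Rightarrow>
     'a set \<Rightarrow> ('k, 'w) sym set" where
  "mult_space s S \<I> \<phi> I = fspan (\<Union>Is\<in>Tchains S \<I> I. chain_space s \<phi> Is)"

type_synonym ('k, 'a) extU_idx = "('a \<Rightarrow> 'k) list \<Rightarrow> 'k"
type_synonym ('k, 'w) extV_idx = "('w \<Rightarrow> 'k) list \<Rightarrow> 'k"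
type_synonym ('k, 'a, 'w) uv_idx =
  "(('k, 'a) extU_idx \<Rightarrow> 'k) \<Rightarrow> (('k, 'w) extV_idx \<Rightarrow> 'k) \<Rightarrow> 'k"
type_synonym ('k, 'a, 'w) tspace = "('k, ('k, 'w) sym, ('k, 'a, 'w) uv_idx) tens"

abbreviation UV_space ::
  "('k::field \<Rightarrow> 'w::ab_group_add \<Rightarrow> 'w) \<Rightarrow> (('a \<Rightarrow> 'k) \<Rightarrow> 'w) \<Rightarrow> 'a set \<Rightarrow>
     (('k, 'a, 'w) uv_idx \<Rightarrow> 'k) set" where
  "UV_space s \<phi> I \<equiv> tensor (Lam fscale (U I)) (Lam fscale (dual s (V \<phi> I)))"

definition Tspace ::
  "('k::field \<Rightarrow> 'w::ab_group_add \<Rightarrow> 'w) \<Rightarrow> 'a set \<Rightarrow> 'a set set \<Rightarrow> (('a \<Rightarrow> 'k) \<Rightarrow> 'w) \<Rightarrow>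
     'a set \<Rightarrow> ('k, 'a, 'w) tspace set" where
  "Tspace s S \<I> \<phi> I = tensor (dual fscale (mult_space s S \<I> \<phi> I)) (UV_space s \<phi> I)"


section \<open>The structure maps\<close>

text \<open>
  For a circuit \<open>I\<close> the multiplicity space is \<open>S\<^sub>0 W\<close> with basis the empty product; the
  identification \<open>S\<^sub>0 W = \<Bbbk>\<close> makes \<open>h \<in> S\<^sub>I\<^sup>*\<close> the scalar \<open>h 1\<close>.
\<close>

definition phi0 ::
  "('k::field \<Rightarrow> 'w::ab_group_add \<Rightarrow> 'w) \<Rightarrow> (('a \<Rightarrow> 'k) \<Rightarrow> 'w) \<Rightarrow> 'a set \<Rightarrow> 'a \<Rightarrow>
     ('k, 'a, 'w) tspace \<Rightarrow> ('a \<Rightarrow> 'k)" where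
  "phi0 s \<phi> I a =
     (let d = card (I - {a});
          head = (\<lambda>\<omega>. THE u. u \<in> Lam fscale (U (I - {a})) \<and>
                     ext_mult fscale (U I) 1 d (wedge fscale (U {a}) [unit_vec a]) u = \<omega>)
      in tlift (\<lambda>h. tlift (\<lambda>\<omega> F.
           fscale (h (sym_prod s []) * ext_pair d F (ext_map s (V \<phi> I) d \<phi> (head \<omega>)))
             (unit_vec a))))"

context
  fixes s :: "'k::field \<Rightarrow> 'w::ab_group_add \<Rightarrow> 'w"
    and S :: "'a set" and \<I> :: "'a set set"
    and \<phi> :: "('a \<Rightarrow> 'k) \<Rightarrow> 'w"
    and I J :: "'a set"
begin

definition D_space :: "'w set" where
  "D_space = V \<phi> J \<inter> V \<phi> (I - J)"

text \<open>The dual of \<open>K = V\<^sub>I / V\<^sub>J\<close>.\<close>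

definition K_dual :: "('w set \<Rightarrow> 'k) set" where
  "K_dual = quot_dual s (V \<phi> I) (V \<phi> J)"

abbreviation "dimK \<equiv> vector_space.dim fscale K_dual"

text \<open>
  The dual of the multiplication \<open>D \<otimes> S\<^sub>J \<rightarrow> S\<^sub>I\<close>, where \<open>g \<otimes> q \<in> D\<^sup>* \<otimes> S\<^sub>J\<^sup>*\<close> is the functional
  \<open>x \<otimes> p \<mapsto> g x * q p\<close> on \<open>D \<otimes> S\<^sub>J\<close>, and \<open>m\<close> is the level of \<open>J\<close>.
\<close>

definition Delta ::
  "nat \<Rightarrow> (('k, 'w) sym \<Rightarrow> 'k) \<Rightarrow> ('k, 'w, ('k, 'w) sym) tens" where
  "Delta m h = (THE t. t \<in> tensor (dual s D_space) (dual fscale (mult_space s S \<I> \<phi> J)) \<and>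
     (\<forall>x\<in>D_space. \<forall>p\<in>mult_space s S \<I> \<phi> J. t (\<lambda>g q. g x * q p) = h (sym_mult s m x p)))"

definition delta ::
  "('k, 'a \<Rightarrow> 'k) ext \<Rightarrow> ('k, ('k, 'a) extU_idx, ('k, 'a) extU_idx) tens" where
  "delta = inv_into (tensor (Lam fscale (U (I - J))) (Lam fscale (U J)))
     (tlift (ext_mult fscale (U I) (card (I - J)) (card J)))"

text \<open>Some lift to \<open>\<Lambda>\<^sup>r(V\<^sub>I\<^sup>*)\<close> of \<open>f \<in> \<Lambda>(V\<^sub>J\<^sup>*)\<close>, \<open>r = dim V\<^sub>J\<close>, along restriction of functionals.\<close>

definition lift_a :: "('k, 'w \<Rightarrow> 'k) ext \<Rightarrow> ('k, 'w \<Rightarrow> 'k) ext" where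
  "lift_a f = (let r = vector_space.dim s (V \<phi> J) in
     SOME F. F \<in> ext_power fscale r (dual s (V \<phi> I)) \<and>
             ext_map fscale (dual s (V \<phi> J)) r (res (V \<phi> J)) F = f)"

definition amap ::
  "('k, 'w \<Rightarrow> 'k) ext \<Rightarrow> ('k, ('w set \<Rightarrow> 'k) list \<Rightarrow> 'k, ('k, 'w) extV_idx) tens" where
  "amap = inv_into (tensor (Lam fscale K_dual) (Lam fscale (dual s (V \<phi> J))))
     (tlift (\<lambda>k f. ext_mult fscale (dual s (V \<phi> I)) dimK (vector_space.dim s (V \<phi> J))
        (ext_map fscale (dual s (V \<phi> I)) dimK (quot_pull (V \<phi> I) (V \<phi> J)) k)
        (lift_a f)))"

definition lift_b :: "('w \<Rightarrow> 'k) \<Rightarrow> 'w \<Rightarrow> 'k" where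
  "lift_b g = (SOME g'. g' \<in> dual s (V \<phi> (I - J)) \<and> res D_space g' = g)"

text \<open>
  \<open>\<Lambda>(K\<^sup>*)\<close> is pulled back along \<open>V\<^bsub>I\<setminus>J\<^esub> \<rightarrow> V\<^sub>I / V\<^sub>J\<close>, which induces the identification
  \<open>V\<^bsub>I\<setminus>J\<^esub> / D = V\<^sub>I / V\<^sub>J\<close>.
\<close>

definition bmap ::
  "('k, 'w, ('w set \<Rightarrow> 'k) list \<Rightarrow> 'k) tens \<Rightarrow> ('k, 'w \<Rightarrow> 'k) ext" where
  "bmap = (if D_space = {0} then (\<lambda>_. 0) else
     tlift (\<lambda>g k. ext_mult fscale (dual s (V \<phi> (I - J))) 1 dimK
        (wedge fscale (dual s (V \<phi> (I - J))) [lift_b g])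
        (ext_map fscale (dual s (V \<phi> (I - J))) dimK (quot_pull (V \<phi> (I - J)) (V \<phi> J)) k)))"

definition wphi :: "('k, 'a \<Rightarrow> 'k) ext \<Rightarrow> ('k, 'w) ext" where
  "wphi = (if I - J \<in> \<I> then ext_map s (V \<phi> (I - J)) (card (I - J)) \<phi> else (\<lambda>_. 0))"

text \<open>
  \<open>\<phi>\<^sub>n\<^sup>I\<^sup>J : T\<^sub>I \<rightarrow> T\<^sub>J\<close> for \<open>n = m + 1\<close>.  The tensor factors are bracketed as
  \<open>S\<^sub>I\<^sup>* \<otimes> (\<Lambda>(U\<^sub>I) \<otimes> \<Lambda>(V\<^sub>I\<^sup>*))\<close> in \<open>T\<^sub>I\<close>, as
  \<open>(D\<^sup>* \<otimes> S\<^sub>J\<^sup>*) \<otimes> ((\<Lambda>(U\<^bsub>I\<setminus>J\<^esub>) \<otimes> \<Lambda>(U\<^sub>J)) \<otimes> (\<Lambda>(K\<^sup>*) \<otimes> \<Lambda>(V\<^sub>J\<^sup>*)))\<close> after the first step, and as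
  \<open>((D\<^sup>* \<otimes> \<Lambda>(K\<^sup>*)) \<otimes> \<Lambda>(U\<^bsub>I\<setminus>J\<^esub>)) \<otimes> T\<^sub>J\<close> after the permutation.
\<close>

abbreviation "split_map m \<equiv>
  tmap
    (tensor (dual s D_space) (dual fscale (mult_space s S \<I> \<phi> J)))
    (tensor (tensor (Lam fscale (U (I - J))) (Lam fscale (U J)))
            (tensor (Lam fscale K_dual) (Lam fscale (dual s (V \<phi> J)))))
    (Delta m)
    (tmap
      (tensor (Lam fscale (U (I - J))) (Lam fscale (U J)))
      (tensor (Lam fscale K_dual) (Lam fscale (dual s (V \<phi> J))))
      delta amap)"

abbreviation "perm_map \<equiv>
  tlift (\<lambda>gq. tlift (\<lambda>uv kf.
    tlift (\<lambda>g q. tlift (\<lambda>u v. tlift (\<lambda>k f.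
      pure (tensor (tensor (dual s D_space) (Lam fscale K_dual)) (Lam fscale (U (I - J))))
           (Tspace s S \<I> \<phi> J)
        (pure (tensor (dual s D_space) (Lam fscale K_dual)) (Lam fscale (U (I - J)))
           (pure (dual s D_space) (Lam fscale K_dual) g k) u)
        (pure (dual fscale (mult_space s S \<I> \<phi> J)) (UV_space s \<phi> J) q
           (pure (Lam fscale (U J)) (Lam fscale (dual s (V \<phi> J))) v f)))
    kf) uv) gq))"

abbreviation "b_wphi_map \<equiv>
  tmap
    (tensor (Lam fscale (dual s (V \<phi> (I - J)))) (Lam s (V \<phi> (I - J))))
    (Tspace s S \<I> \<phi> J)
    (tmap (Lam fscale (dual s (V \<phi> (I - J)))) (Lam s (V \<phi> (I - J))) bmap wphi)
    (\<lambda>t. t)"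

text \<open>\<open>\<mu> \<otimes> 1\<close>, followed by the identification \<open>\<Bbbk> \<otimes> T\<^sub>J = T\<^sub>J\<close>.\<close>

abbreviation "mu_map \<equiv>
  tlift (\<lambda>z t. fscale (z (ext_pair (vector_space.dim s (V \<phi> (I - J))))) t)"

definition phi_IJ :: "nat \<Rightarrow> ('k, 'a, 'w) tspace \<Rightarrow> ('k, 'a, 'w) tspace" where
  "phi_IJ m t = mu_map (b_wphi_map (perm_map (split_map m t)))"

end


section \<open>Sequences of vector spaces\<close>

text \<open>
  \<open>chain C n\<close> is the space in degree \<open>n \<ge> 0\<close> and \<open>bdry C n\<close> is the map from degree \<open>n + 1\<close> to
  degree \<open>n\<close>, undefined outside its domain.  All spaces of a sequence are subspaces of one
  ambient space with scalar multiplication \<open>sc\<close>; beyond the top degree they are zero.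
\<close>

record 'v sequence =
  chain :: "nat \<Rightarrow> 'v set"
  bdry :: "nat \<Rightarrow> 'v \<Rightarrow> 'v"

definition vs_sequence ::
  "('k::field \<Rightarrow> 'v::ab_group_add \<Rightarrow> 'v) \<Rightarrow> 'v sequence \<Rightarrow> bool" where
  "vs_sequence sc C \<longleftrightarrow> (\<forall>n. Modules.module.subspace sc (chain C n) \<and>
     linear_on sc sc (chain C (Suc n)) (bdry C n) \<and> bdry C n ` chain C (Suc n) \<subseteq> chain C n)"

text \<open>
  A subcomplex consists of subspaces stable under the differentials, with the restricted
  differentials.  The vanishing of the composition of two consecutive differentials is then
  inherited from the ambient sequence.
\<close>

definition subcomplex ::
  "('k::field \<Rightarrow> 'v::ab_group_add \<Rightarrow> 'v) \<Rightarrow> 'v sequence \<Rightarrow> 'v sequence \<Rightarrow> bool" where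
  "subcomplex sc A C \<longleftrightarrow> vs_sequence sc A \<and> vs_sequence sc C \<and>
     (\<forall>n. chain A n \<subseteq> chain C n \<and> (\<forall>x\<in>chain A (Suc n). bdry A n x = bdry C n x))"


lemma subcomplex_bdry_bdry:
  assumes "subcomplex sc A C"
    and "\<And>n x. x \<in> chain C (Suc (Suc n)) \<Longrightarrow> bdry C n (bdry C (Suc n) x) = 0"
    and "x \<in> chain A (Suc (Suc n))"
  shows "bdry A n (bdry A (Suc n) x) = 0"
proof -
  have "bdry A (Suc n) x \<in> chain A (Suc n)"
    using assms(1,3) unfolding subcomplex_def vs_sequence_def by blast
  then show ?thesis
    using assms unfolding subcomplex_def by (metis subsetD)
qed


section \<open>The complexes\<close>

text \<open>
  The direct sum over \<open>F\<close> of subspaces \<open>X I\<close> of one ambient function space (\<open>F\<close> is always finite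
  here): families that vanish outside \<open>F\<close>.
\<close>

definition dsum :: "'i set \<Rightarrow> ('i \<Rightarrow> ('z \<Rightarrow> 'k::field) set) \<Rightarrow> ('i \<Rightarrow> 'z \<Rightarrow> 'k) set" where
  "dsum F X = {x. \<forall>i. if i \<in> F then x i \<in> X i else x i = 0}"

definition dscale :: "'k::field \<Rightarrow> ('i \<Rightarrow> 'z \<Rightarrow> 'k) \<Rightarrow> 'i \<Rightarrow> 'z \<Rightarrow> 'k" where
  "dscale c x = (\<lambda>i. fscale c (x i))"

context
  fixes s :: "'k::field \<Rightarrow> 'w::ab_group_add \<Rightarrow> 'w"
    and S :: "'a set" and \<I> :: "'a set set"
    and \<phi> :: "('a \<Rightarrow> 'k) \<Rightarrow> 'w"
begin

definition T_full :: "nat \<Rightarrow> ('a set \<Rightarrow> ('k, 'a, 'w) tspace) set" where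
  "T_full n = dsum (Tflats S \<I> n) (Tspace s S \<I> \<phi>)"

definition T_on :: "'a set \<Rightarrow> nat \<Rightarrow> ('a set \<Rightarrow> ('k, 'a, 'w) tspace) set" where
  "T_on Y n = dsum {I \<in> Tflats S \<I> n. I \<subseteq> Y} (Tspace s S \<I> \<phi>)"

text \<open>\<open>\<phi>\<^sub>0 : T\<^sub>0 \<rightarrow> T\<^sub>-\<^sub>1 = U\<^sub>S\<close>, where \<open>J = {the_elem J}\<close> runs over the one-element sets.\<close>

definition phi_zero :: "('a set \<Rightarrow> ('k, 'a, 'w) tspace) \<Rightarrow> ('a \<Rightarrow> 'k)" where
  "phi_zero x = (\<Sum>I\<in>Tflats S \<I> 0. \<Sum>J | J \<in> singles S \<and> J \<subseteq> I.
     fscale ((- 1) ^ card J) (phi0 s \<phi> I (the_elem J) (x I)))"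

text \<open>\<open>\<phi>\<^sub>n : T\<^sub>n \<rightarrow> T\<^sub>n\<^sub>-\<^sub>1\<close> for \<open>n = m + 1\<close>, given by its components: the summand of the
  image in \<open>T\<^sub>J\<close> collects the contributions of all \<open>I \<supset> J\<close>.\<close>

definition phi_Suc ::
  "nat \<Rightarrow> ('a set \<Rightarrow> ('k, 'a, 'w) tspace) \<Rightarrow> ('a set \<Rightarrow> ('k, 'a, 'w) tspace)" where
  "phi_Suc m x = (\<lambda>J. if J \<in> Tflats S \<I> m
     then (\<Sum>I | I \<in> Tflats S \<I> (Suc m) \<and> J \<subseteq> I.
             fscale ((- 1) ^ card J) (phi_IJ s S \<I> \<phi> I J m (x I)))
     else 0)"

text \<open>
  The sequences are truncated at \<open>\<lambda> = |S| - r\<^sub>S - 1\<close>, the level of \<open>S\<close>, which is \<open>-1\<close> if \<open>S\<close> is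
  independent.
\<close>

definition T_complex :: "('a set \<Rightarrow> ('k, 'a, 'w) tspace) sequence" where
  "T_complex = (let C = (\<lambda>n. if int n \<le> level \<I> S then T_full n else {0}) in
     \<lparr>chain = C, bdry = (\<lambda>m. restrict (phi_Suc m) (C (Suc m)))\<rparr>)"

definition T_complex_on :: "'a set \<Rightarrow> ('a set \<Rightarrow> ('k, 'a, 'w) tspace) sequence" where
  "T_complex_on Y = (let C = (\<lambda>n. if int n \<le> level \<I> S then T_on Y n else {0}) in
     \<lparr>chain = C, bdry = (\<lambda>m. restrict (phi_Suc m) (C (Suc m)))\<rparr>)"

end

text \<open>
  The augmented sequences have the terms \<open>W\<close>, \<open>U\<^sub>S\<close>, \<open>T\<^sub>0\<close>, \<open>T\<^sub>1\<close>, \<open>\<dots>\<close> in degrees \<open>0, 1, 2, 3, \<dots>\<close>.  To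
  have a common ambient space, these are placed in the three factors of a product.
\<close>

type_synonym ('k, 'a, 'w) plus_space =
  "'w \<times> ('a \<Rightarrow> 'k) \<times> ('a set \<Rightarrow> ('k, 'a, 'w) tspace)"

definition plus_scale ::
  "('k::field \<Rightarrow> 'w::ab_group_add \<Rightarrow> 'w) \<Rightarrow> 'k \<Rightarrow>
     ('k, 'a, 'w) plus_space \<Rightarrow> ('k, 'a, 'w) plus_space" where
  "plus_scale s c = (\<lambda>(w, u, x). (s c w, fscale c u, dscale c x))"

context
  fixes s :: "'k::field \<Rightarrow> 'w::ab_group_add \<Rightarrow> 'w"
    and S :: "'a set" and \<I> :: "'a set set"
    and \<phi> :: "('a \<Rightarrow> 'k) \<Rightarrow> 'w"
begin

fun plus_chain ::
  "('a \<Rightarrow> 'k) set \<Rightarrow> (nat \<Rightarrow> ('a set \<Rightarrow> ('k, 'a, 'w) tspace) set) \<Rightarrow> nat \<Rightarrow>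
     ('k, 'a, 'w) plus_space set" where
  "plus_chain Z C 0 = UNIV \<times> {0} \<times> {0}"
| "plus_chain Z C (Suc 0) = {0} \<times> Z \<times> {0}"
| "plus_chain Z C (Suc (Suc n)) = {0} \<times> {0} \<times> C n"

text \<open>\<open>plus_bdry n\<close> is \<open>\<phi>\<^sup>+\<close> from degree \<open>n + 1\<close> to degree \<open>n\<close>.\<close>

fun plus_bdry :: "nat \<Rightarrow> ('k, 'a, 'w) plus_space \<Rightarrow> ('k, 'a, 'w) plus_space" where
  "plus_bdry 0 (w, u, x) = (\<phi> u, 0, 0)"
| "plus_bdry (Suc 0) (w, u, x) = (0, phi_zero s S \<I> \<phi> x, 0)"
| "plus_bdry (Suc (Suc m)) (w, u, x) = (0, 0, phi_Suc s S \<I> \<phi> m x)"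

definition T_plus :: "('k, 'a, 'w) plus_space sequence" where
  "T_plus = (let C = plus_chain (U S) (chain (T_complex s S \<I> \<phi>)) in
     \<lparr>chain = C, bdry = (\<lambda>n. restrict (plus_bdry n) (C (Suc n)))\<rparr>)"

text \<open>In degree \<open>1\<close> the restriction to \<open>Y\<close> is the sum of the \<open>U\<^sub>a\<close> with \<open>a \<in> Y\<close>, that is, \<open>U\<^sub>Y\<close>.\<close>

definition T_plus_on :: "'a set \<Rightarrow> ('k, 'a, 'w) plus_space sequence" where
  "T_plus_on Y = (let C = plus_chain (U Y) (chain (T_complex_on s S \<I> \<phi> Y)) in
     \<lparr>chain = C, bdry = (\<lambda>n. restrict (plus_bdry n) (C (Suc n)))\<rparr>)"

end

end

theory Submission
  imports Defs
begin

text \<open>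
  The corank formula for the dual matroid shows that \<open>A\<close> is a T-flat iff it is nonempty and
  deleting a point does not lower its rank. This condition, like the level, depends only on the
  independent subsets of \<open>A\<close>, so the T-flats and chains of \<open>M|Y\<close> are those of \<open>M\<close> contained in
  \<open>Y\<close>, and the spaces \<open>T\<^sub>I\<close> with \<open>I \<subseteq> Y\<close> agree. A component \<open>T\<^sub>I \<rightarrow> T\<^sub>J\<close> has \<open>J \<subseteq> I\<close>, so a sum over
  \<open>I \<subseteq> Y\<close> is stable under the differentials. What needs care is that the components really
  are linear maps \<open>T\<^sub>I \<rightarrow> T\<^sub>J\<close>: the inverses entering them exist because top exterior powers are
  lines, a wedge of bases of two complementary subspaces being a generator, and the dual of
  multiplication exists because \<open>D\<close> is finite-dimensional. The final contraction lands in \<open>T\<^sub>J\<close>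
  whatever its scalar factor is, so nothing about \<open>b\<close> and \<open>\<mu>\<close> is needed.
\<close>

text \<open>The two sequences of part (a), and likewise those of part (b), are claimed to be equal
  as records: the spaces must be the same sets and the differentials the same functions, not merely
  isomorphic data. The models make this possible. An element of a tensor, exterior or symmetric
  power is a function on forms that returns 0 at anything failing the test of being a form on the
  given subspaces. Maps written as substitutions in the argument are therefore linear on the whole
  ambient type, and a value depends on a form only through its restriction to the subspaces, so
  whatever distinguishes \<open>\<phi>\<close> from its restriction outside \<open>U Y\<close> is
  invisible. The price is that evaluation is additive only at genuine forms, so every nested
  evaluation needs a proof that the inner one is again a form. The delicate point is
  \<open>lift_a\<close>, which picks a lift separately for each element: before the product defining
  \<open>amap\<close> can be seen to be bilinear, it has to be shown independent of the
  lift.\<close>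

lemma vector_space_fscale: "vector_space (fscale :: 'k::field \<Rightarrow> ('x \<Rightarrow> 'k) \<Rightarrow> _)"
  by unfold_locales (auto simp: fscale_def fun_eq_iff algebra_simps)

interpretation fs: vector_space fscale
  by (rule vector_space_fscale)

lemma fscale_apply: "fscale c f x = c * f x"
  by (simp add: fscale_def)

section \<open>Linear maps defined on subspaces of an ambient type\<close>

lemma linear_on_cong:
  assumes "Modules.module.subspace s X" "vector_space s" "\<And>x. x \<in> X \<Longrightarrow> f x = g x"
  shows "linear_on s s' X f \<longleftrightarrow> linear_on s s' X g"
proof -
  interpret m: vector_space s by fact
  show ?thesis
    using assms m.subspace_add m.subspace_scale unfolding linear_on_def by auto
qed

lemma linear_on_subset: "linear_on s s' X f \<Longrightarrow> X' \<subseteq> X \<Longrightarrow> linear_on s s' X' f"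
  unfolding linear_on_def by blast

lemma linear_on_compose:
  assumes "linear_on s s' X f" "linear_on s' s'' Y g" "f ` X \<subseteq> Y"
  shows "linear_on s s'' X (\<lambda>x. g (f x))"
  using assms unfolding linear_on_def by (auto simp: image_subset_iff)

text \<open>Linearity is available on the span only, so the induction carries membership in the span
  along with the claim. This is the standard way below of reducing a statement about tensors, wedges
  or symmetric products to generators.\<close>

lemma linear_on_span_mem:
  assumes "vector_space s" "vector_space s'" "linear_on s s' (Modules.module.span s B) f"
    and "\<And>b. b \<in> B \<Longrightarrow> f b \<in> Z" "Modules.module.subspace s' Z" "x \<in> Modules.module.span s B"
  shows "f x \<in> Z"
proof -
  interpret m: vector_space s by fact
  interpret m': vector_space s' by fact
  have f0: "f 0 = 0"
    using assms(3) m.span_zero[of B] unfolding linear_on_def by (metis m.scale_zero_left m'.scale_zero_left)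
  from assms(6) have "x \<in> m.span B \<and> f x \<in> Z"
  proof (induction rule: m.span_induct_alt)
    case base
    show ?case using f0 m'.subspace_0[OF assms(5)] by (simp add: m.span_zero)
  next
    case (step c x y)
    have "x \<in> m.span B" using step by (simp add: m.span_base)
    then show ?case
      using step assms(3-5) m'.subspace_add m'.subspace_scale
      by (auto simp: linear_on_def m.span_scale m.span_add)
  qed
  then show ?thesis by blast
qed

lemma linear_on_span_eq:
  assumes "vector_space s" "vector_space s'" "linear_on s s' (Modules.module.span s B) f"
    and "linear_on s s' (Modules.module.span s B) g"
    and "\<And>b. b \<in> B \<Longrightarrow> f b = g b" "x \<in> Modules.module.span s B"
  shows "f x = g x"
proof -
  interpret m': vector_space s' by fact
  have "linear_on s s' (Modules.module.span s B) (\<lambda>x. f x - g x)"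
    using assms(3,4) by (auto simp: linear_on_def m'.scale_right_diff_distrib)
  from linear_on_span_mem[OF assms(1,2) this, of "{0}"] show ?thesis
    using assms by (auto simp: m'.subspace_single_0)
qed

lemma linear_on_subspace_image:
  assumes "vector_space s" "vector_space s'" "linear_on s s' X f" "Modules.module.subspace s X"
  shows "Modules.module.subspace s' (f ` X)"
proof -
  interpret m: vector_space s by fact
  interpret m': vector_space s' by fact
  show ?thesis
  proof (rule m'.subspaceI)
    show "0 \<in> f ` X"
      using assms(3) m.subspace_0[OF assms(4)] unfolding linear_on_def
      by (metis image_eqI m'.scale_zero_left m.scale_zero_left)
  qed (use assms(3) m.subspace_add[OF assms(4)] m.subspace_scale[OF assms(4)] in
      \<open>auto simp: linear_on_def image_iff intro: bexI[rotated]\<close>, metis+)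
qed

lemma linear_on_span_image:
  assumes "vector_space s" "vector_space s'" "linear_on s s' (Modules.module.span s B) f"
  shows "f ` Modules.module.span s B = Modules.module.span s' (f ` B)"
proof
  interpret m: vector_space s by fact
  interpret m': vector_space s' by fact
  show "f ` m.span B \<subseteq> m'.span (f ` B)"
    using linear_on_span_mem[OF assms, of "m'.span (f ` B)"] by (auto intro: m'.span_base)
  show "m'.span (f ` B) \<subseteq> f ` m.span B"
    by (intro m'.span_minimal image_mono linear_on_subspace_image[OF assms] m.span_superset m.subspace_span)
qed

lemma linear_on_fun_iff:
  "linear_on s fscale X f \<longleftrightarrow> (\<forall>z. linear_on s (*) X (\<lambda>x. f x z))"
  unfolding linear_on_def by (auto simp: fun_eq_iff fscale_def)

text \<open>The elements of the models of tensor, exterior and symmetric powers are combinations of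
  partially defined evaluations, so identities between their values reduce to generators.\<close>

lemma fspan_apply_combination:
  assumes "t \<in> fspan G" "\<And>g. g \<in> G \<Longrightarrow> g \<gamma> = a * g \<alpha> + b * g \<beta>"
  shows "t \<gamma> = a * t \<alpha> + b * t \<beta>"
  using assms(1)
proof (induction rule: fs.span_induct_alt)
  case (step c x y)
  have "x \<gamma> = a * x \<alpha> + b * x \<beta>" using step assms(2) by blast
  with step show ?case by (simp add: fscale_def algebra_simps)
qed simp

lemma fspan_apply_cong:
  assumes "t \<in> fspan G" "\<And>g. g \<in> G \<Longrightarrow> g \<alpha> = g \<beta>"
  shows "t \<alpha> = t \<beta>"
  using fspan_apply_combination[OF assms(1), of \<alpha> 1 \<beta> 0 \<beta>] assms(2) by auto


section \<open>Tensor products\<close>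

definition bilinear_map ::
  "('x \<Rightarrow> 'k::field) set \<Rightarrow> ('y \<Rightarrow> 'k) set \<Rightarrow> (('x \<Rightarrow> 'k) \<Rightarrow> ('y \<Rightarrow> 'k) \<Rightarrow> ('z \<Rightarrow> 'k)) \<Rightarrow> bool" where
  "bilinear_map X Y \<beta> \<longleftrightarrow>
     (\<forall>x\<in>X. linear_on fscale fscale Y (\<beta> x)) \<and> (\<forall>y\<in>Y. linear_on fscale fscale X (\<lambda>x. \<beta> x y))"

lemma bilinear_mapI:
  assumes "\<And>x. x \<in> X \<Longrightarrow> linear_on fscale fscale Y (\<beta> x)"
    and "\<And>y. y \<in> Y \<Longrightarrow> linear_on fscale fscale X (\<lambda>x. \<beta> x y)"
  shows "bilinear_map X Y \<beta>"
  using assms unfolding bilinear_map_def by blast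

lemma bilinear_map_form: "bilinear_map X Y \<beta> \<Longrightarrow> bilinear_form X Y (\<lambda>x y. \<beta> x y z)"
  unfolding bilinear_map_def bilinear_form_def linear_on_fun_iff by blast

text \<open>\<open>pure\<close> tests whether its argument is a bilinear form; changing the argument
  outside \<open>X\<close> and \<open>Y\<close> must not change the outcome of the test.\<close>

lemma bilinear_form_cong:
  assumes "fs.subspace X" "fs.subspace Y" "\<And>x y. x \<in> X \<Longrightarrow> y \<in> Y \<Longrightarrow> \<beta> x y = \<beta>' x y"
  shows "bilinear_form X Y \<beta> \<longleftrightarrow> bilinear_form X Y \<beta>'"
  unfolding bilinear_form_def
  by (intro conj_cong ball_cong refl linear_on_cong assms vector_space_fscale)

lemma bilinear_map_cong:
  assumes "fs.subspace X" "fs.subspace Y" "\<And>x y. x \<in> X \<Longrightarrow> y \<in> Y \<Longrightarrow> \<beta> x y = \<beta>' x y"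
  shows "bilinear_map X Y \<beta> \<longleftrightarrow> bilinear_map X Y \<beta>'"
  unfolding bilinear_map_def
  by (intro conj_cong ball_cong refl linear_on_cong assms vector_space_fscale)

lemma bilinear_map_compose:
  assumes "bilinear_map X' Y' \<beta>" "linear_on fscale fscale X f" "f ` X \<subseteq> X'"
    and "linear_on fscale fscale Y g" "g ` Y \<subseteq> Y'"
  shows "bilinear_map X Y (\<lambda>x y. \<beta> (f x) (g y))"
proof (rule bilinear_mapI)
  fix x assume "x \<in> X"
  then have "linear_on fscale fscale Y' (\<beta> (f x))" using assms(1,3) by (auto simp: bilinear_map_def)
  from linear_on_compose[OF assms(4) this assms(5)]
  show "linear_on fscale fscale Y (\<lambda>y. \<beta> (f x) (g y))" .
next
  fix y assume "y \<in> Y"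
  then have "linear_on fscale fscale X' (\<lambda>x. \<beta> x (g y))" using assms(1,5) by (auto simp: bilinear_map_def)
  from linear_on_compose[OF assms(2) this assms(3)]
  show "linear_on fscale fscale X (\<lambda>x. \<beta> (f x) (g y))" .
qed

lemma bilinear_map_pure: "bilinear_map X Y (pure X Y)"
  unfolding bilinear_map_def pure_def bilinear_form_def linear_on_def
  by (auto simp: fun_eq_iff fscale_def)

lemma pure_in_tensor: "x \<in> X \<Longrightarrow> y \<in> Y \<Longrightarrow> pure X Y x y \<in> tensor X Y"
  unfolding tensor_def by (auto intro: fs.span_base)

lemma subspace_tensor [simp]: "fs.subspace (tensor X Y)"
  unfolding tensor_def by simp

text \<open>Locality of tensors: both the test in \<open>pure\<close> and the value see a form only
  on \<open>X\<close> and \<open>Y\<close>. Through \<open>tlift_cong\<close> this later allows a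
  map to be replaced by one that agrees with it on the relevant subspaces.\<close>

lemma tensor_apply_cong:
  assumes "t \<in> tensor X Y" "fs.subspace X" "fs.subspace Y"
    and "\<And>x y. x \<in> X \<Longrightarrow> y \<in> Y \<Longrightarrow> \<beta> x y = \<beta>' x y"
  shows "t \<beta> = t \<beta>'"
  using assms(1) unfolding tensor_def
proof (rule fspan_apply_cong)
  show "g \<beta> = g \<beta>'" if "g \<in> {pure X Y x y |x y. x \<in> X \<and> y \<in> Y}" for g
    using that bilinear_form_cong[OF assms(2-4)] assms(4) by (auto simp: pure_def)
qed

lemma tensor_apply_combination:
  assumes "t \<in> tensor X Y" "bilinear_form X Y \<alpha>" "bilinear_form X Y \<beta>"
  shows "t (\<lambda>x y. a * \<alpha> x y + b * \<beta> x y) = a * t \<alpha> + b * t \<beta>"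
  using assms(1) unfolding tensor_def
proof (rule fspan_apply_combination)
  have "bilinear_form X Y (\<lambda>x y. a * \<alpha> x y + b * \<beta> x y)"
    using assms(2,3) unfolding bilinear_form_def linear_on_def by (auto simp: algebra_simps)
  then show "g (\<lambda>x y. a * \<alpha> x y + b * \<beta> x y) = a * g \<alpha> + b * g \<beta>"
    if "g \<in> {pure X Y x y |x y. x \<in> X \<and> y \<in> Y}" for g
    using that assms(2,3) by (auto simp: pure_def)
qed

text \<open>\<open>tlift \<beta> t\<close> evaluates \<open>t\<close> at arguments that do not
  depend on \<open>t\<close>, which makes it linear in \<open>t\<close> on any set; bilinearity of
  \<beta> enters through the values on pure tensors in \<open>tlift_pure\<close>.\<close>

lemma linear_tlift: "linear_on fscale fscale X (tlift \<beta>)"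
  unfolding linear_on_def tlift_def by (auto simp: fun_eq_iff fscale_def)

lemma tlift_pure:
  "bilinear_map X Y \<beta> \<Longrightarrow> tlift \<beta> (pure X Y x y) = \<beta> x y"
  unfolding tlift_def pure_def by (auto simp: bilinear_map_form)

lemma tlift_cong:
  assumes "t \<in> tensor X Y" "fs.subspace X" "fs.subspace Y"
    and "\<And>x y. x \<in> X \<Longrightarrow> y \<in> Y \<Longrightarrow> \<beta> x y = \<beta>' x y"
  shows "tlift \<beta> t = tlift \<beta>' t"
  unfolding tlift_def by (rule ext) (rule tensor_apply_cong[OF assms(1-3)], simp add: assms(4))

lemma tlift_mem:
  assumes "t \<in> tensor X Y" "bilinear_map X Y \<beta>" "fs.subspace Z"
    and "\<And>x y. x \<in> X \<Longrightarrow> y \<in> Y \<Longrightarrow> \<beta> x y \<in> Z"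
  shows "tlift \<beta> t \<in> Z"
  using vector_space_fscale vector_space_fscale linear_tlift _ assms(3) assms(1)[unfolded tensor_def]
  by (rule linear_on_span_mem) (auto simp: tlift_pure[OF assms(2)] assms(4))

text \<open>Linearity in the parameter, unlike linearity in \<open>t\<close>, is not formal: a
  tensor is additive as a function on forms only at bilinear forms, so \<open>bil\<close> is
  required besides the pointwise linearity \<open>lin\<close>. This is what permits nesting
  \<open>tlift\<close>.\<close>

lemma linear_tlift_parameter:
  assumes t: "t \<in> tensor X Y" and X: "fs.subspace X" and Y: "fs.subspace Y" and A: "fs.subspace A"
    and bil: "\<And>p. p \<in> A \<Longrightarrow> bilinear_map X Y (\<beta> p)"
    and lin: "\<And>x y. x \<in> X \<Longrightarrow> y \<in> Y \<Longrightarrow> linear_on fscale fscale A (\<lambda>p. \<beta> p x y)"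
  shows "linear_on fscale fscale A (\<lambda>p. tlift (\<beta> p) t)"
  unfolding linear_on_def
proof (intro conjI ballI allI)
  fix p q assume pq: "p \<in> A" "q \<in> A"
  have "tlift (\<beta> (p + q)) t = tlift (\<lambda>x y. \<beta> p x y + \<beta> q x y) t"
    using lin pq by (intro tlift_cong[OF t X Y]) (simp add: linear_on_def)
  also have "\<dots> = tlift (\<beta> p) t + tlift (\<beta> q) t"
    using tensor_apply_combination[OF t bilinear_map_form[OF bil[OF pq(1)]]
        bilinear_map_form[OF bil[OF pq(2)]], of 1 _ 1]
    by (simp add: tlift_def fun_eq_iff)
  finally show "tlift (\<beta> (p + q)) t = tlift (\<beta> p) t + tlift (\<beta> q) t" .
next
  fix c p assume p: "p \<in> A"
  have "tlift (\<beta> (fscale c p)) t = tlift (\<lambda>x y. fscale c (\<beta> p x y)) t"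
    using lin p by (intro tlift_cong[OF t X Y]) (simp add: linear_on_def)
  also have "\<dots> = fscale c (tlift (\<beta> p) t)"
    using tensor_apply_combination[OF t bilinear_map_form[OF bil[OF p]]
        bilinear_map_form[OF bil[OF p]], of c _ 0]
    by (simp add: tlift_def fun_eq_iff fscale_def)
  finally show "tlift (\<beta> (fscale c p)) t = fscale c (tlift (\<beta> p) t)" .
qed

lemma bilinear_map_pure_compose:
  assumes "linear_on fscale fscale X f" "f ` X \<subseteq> X'" "linear_on fscale fscale Y g" "g ` Y \<subseteq> Y'"
  shows "bilinear_map X Y (\<lambda>x y. pure X' Y' (f x) (g y))"
  by (rule bilinear_map_compose[OF bilinear_map_pure assms])

lemma linear_tmap: "linear_on fscale fscale X (tmap X' Y' f g)"
  unfolding tmap_def by (rule linear_tlift)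

lemma tmap_mem:
  assumes "linear_on fscale fscale X f" "f ` X \<subseteq> X'" "linear_on fscale fscale Y g" "g ` Y \<subseteq> Y'"
  shows "tmap X' Y' f g ` tensor X Y \<subseteq> tensor X' Y'"
proof
  fix u assume "u \<in> tmap X' Y' f g ` tensor X Y"
  then obtain t where t: "t \<in> tensor X Y" "u = tmap X' Y' f g t" by blast
  show "u \<in> tensor X' Y'" unfolding t(2) tmap_def
    using assms by (intro tlift_mem[OF t(1) bilinear_map_pure_compose[OF assms]])
      (auto intro: pure_in_tensor)
qed

lemma tmap_cong:
  assumes "t \<in> tensor X Y" "fs.subspace X" "fs.subspace Y"
    and "\<And>x. x \<in> X \<Longrightarrow> f x = f' x" "\<And>y. y \<in> Y \<Longrightarrow> g y = g' y"
  shows "tmap X' Y' f g t = tmap X' Y' f' g' t"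
  unfolding tmap_def by (rule tlift_cong[OF assms(1-3)]) (simp add: assms)

lemma bilinear_map_span_mem:
  assumes bil: "bilinear_map (fspan A) (fspan B) \<beta>" and x: "x \<in> fspan A" and y: "y \<in> fspan B"
    and Z: "fs.subspace Z" and gen: "\<And>a b. a \<in> A \<Longrightarrow> b \<in> B \<Longrightarrow> \<beta> a b \<in> Z"
  shows "\<beta> x y \<in> Z"
proof (rule linear_on_span_mem[OF vector_space_fscale vector_space_fscale _ _ Z x])
  show "linear_on fscale fscale (fspan A) (\<lambda>x. \<beta> x y)" using bil y by (simp add: bilinear_map_def)
  fix a assume a: "a \<in> A"
  show "\<beta> a y \<in> Z"
  proof (rule linear_on_span_mem[OF vector_space_fscale vector_space_fscale _ _ Z y])
    show "linear_on fscale fscale (fspan B) (\<beta> a)"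
      using bil fs.span_base[OF a] by (simp add: bilinear_map_def)
  qed (rule gen[OF a])
qed

lemma tensor_lines:
  "tensor (fspan {a}) (fspan {b}) = fspan {pure (fspan {a}) (fspan {b}) a b}"
proof
  show "fspan {pure (fspan {a}) (fspan {b}) a b} \<subseteq> tensor (fspan {a}) (fspan {b})"
    by (rule fs.span_minimal) (auto intro!: pure_in_tensor fs.span_base)
  show "tensor (fspan {a}) (fspan {b}) \<subseteq> fspan {pure (fspan {a}) (fspan {b}) a b}"
    unfolding tensor_def
  proof (rule fs.span_minimal)
    have "pure (fspan {a}) (fspan {b}) x y \<in> fspan {pure (fspan {a}) (fspan {b}) a b}"
      if "x \<in> fspan {a}" "y \<in> fspan {b}" for x y
      by (rule bilinear_map_span_mem[OF bilinear_map_pure that])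
        (auto intro: fs.span_base)
    then show "{pure (fspan {a}) (fspan {b}) x y |x y. x \<in> fspan {a} \<and> y \<in> fspan {b}}
        \<subseteq> fspan {pure (fspan {a}) (fspan {b}) a b}" by blast
  qed simp
qed

lemma linear_inj_on_line:
  assumes "linear_on fscale fscale (fspan {a}) f" "f a \<noteq> 0"
  shows "inj_on f (fspan {a})" "f ` fspan {a} = fspan {f a}"
proof -
  have a: "a \<in> fspan {a}" by (simp add: fs.span_base)
  show "inj_on f (fspan {a})"
  proof (rule inj_onI)
    fix x y assume "x \<in> fspan {a}" "y \<in> fspan {a}" and eq: "f x = f y"
    then obtain c d where cd: "x = fscale c a" "y = fscale d a" by (auto simp: fs.span_singleton)
    have "fscale c (f a) = fscale d (f a)" using eq cd a assms(1) by (simp add: linear_on_def)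
    then show "x = y" using assms(2) cd by simp
  qed
  show "f ` fspan {a} = fspan {f a}"
    using linear_on_span_image[OF vector_space_fscale vector_space_fscale assms(1)] by simp
qed

lemma linear_inv_into:
  assumes "vector_space s" "vector_space s'" "linear_on s s' X f" "inj_on f X" "Modules.module.subspace s X"
  shows "linear_on s' s (f ` X) (inv_into X f)"
  unfolding linear_on_def
proof (intro conjI ballI allI)
  interpret m: vector_space s by fact
  interpret m': vector_space s' by fact
  fix x y assume "x \<in> f ` X" "y \<in> f ` X"
  then obtain x' y' where *: "x' \<in> X" "y' \<in> X" "x = f x'" "y = f y'" by blast
  then have "x + y = f (x' + y')" using assms(3) by (simp add: linear_on_def)
  with * show "inv_into X f (x + y) = inv_into X f x + inv_into X f y"
    using assms(4,5) m.subspace_add by simp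
next
  interpret m: vector_space s by fact
  interpret m': vector_space s' by fact
  fix c x assume "x \<in> f ` X"
  then obtain x' where *: "x' \<in> X" "x = f x'" by blast
  then have "s' c x = f (s c x')" using assms(3) by (simp add: linear_on_def)
  with * show "inv_into X f (s' c x) = s c (inv_into X f x)"
    using assms(4,5) m.subspace_scale by simp
qed

text \<open>\<open>delta\<close> and \<open>amap\<close> are both inverses of a product of two lines
  with values in a line. If the product of the generators is nonzero, the induced map on the tensor
  product is a bijection between lines, and its inverse is linear.\<close>

lemma inv_tlift_lines:
  assumes bil: "bilinear_map (fspan {a}) (fspan {b}) \<beta>" and "\<beta> a b \<noteq> 0"
  defines "T \<equiv> tensor (fspan {a}) (fspan {b})"
  shows "linear_on fscale fscale (fspan {\<beta> a b}) (inv_into T (tlift \<beta>))"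
    and "inv_into T (tlift \<beta>) ` fspan {\<beta> a b} \<subseteq> T"
proof -
  let ?p = "pure (fspan {a}) (fspan {b}) a b"
  have p: "tlift \<beta> ?p = \<beta> a b" by (rule tlift_pure[OF bil])
  have T: "T = fspan {?p}" unfolding T_def by (rule tensor_lines)
  have "linear_on fscale fscale (fspan {?p}) (tlift \<beta>)" by (rule linear_tlift)
  note * = linear_inj_on_line[OF this, unfolded p, OF assms(2)]
  show "linear_on fscale fscale (fspan {\<beta> a b}) (inv_into T (tlift \<beta>))"
    using linear_inv_into[OF vector_space_fscale vector_space_fscale linear_tlift *(1)] *(2) T by simp
  show "inv_into T (tlift \<beta>) ` fspan {\<beta> a b} \<subseteq> T"
    using *(2) T by (auto intro: inv_into_into)
qed

section \<open>Exterior powers\<close>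

text \<open>Bases are lists because a wedge depends on the order of its factors; the list also
  encodes finite dimension.\<close>

definition basis_list ::
  "('k::field \<Rightarrow> 'x::ab_group_add \<Rightarrow> 'x) \<Rightarrow> 'x set \<Rightarrow> 'x list \<Rightarrow> bool" where
  "basis_list s X bs \<longleftrightarrow>
     distinct bs \<and> \<not> Modules.module.dependent s (set bs) \<and> Modules.module.span s (set bs) = X"

section \<open>Wedges of bases and top exterior powers\<close>

context vector_space
begin

text \<open>Substitution at a position is rephrased as a splitting of the list, the shape in which
  factors are moved and lists are concatenated later.\<close>

lemma multilinear_form_linear:
  assumes "multilinear_form scale X d \<alpha>" "subspace X" "set ps \<subseteq> X" "set qs \<subseteq> X"
    and "d = Suc (length ps + length qs)"
  shows "linear_on scale (*) X (\<lambda>x. \<alpha> (ps @ x # qs))"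
  using assms(1,3-5) subspace_0[OF assms(2)] unfolding multilinear_form_def
  by (auto dest!: spec[of _ "ps @ 0 # qs"] spec[of _ "length ps"])

lemma multilinear_formI:
  assumes "\<And>ps qs. set ps \<subseteq> X \<Longrightarrow> set qs \<subseteq> X \<Longrightarrow> d = Suc (length ps + length qs) \<Longrightarrow>
    linear_on scale (*) X (\<lambda>x. \<alpha> (ps @ x # qs))"
  shows "multilinear_form scale X d \<alpha>"
  unfolding multilinear_form_def
proof (intro allI impI)
  fix xs :: "'b list" and i assume *: "length xs = d \<and> set xs \<subseteq> X \<and> i < d"
  have "linear_on scale (*) X (\<lambda>x. \<alpha> (take i xs @ x # drop (Suc i) xs))"
    by (rule assms) (use * set_take_subset[of i xs] set_drop_subset[of "Suc i" xs] in auto)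
  then show "linear_on scale (*) X (\<lambda>x. \<alpha> (xs[i := x]))"
    using * by (simp add: upd_conv_take_nth_drop)
qed

lemma alternating_form_cong:
  assumes "subspace X" "\<And>xs. length xs = d \<Longrightarrow> set xs \<subseteq> X \<Longrightarrow> \<alpha> xs = \<beta> xs"
  shows "alternating_form scale X d \<alpha> \<longleftrightarrow> alternating_form scale X d \<beta>"
proof -
  have "linear_on scale (*) X (\<lambda>x. \<alpha> (xs[i := x])) \<longleftrightarrow> linear_on scale (*) X (\<lambda>x. \<beta> (xs[i := x]))"
    if "length xs = d" "set xs \<subseteq> X" for xs i
    using that set_update_subsetI
    by (intro linear_on_cong assms vector_space_axioms) (simp_all add: set_update_subsetI)
  then show ?thesis
    unfolding alternating_form_def multilinear_form_def using assms(2) by auto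
qed

lemma alternating_form_combination:
  assumes "alternating_form scale X d \<alpha>" "alternating_form scale X d \<beta>"
  shows "alternating_form scale X d (\<lambda>xs. a * \<alpha> xs + b * \<beta> xs)"
  using assms unfolding alternating_form_def multilinear_form_def linear_on_def
  by (auto simp: algebra_simps)

lemma wedge_in_ext_power: "set xs \<subseteq> X \<Longrightarrow> wedge scale X xs \<in> ext_power scale (length xs) X"
  unfolding ext_power_def by (auto intro: fs.span_base)

lemma subspace_ext_power [simp]: "fs.subspace (ext_power scale d X)"
  unfolding ext_power_def by simp

lemma ext_power_apply_cong:
  assumes "\<omega> \<in> ext_power scale d X" "subspace X"
    and "\<And>xs. length xs = d \<Longrightarrow> set xs \<subseteq> X \<Longrightarrow> \<alpha> xs = \<beta> xs"
  shows "\<omega> \<alpha> = \<omega> \<beta>"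
  using assms(1) unfolding ext_power_def
  by (rule fspan_apply_cong) (use alternating_form_cong[OF assms(2,3)] assms(3) in \<open>auto simp: wedge_def\<close>)

lemma ext_power_apply_combination:
  assumes "\<omega> \<in> ext_power scale d X" "alternating_form scale X d \<alpha>" "alternating_form scale X d \<beta>"
  shows "\<omega> (\<lambda>xs. a * \<alpha> xs + b * \<beta> xs) = a * \<omega> \<alpha> + b * \<omega> \<beta>"
  using assms(1) unfolding ext_power_def
  by (rule fspan_apply_combination)
    (use assms(2,3) alternating_form_combination in \<open>auto simp: wedge_def\<close>)

lemma linear_wedge:
  assumes "subspace X" "set ps \<subseteq> X" "set qs \<subseteq> X"
  shows "linear_on scale fscale X (\<lambda>x. wedge scale X (ps @ x # qs))"
  unfolding linear_on_fun_iff
proof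
  fix \<alpha>
  show "linear_on scale (*) X (\<lambda>x. wedge scale X (ps @ x # qs) \<alpha>)"
    using multilinear_form_linear[of X _ \<alpha> ps qs] assms
    by (cases "alternating_form scale X (Suc (length ps + length qs)) \<alpha>")
      (auto simp: wedge_def alternating_form_def linear_on_def)
qed

lemma wedge_not_distinct: "set xs \<subseteq> X \<Longrightarrow> \<not> distinct xs \<Longrightarrow> wedge scale X xs = 0"
  unfolding wedge_def alternating_form_def by (auto simp: fun_eq_iff)

text \<open>Polarization: a wedge with the factor \<open>x + y\<close> in two adjacent places
  vanishes, and expanding it leaves the two mixed terms. No division by 2 occurs.\<close>

lemma wedge_swap:
  assumes "subspace X" "set ps \<subseteq> X" "x \<in> X" "y \<in> X" "set qs \<subseteq> X"
  shows "wedge scale X (ps @ x # y # qs) = - wedge scale X (ps @ y # x # qs)"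
proof -
  let ?w = "\<lambda>x y. wedge scale X (ps @ x # y # qs)"
  have xy: "x + y \<in> X" using assms subspace_add by blast
  have l: "?w (u + u') v = ?w u v + ?w u' v" if "u \<in> X" "u' \<in> X" "v \<in> X" for u u' v
    using linear_wedge[of X ps "v # qs"] assms that by (simp add: linear_on_def)
  have r: "?w v (u + u') = ?w v u + ?w v u'" if "u \<in> X" "u' \<in> X" "v \<in> X" for u u' v
    using linear_wedge[of X "ps @ [v]" qs] assms that by (simp add: linear_on_def)
  have z: "?w u u = 0" if "u \<in> X" for u
    using that assms by (intro wedge_not_distinct) auto
  have "0 = ?w (x + y) (x + y)" using z[OF xy] by simp
  also have "\<dots> = (?w x x + ?w x y) + (?w y x + ?w y y)"
    by (simp add: l r assms xy)
  finally show ?thesis using z assms by (simp add: eq_neg_iff_add_eq_0)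
qed

text \<open>Signs are absorbed by passing to the line of the target wedge, so that no parity of a
  permutation has to be tracked.\<close>

lemma wedge_move:
  assumes "subspace X" "set us \<subseteq> X" "x \<in> X" "set vs \<subseteq> X" "set ps \<subseteq> X"
  shows "wedge scale X (ps @ x # us @ vs) \<in> fspan {wedge scale X (ps @ us @ x # vs)}"
  using assms
proof (induction us arbitrary: ps)
  case (Cons u us)
  have "wedge scale X ((ps @ [u]) @ x # us @ vs) \<in> fspan {wedge scale X ((ps @ [u]) @ us @ x # vs)}"
    by (rule Cons.IH) (use Cons.prems in auto)
  moreover have "wedge scale X (ps @ x # u # us @ vs) = - wedge scale X (ps @ u # x # us @ vs)"
    using wedge_swap[of X ps x u "us @ vs"] Cons.prems by simp
  ultimately show ?case by (metis append.assoc append_Cons append_Nil fs.span_neg)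
qed (auto intro: fs.span_base)

lemma wedge_permute:
  assumes "subspace X" "mset xs = mset ys" "set xs \<subseteq> X" "set ps \<subseteq> X"
  shows "wedge scale X (ps @ xs) \<in> fspan {wedge scale X (ps @ ys)}"
  using assms
proof (induction xs arbitrary: ps ys)
  case (Cons x xs)
  from Cons.prems(2) have "x \<in> set ys" by (metis list.set_intros(1) mset_eq_setD)
  then obtain us vs where ys: "ys = us @ x # vs" by (auto simp: in_set_conv_decomp)
  have "mset xs = mset (us @ vs)" using Cons.prems(2) ys by simp
  moreover have sets: "set us \<subseteq> X" "set vs \<subseteq> X"
    using Cons.prems(3) mset_eq_setD[OF Cons.prems(2)] ys by auto
  ultimately have "wedge scale X ((ps @ [x]) @ xs) \<in> fspan {wedge scale X ((ps @ [x]) @ us @ vs)}"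
    using Cons.prems by (intro Cons.IH) auto
  moreover have "fspan {wedge scale X ((ps @ [x]) @ us @ vs)} \<subseteq> fspan {wedge scale X (ps @ ys)}"
    using wedge_move[of X us x vs ps] Cons.prems sets
    by (intro fs.span_minimal) (auto simp: ys)
  ultimately show ?case by auto
qed (auto intro: fs.span_base)

lemma basis_list_subset: "basis_list scale X bs \<Longrightarrow> set bs \<subseteq> X"
  unfolding basis_list_def by (auto intro: span_base)

lemma basis_list_subspace: "basis_list scale X bs \<Longrightarrow> subspace X"
  unfolding basis_list_def by auto

lemma basis_list_dim: "basis_list scale X bs \<Longrightarrow> dim X = length bs"
  unfolding basis_list_def by (metis dim_span_eq_card_independent distinct_card)

text \<open>The factors are expanded in the basis from left to right, \<open>ps\<close> holding
  those already replaced by basis vectors. Once all are replaced, either some vector is repeated and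
  the wedge is 0, or \<open>ps\<close> is a rearrangement of the basis, its length being that of
  \<open>bs\<close>.\<close>

lemma wedge_in_line:
  assumes bs: "basis_list scale X bs" and "set xs \<subseteq> X" "length xs = length bs"
  shows "wedge scale X xs \<in> fspan {wedge scale X bs}"
proof -
  note X = basis_list_subspace[OF bs]
  have "wedge scale X (ps @ qs) \<in> fspan {wedge scale X bs}"
    if "set ps \<subseteq> set bs" "set qs \<subseteq> X" "length (ps @ qs) = length bs" for ps qs
    using that
  proof (induction qs arbitrary: ps)
    case Nil
    show ?case
    proof (cases "distinct ps")
      case True
      have "set ps = set bs"
        using Nil True bs unfolding basis_list_def
        by (intro card_subset_eq) (auto simp: distinct_card)
      then have "mset ps = mset bs"
        using True bs unfolding basis_list_def by (simp add: set_eq_iff_mset_eq_distinct)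
      from wedge_permute[OF X this, of "[]"] show ?thesis
        using Nil basis_list_subset[OF bs] by auto
    next
      case False
      then show ?thesis using Nil basis_list_subset[OF bs] by (subst wedge_not_distinct) (auto simp: fs.span_zero)
    qed
  next
    case (Cons q qs)
    have ps: "set ps \<subseteq> X" using Cons.prems basis_list_subset[OF bs] by auto
    show ?case
    proof (rule linear_on_span_mem[OF vector_space_axioms vector_space_fscale])
      show "linear_on scale fscale (span (set bs)) (\<lambda>x. wedge scale X (ps @ x # qs))"
        using linear_wedge[OF X ps, of qs] Cons.prems bs by (simp add: basis_list_def)
      show "wedge scale X (ps @ b # qs) \<in> fspan {wedge scale X bs}" if "b \<in> set bs" for b
        using Cons.IH[of "ps @ [b]"] Cons.prems that by simp
      show "q \<in> span (set bs)" using Cons.prems bs by (simp add: basis_list_def)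
    qed simp
  qed
  from this[of "[]" xs] assms show ?thesis by simp
qed

lemma Lam_eq_line:
  assumes "basis_list scale X bs"
  shows "Lam scale X = fspan {wedge scale X bs}"
proof
  show "Lam scale X \<subseteq> fspan {wedge scale X bs}"
    unfolding Lam_def ext_power_def
    using basis_list_dim[OF assms] wedge_in_line[OF assms] by (intro fs.span_minimal) auto
  show "fspan {wedge scale X bs} \<subseteq> Lam scale X"
    unfolding Lam_def basis_list_dim[OF assms]
    using basis_list_subset[OF assms] by (intro fs.span_minimal) (auto intro: wedge_in_ext_power)
qed

lemma det_alternating:
  fixes c :: "nat \<Rightarrow> 'b \<Rightarrow> 'a"
  assumes lin: "\<And>j. j < n \<Longrightarrow> linear_on scale (*) X (c j)"
  shows "alternating_form scale X n (\<lambda>xs. det (mat n n (\<lambda>(i, j). c j (xs ! i))))"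
    (is "alternating_form scale X n ?\<alpha>")
  unfolding alternating_form_def
proof (intro conjI allI impI)
  show "multilinear_form scale X n ?\<alpha>"
    unfolding multilinear_form_def
  proof (intro allI impI)
    fix xs i assume *: "length xs = n \<and> set xs \<subseteq> X \<and> i < n"
    let ?A = "\<lambda>x. mat n n (\<lambda>(i', j). c j (xs[i := x] ! i'))"
    \<comment> \<open>Laplace expansion along row \<open>i\<close>: the cofactors omit that row and
      hence do not depend on \<open>x\<close>, so \<open>undefined\<close> can stand in for
      it.\<close>
    have "?\<alpha> (xs[i := x]) = (\<Sum>j<n. c j x * cofactor (?A undefined) i j)" for x
    proof -
      have "mat_delete (?A x) i j = mat_delete (?A undefined) i j" for j
        unfolding mat_delete_def using * by (intro cong_mat) auto
      then show ?thesis
        using * by (subst laplace_expansion_row[of "?A x" n i]) (auto simp: cofactor_def)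
    qed
    then show "linear_on scale (*) X (\<lambda>x. ?\<alpha> (xs[i := x]))"
      using lin unfolding linear_on_def
      by (auto simp: sum.distrib[symmetric] sum_distrib_left algebra_simps intro!: sum.cong)
  qed
  fix xs assume *: "length xs = n \<and> set xs \<subseteq> X \<and> \<not> distinct xs"
  then obtain i j where ij: "i < n" "j < n" "i \<noteq> j" "xs ! i = xs ! j"
    by (auto simp: distinct_conv_nth)
  show "?\<alpha> xs = 0"
    by (rule det_identical_rows[of _ n i j]) (use ij in \<open>auto intro!: eq_vecI\<close>)
qed

text \<open>The determinant of the coordinates with respect to the basis is an alternating form, and
  at the basis itself it is the determinant of the identity matrix.\<close>

lemma wedge_basis_nonzero:
  assumes "basis_list scale X bs"
  shows "wedge scale X bs \<noteq> 0"
proof -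
  let ?n = "length bs" and ?c = "\<lambda>j x. representation (set bs) x (bs ! j)"
  let ?\<alpha> = "\<lambda>xs. det (mat ?n ?n (\<lambda>(i, j). ?c j (xs ! i)))"
  have X: "X = span (set bs)" and i: "local.independent (set bs)" and d: "distinct bs"
    using assms by (auto simp: basis_list_def)
  have "alternating_form scale X ?n ?\<alpha>"
    by (rule det_alternating) (auto simp: linear_on_def X representation_add[OF i] representation_scale[OF i])
  moreover have "mat ?n ?n (\<lambda>(i, j). ?c j (bs ! i)) = 1\<^sub>m ?n"
    using d by (intro eq_matI) (auto simp: representation_basis[OF i] nth_eq_iff_index_eq)
  ultimately have "wedge scale X bs ?\<alpha> = 1"
    unfolding wedge_def by simp
  then show ?thesis by auto
qed

lemma basis_list_exists:
  assumes "subspace X" "X \<subseteq> span F" "finite F"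
  obtains bs where "basis_list scale X bs"
proof -
  obtain B where B: "B \<subseteq> X" "local.independent B" "X \<subseteq> span B" "card B = dim X"
    by (rule basis_exists)
  have "finite B" using independent_span_bound[OF assms(3) B(2)] B(1) assms(2) by blast
  then obtain bs where "set bs = B" "distinct bs" using finite_distinct_list by blast
  moreover have "span B = X" using B(1,3) span_minimal[OF _ assms(1)] by blast
  ultimately show thesis using that[of bs] B(2) unfolding basis_list_def by simp
qed

text \<open>Vectors of \<open>cs\<close> are adjoined to \<open>bs\<close> one at a time. If a new
  \<open>c\<close> were \<open>x + y\<close> with \<open>x\<close> in \<open>X\<close> and
  \<open>y\<close> in the span of the earlier ones, then \<open>x = c - y\<close> would lie in both
  \<open>X\<close> and \<open>Y\<close>, so \<open>x = 0\<close>, contradicting the independence of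
  \<open>cs\<close>.\<close>

lemma basis_list_append:
  assumes bs: "basis_list scale X bs" "basis_list scale Y cs" and disj: "X \<inter> Y \<subseteq> {0}"
    and Z: "Z = {x + y | x y. x \<in> X \<and> y \<in> Y}"
  shows "basis_list scale Z (bs @ cs)"
proof -
  have ind: "local.independent (set bs \<union> C) \<and> set bs \<inter> C = {}" if "finite C" "C \<subseteq> set cs" for C
    using that
  proof (induction C)
    case empty
    then show ?case using bs(1) by (simp add: basis_list_def)
  next
    case (insert c C)
    have iC: "local.independent (insert c C)"
      using insert.prems bs(2) independent_mono unfolding basis_list_def by blast
    have "c \<notin> span (set bs \<union> C)"
    proof
      assume "c \<in> span (set bs \<union> C)"
      then obtain x y where xy: "c = x + y" "x \<in> X" "y \<in> span C"
        using bs(1) unfolding span_Un basis_list_def by blast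
      have "c \<in> Y" "span C \<subseteq> Y"
        using insert.prems bs(2) span_mono[of C "set cs"] basis_list_subset[OF bs(2)]
        unfolding basis_list_def by auto
      then have "x \<in> Y"
        using xy basis_list_subspace[OF bs(2)] by (metis add_diff_cancel_right' subsetD subspace_diff)
      then have "x = 0" using xy disj by auto
      then have "c \<in> span C" using xy by simp
      with iC insert.hyps show False using dependent_def by (metis insertI1 Diff_insert_absorb)
    qed
    then show ?case using insert independent_insertI span_base by auto
  qed
  then have "local.independent (set bs \<union> set cs)" "set bs \<inter> set cs = {}" by auto
  then show ?thesis
    using bs Z unfolding basis_list_def by (auto simp: span_Un)
qed

end

section \<open>Functoriality of exterior powers and the exterior product\<close>

lemma basis_list_image:
  assumes s: "vector_space s" and s': "vector_space s'" and lin: "linear_on s s' X f"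
    and inj: "inj_on f X" and bs: "basis_list s X bs"
  shows "basis_list s' (f ` X) (map f bs)"
proof -
  interpret m: vector_space s by fact
  interpret m': vector_space s' by fact
  have d: "distinct bs" and ind: "m.independent (set bs)" and X: "m.span (set bs) = X"
    using bs by (auto simp: basis_list_def)
  note sub = m.basis_list_subset[OF bs]
  have "m'.independent (f ` set bs)"
  proof
    assume "m'.dependent (f ` set bs)"
    then obtain b where b: "b \<in> set bs" "f b \<in> m'.span (f ` set bs - {f b})"
      unfolding m'.dependent_def by auto
    have "f ` set bs - {f b} = f ` (set bs - {b})"
      using inj sub b(1) by (auto dest: inj_onD)
    moreover have sp: "m.span (set bs - {b}) \<subseteq> X" using X m.span_mono[of "set bs - {b}" "set bs"] by auto
    ultimately have "f b \<in> f ` m.span (set bs - {b})"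
      using b(2) linear_on_span_image[OF s s' linear_on_subset[OF lin sp]] by simp
    then have "b \<in> m.span (set bs - {b})" using inj sp sub b(1) by (auto dest: inj_onD)
    then show False using ind b(1) unfolding m.dependent_def by blast
  qed
  moreover have "m'.span (f ` set bs) = f ` X"
    using linear_on_span_image[OF s s'] lin X by metis
  moreover have "distinct (map f bs)"
    using d inj sub by (auto simp: distinct_map intro: inj_on_subset)
  ultimately show ?thesis unfolding basis_list_def by simp
qed

lemma alternating_form_map:
  assumes "linear_on s s' X f" "f ` X \<subseteq> Z" "alternating_form s' Z d \<alpha>"
  shows "alternating_form s X d (\<lambda>xs. \<alpha> (map f xs))"
  unfolding alternating_form_def multilinear_form_def
proof (intro conjI allI impI)
  fix xs i assume *: "length xs = d \<and> set xs \<subseteq> X \<and> i < d"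
  then have "length (map f xs) = d \<and> set (map f xs) \<subseteq> Z \<and> i < d" using assms(2) by auto
  then have "linear_on s' (*) Z (\<lambda>z. \<alpha> ((map f xs)[i := z]))"
    using assms(3) unfolding alternating_form_def multilinear_form_def by blast
  from linear_on_compose[OF assms(1) this assms(2)]
  show "linear_on s (*) X (\<lambda>x. \<alpha> (map f (xs[i := x])))" by (simp add: map_update)
next
  fix xs assume *: "length xs = d \<and> set xs \<subseteq> X \<and> \<not> distinct xs"
  then have "length (map f xs) = d \<and> set (map f xs) \<subseteq> Z \<and> \<not> distinct (map f xs)"
    using assms(2) by (auto simp: distinct_map)
  then show "\<alpha> (map f xs) = 0"
    using assms(3) unfolding alternating_form_def by blast
qed

lemma linear_ext_map: "linear_on fscale fscale A (ext_map s' Z d f)"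
  unfolding linear_on_def ext_map_def by (auto simp: fun_eq_iff fscale_def)

lemma ext_map_wedge:
  assumes "linear_on s s' X f" "f ` X \<subseteq> Z" "length xs = d"
  shows "ext_map s' Z d f (wedge s X xs) = wedge s' Z (map f xs)"
  unfolding ext_map_def wedge_def
  using alternating_form_map[OF assms(1,2)] assms(3) by (auto simp: fun_eq_iff)

lemma ext_map_mem:
  assumes "vector_space s'" "linear_on s s' X f" "f ` X \<subseteq> Z"
  shows "ext_map s' Z d f ` ext_power s d X \<subseteq> ext_power s' d Z"
proof -
  interpret m': vector_space s' by fact
  have gen: "ext_map s' Z d f (wedge s X xs) \<in> ext_power s' d Z" if "length xs = d" "set xs \<subseteq> X" for xs
  proof -
    have "set (map f xs) \<subseteq> Z" using that(2) assms(3) by auto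
    from m'.wedge_in_ext_power[OF this] show ?thesis
      unfolding ext_map_wedge[OF assms(2,3) that(1)] using that(1) by simp
  qed
  show ?thesis
  proof (rule image_subsetI)
    fix \<omega> assume "\<omega> \<in> ext_power s d X"
    then show "ext_map s' Z d f \<omega> \<in> ext_power s' d Z"
      unfolding ext_power_def[of s]
    proof (rule linear_on_span_mem[OF vector_space_fscale vector_space_fscale linear_ext_map, rotated 2])
      show "ext_map s' Z d f b \<in> ext_power s' d Z"
        if "b \<in> {wedge s X xs |xs. length xs = d \<and> set xs \<subseteq> X}" for b
        using that gen by blast
    qed (rule m'.subspace_ext_power)
  qed
qed

text \<open>Only the values of the map on \<open>X\<close> count. This is the place where
  \<open>restrict \<phi> (U Y)\<close> and \<open>\<phi>\<close> become interchangeable, in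
  \<open>wphi\<close> as well as in \<open>phi0\<close>.\<close>

lemma ext_map_cong:
  assumes "vector_space s" "Modules.module.subspace s X" "\<omega> \<in> ext_power s d X"
    and "\<And>x. x \<in> X \<Longrightarrow> f x = g x"
  shows "ext_map s' Z d f \<omega> = ext_map s' Z d g \<omega>"
proof
  interpret m: vector_space s by fact
  fix \<alpha>
  have "\<omega> (\<lambda>xs. \<alpha> (map f xs)) = \<omega> (\<lambda>xs. \<alpha> (map g xs))"
  proof (rule m.ext_power_apply_cong[OF assms(3,2)])
    show "\<alpha> (map f xs) = \<alpha> (map g xs)" if "set xs \<subseteq> X" for xs
      using that assms(4) by (metis map_cong subsetD)
  qed
  then show "ext_map s' Z d f \<omega> \<alpha> = ext_map s' Z d g \<omega> \<alpha>" by (simp add: ext_map_def)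
qed

context vector_space
begin

text \<open>\<open>ext_mult\<close> nests two evaluations, and the outer one makes sense only at an
  alternating form. Contracting the last \<open>q\<close> arguments of \<alpha> with \<eta> gives
  such a form: linearity in an outer argument uses that \<eta> is additive at alternating forms,
  whence \<open>alt\<close> for the forms obtained by fixing the first \<open>p\<close>
  arguments.\<close>

lemma alternating_form_partial:
  assumes A: "subspace A" "A \<subseteq> X" and B: "subspace B" "B \<subseteq> X" and X: "subspace X"
    and \<eta>: "\<eta> \<in> ext_power scale q B" and \<alpha>: "alternating_form scale X (p + q) \<alpha>"
  shows "alternating_form scale A p (\<lambda>xs. \<eta> (\<lambda>ys. \<alpha> (xs @ ys)))"
proof -
  have lin: "linear_on scale (*) X (\<lambda>x. \<alpha> (xs @ x # ys))"
    if "set xs \<subseteq> X" "set ys \<subseteq> X" "p + q = Suc (length xs + length ys)" for xs ys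
    using \<alpha> that multilinear_form_linear[OF _ X] unfolding alternating_form_def by blast
  have alt: "alternating_form scale B q (\<lambda>ys. \<alpha> (xs @ ys))" if "set xs \<subseteq> X" "length xs = p" for xs
    unfolding alternating_form_def
  proof (intro conjI allI impI multilinear_formI)
    fix ps qs assume *: "set ps \<subseteq> B" "set qs \<subseteq> B" "q = Suc (length ps + length qs)"
    have "linear_on scale (*) X (\<lambda>x. \<alpha> ((xs @ ps) @ x # qs))"
      by (rule lin) (use * that B(2) in auto)
    then show "linear_on scale (*) B (\<lambda>x. \<alpha> (xs @ ps @ x # qs))"
      using linear_on_subset[OF _ B(2)] by simp
  next
    fix ys assume "length ys = q \<and> set ys \<subseteq> B \<and> \<not> distinct ys"
    then have "length (xs @ ys) = p + q \<and> set (xs @ ys) \<subseteq> X \<and> \<not> distinct (xs @ ys)"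
      using that B(2) by auto
    then show "\<alpha> (xs @ ys) = 0" using \<alpha> unfolding alternating_form_def by blast
  qed
  show ?thesis
    unfolding alternating_form_def
  proof (intro conjI allI impI multilinear_formI)
    fix ps qs assume *: "set ps \<subseteq> A" "set qs \<subseteq> A" "p = Suc (length ps + length qs)"
    have sub: "set ps \<subseteq> X" "set qs \<subseteq> X" using * A(2) by auto
    have "\<eta> (\<lambda>ys. \<alpha> ((ps @ (x + y) # qs) @ ys)) =
        \<eta> (\<lambda>ys. \<alpha> ((ps @ x # qs) @ ys)) + \<eta> (\<lambda>ys. \<alpha> ((ps @ y # qs) @ ys))" if "x \<in> A" "y \<in> A" for x y
    proof -
      have xy: "x \<in> X" "y \<in> X" using that A(2) by auto
      have "\<eta> (\<lambda>ys. \<alpha> ((ps @ (x + y) # qs) @ ys)) =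
          \<eta> (\<lambda>ys. 1 * \<alpha> ((ps @ x # qs) @ ys) + 1 * \<alpha> ((ps @ y # qs) @ ys))"
        by (rule ext_power_apply_cong[OF \<eta> B(1)])
          (use lin[of ps "qs @ _"] sub * B(2) xy in \<open>auto simp: linear_on_def\<close>)
      also have "\<dots> = 1 * \<eta> (\<lambda>ys. \<alpha> ((ps @ x # qs) @ ys)) + 1 * \<eta> (\<lambda>ys. \<alpha> ((ps @ y # qs) @ ys))"
        by (rule ext_power_apply_combination[OF \<eta> alt alt]) (use sub * xy in auto)
      finally show ?thesis by simp
    qed
    moreover have "\<eta> (\<lambda>ys. \<alpha> ((ps @ scale c x # qs) @ ys)) = c * \<eta> (\<lambda>ys. \<alpha> ((ps @ x # qs) @ ys))"
      if "x \<in> A" for c x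
    proof -
      have x: "x \<in> X" using that A(2) by auto
      have "\<eta> (\<lambda>ys. \<alpha> ((ps @ scale c x # qs) @ ys)) =
          \<eta> (\<lambda>ys. c * \<alpha> ((ps @ x # qs) @ ys) + 0 * \<alpha> ((ps @ x # qs) @ ys))"
        by (rule ext_power_apply_cong[OF \<eta> B(1)])
          (use lin[of ps "qs @ _"] sub * B(2) x in \<open>auto simp: linear_on_def\<close>)
      also have "\<dots> = c * \<eta> (\<lambda>ys. \<alpha> ((ps @ x # qs) @ ys)) + 0 * \<eta> (\<lambda>ys. \<alpha> ((ps @ x # qs) @ ys))"
        by (rule ext_power_apply_combination[OF \<eta> alt alt]) (use sub * x in auto)
      finally show ?thesis by simp
    qed
    ultimately show "linear_on scale (*) A (\<lambda>x. \<eta> (\<lambda>ys. \<alpha> ((ps @ x # qs) @ ys)))"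
      unfolding linear_on_def by blast
  next
    fix xs assume *: "length xs = p \<and> set xs \<subseteq> A \<and> \<not> distinct xs"
    have "\<alpha> (xs @ ys) = 0" if "length ys = q" "set ys \<subseteq> B" for ys
    proof -
      have "length (xs @ ys) = p + q \<and> set (xs @ ys) \<subseteq> X \<and> \<not> distinct (xs @ ys)"
        using * that A(2) B(2) by auto
      then show ?thesis using \<alpha> unfolding alternating_form_def by blast
    qed
    \<comment> \<open>All arguments that matter give 0. Writing this zero form as a combination with
      coefficients 0 makes the additivity of \<eta> yield the value 0.\<close>
    then have "\<eta> (\<lambda>ys. \<alpha> (xs @ ys)) = \<eta> (\<lambda>ys. 0 * \<alpha> (xs @ ys) + 0 * \<alpha> (xs @ ys))"
      by (intro ext_power_apply_cong[OF \<eta> B(1)]) simp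
    also have "\<dots> = 0 * \<eta> (\<lambda>ys. \<alpha> (xs @ ys)) + 0 * \<eta> (\<lambda>ys. \<alpha> (xs @ ys))"
      by (rule ext_power_apply_combination[OF \<eta> alt alt]) (use * A(2) in auto)
    finally show "\<eta> (\<lambda>ys. \<alpha> (xs @ ys)) = 0" by simp
  qed
qed

lemma bilinear_ext_mult:
  assumes A: "subspace A" "A \<subseteq> X" and B: "subspace B" "B \<subseteq> X" and X: "subspace X"
  shows "bilinear_map (ext_power scale p A) (ext_power scale q B) (ext_mult scale X p q)"
proof (rule bilinear_mapI)
  fix \<eta>
  show "linear_on fscale fscale (ext_power scale p A) (\<lambda>\<omega>. ext_mult scale X p q \<omega> \<eta>)"
    unfolding linear_on_def ext_mult_def by (auto simp: fun_eq_iff fscale_def)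
next
  fix \<omega> assume \<omega>: "\<omega> \<in> ext_power scale p A"
  have comb: "\<omega> (\<lambda>xs. a * \<eta> (\<lambda>ys. \<alpha> (xs @ ys)) + b * \<theta> (\<lambda>ys. \<alpha> (xs @ ys))) =
      a * \<omega> (\<lambda>xs. \<eta> (\<lambda>ys. \<alpha> (xs @ ys))) + b * \<omega> (\<lambda>xs. \<theta> (\<lambda>ys. \<alpha> (xs @ ys)))"
    if "\<eta> \<in> ext_power scale q B" "\<theta> \<in> ext_power scale q B" "alternating_form scale X (p + q) \<alpha>"
    for a b \<eta> \<theta> \<alpha>
    by (intro ext_power_apply_combination[OF \<omega>] alternating_form_partial[OF assms _ that(3)] that(1,2))
  show "linear_on fscale fscale (ext_power scale q B) (ext_mult scale X p q \<omega>)"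
    unfolding linear_on_def
    using comb[where a = 1 and b = 1] comb[where b = 0]
    by (auto simp: ext_mult_def fun_eq_iff fscale_def)
qed

lemma ext_mult_wedge:
  assumes A: "subspace A" "A \<subseteq> X" and B: "subspace B" "B \<subseteq> X" and X: "subspace X"
    and xs: "set xs \<subseteq> A" "length xs = p" and ys: "set ys \<subseteq> B" "length ys = q"
  shows "ext_mult scale X p q (wedge scale A xs) (wedge scale B ys) = wedge scale X (xs @ ys)"
proof
  fix \<alpha>
  show "ext_mult scale X p q (wedge scale A xs) (wedge scale B ys) \<alpha> = wedge scale X (xs @ ys) \<alpha>"
  proof (cases "alternating_form scale X (p + q) \<alpha>")
    case True
    have "wedge scale B ys \<in> ext_power scale q B" using wedge_in_ext_power ys by blast
    from alternating_form_partial[OF A B X this True]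
    have "ext_mult scale X p q (wedge scale A xs) (wedge scale B ys) \<alpha> =
        wedge scale B ys (\<lambda>ys. \<alpha> (xs @ ys))"
      using True xs by (simp add: ext_mult_def wedge_def)
    moreover have "alternating_form scale B q (\<lambda>ys. \<alpha> (xs @ ys))"
      unfolding alternating_form_def
    proof (intro conjI allI impI multilinear_formI)
      fix ps qs assume *: "set ps \<subseteq> B" "set qs \<subseteq> B" "q = Suc (length ps + length qs)"
      have "linear_on scale (*) X (\<lambda>x. \<alpha> ((xs @ ps) @ x # qs))"
        by (rule multilinear_form_linear[OF _ X])
          (use * True xs A(2) B(2) in \<open>auto simp: alternating_form_def add.assoc\<close>)
      then show "linear_on scale (*) B (\<lambda>x. \<alpha> (xs @ ps @ x # qs))"
        using linear_on_subset[OF _ B(2)] by simp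
    next
      fix zs assume "length zs = q \<and> set zs \<subseteq> B \<and> \<not> distinct zs"
      then have "length (xs @ zs) = p + q \<and> set (xs @ zs) \<subseteq> X \<and> \<not> distinct (xs @ zs)"
        using xs A(2) B(2) by auto
      then show "\<alpha> (xs @ zs) = 0" using True unfolding alternating_form_def by blast
    qed
    ultimately show ?thesis using True xs ys by (simp add: wedge_def)
  qed (use xs ys in \<open>simp add: ext_mult_def wedge_def\<close>)
qed

end

lemma linear_on_sum:
  assumes "vector_space s" "vector_space s'" "linear_on s s' X f" "Modules.module.subspace s X"
    and "\<And>i. i \<in> A \<Longrightarrow> g i \<in> X"
  shows "f (sum g A) = (\<Sum>i\<in>A. f (g i))"
proof -
  interpret m: vector_space s by fact
  interpret m': vector_space s' by fact
  have f0: "f 0 = 0"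
    using assms(3) m.subspace_0[OF assms(4)] unfolding linear_on_def by (metis m.scale_zero_left m'.scale_zero_left)
  show ?thesis
    using assms(5)
  proof (induction A rule: infinite_finite_induct)
    case (insert i A)
    have "sum g A \<in> X" using insert.prems by (intro m.subspace_sum[OF assms(4)]) simp
    then have "f (g i + sum g A) = f (g i) + f (sum g A)"
      using assms(3) insert.prems by (simp add: linear_on_def)
    then show ?case using insert by (simp only: sum.insert if_False insert_iff simp_thms)
  qed (simp_all add: f0)
qed

section \<open>Dual spaces\<close>

lemma vector_space_mult: "vector_space ((*) :: 'k::field \<Rightarrow> 'k \<Rightarrow> 'k)"
  by unfold_locales (auto simp: algebra_simps)

lemma sum_fun_apply: "(\<Sum>i\<in>A. f i) x = (\<Sum>i\<in>A. f i x)"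
  by (induction A rule: infinite_finite_induct) auto

lemma subspace_dual: "fs.subspace (dual s X)"
  by (rule fs.subspaceI) (auto simp: dual_def linear_on_def fscale_def algebra_simps)

lemma res_linear: "linear_on fscale fscale A (res X)"
  unfolding linear_on_def res_def by (auto simp: fun_eq_iff fscale_def)

text \<open>The dual basis vector belonging to \<open>b\<close>, cut off outside \<open>X\<close> in
  order to be an element of \<open>dual s X\<close>.\<close>

definition coordinate ::
  "('k::field \<Rightarrow> 'x::ab_group_add \<Rightarrow> 'x) \<Rightarrow> 'x set \<Rightarrow> 'x list \<Rightarrow> 'x \<Rightarrow> 'x \<Rightarrow> 'k" where
  "coordinate s X bs b = res X (\<lambda>x. Modules.module.representation s (set bs) x b)"

context vector_space
begin

lemma res_in_dual:
  assumes "subspace X" "linear_on scale (*) X f"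
  shows "res X f \<in> dual scale X"
  using assms subspace_add subspace_scale by (auto simp: dual_def linear_on_def res_def)

lemma linear_representation_on:
  assumes "basis_list scale X bs"
  shows "linear_on scale (*) X (\<lambda>x. representation (set bs) x b)"
  using assms unfolding basis_list_def linear_on_def
  by (auto simp: representation_add representation_scale)

lemma coordinate_in_dual:
  assumes "basis_list scale X bs"
  shows "coordinate scale X bs b \<in> dual scale X"
  unfolding coordinate_def
  by (rule res_in_dual[OF basis_list_subspace linear_representation_on]) (rule assms)+

lemma coordinate_basis:
  assumes "basis_list scale X bs" "b \<in> set bs"
  shows "coordinate scale X bs a b = (if a = b then 1 else 0)"
  using assms basis_list_subset[OF assms(1)]
  by (auto simp: coordinate_def res_def basis_list_def representation_basis)

lemma linear_form_expand:
  assumes bs: "basis_list scale X bs" and f: "linear_on scale (*) X f" and x: "x \<in> X"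
  shows "f x = (\<Sum>b\<in>set bs. coordinate scale X bs b x * f b)"
proof -
  have X: "span (set bs) = X" using bs by (simp add: basis_list_def)
  let ?g = "\<lambda>x. \<Sum>b\<in>set bs. coordinate scale X bs b x * f b"
  have "linear_on scale (*) X ?g"
    using coordinate_in_dual[OF bs] unfolding dual_def linear_on_def
    by (auto simp: algebra_simps sum.distrib sum_distrib_left)
  moreover have "f b = ?g b" if "b \<in> set bs" for b
  proof -
    have "?g b = (\<Sum>a\<in>set bs. if a = b then f b else 0)"
      by (intro sum.cong) (auto simp: coordinate_basis[OF bs that])
    then show ?thesis using that by simp
  qed
  ultimately show ?thesis
    using f x X
    by (intro linear_on_span_eq[OF vector_space_axioms vector_space_mult, of "set bs" f ?g x]) simp_all
qed

lemma dual_expand: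
  assumes bs: "basis_list scale X bs" and f: "f \<in> dual scale X"
  shows "f = (\<Sum>b\<in>set bs. fscale (f b) (coordinate scale X bs b))"
proof
  fix x
  show "f x = (\<Sum>b\<in>set bs. fscale (f b) (coordinate scale X bs b)) x"
  proof (cases "x \<in> X")
    case True
    then show ?thesis
      using linear_form_expand[OF bs _ True, of f] f
      by (simp add: dual_def sum_fun_apply fscale_def mult.commute)
  next
    case False
    then show ?thesis
      using f by (simp add: dual_def sum_fun_apply fscale_def coordinate_def res_def)
  qed
qed

lemma basis_list_dual:
  assumes bs: "basis_list scale X bs"
  shows "basis_list fscale (dual scale X) (map (coordinate scale X bs) bs)"
proof -
  let ?c = "coordinate scale X bs"
  note c = coordinate_basis[OF bs]
  have inj: "inj_on ?c (set bs)"
    by (rule inj_onI) (metis c zero_neq_one)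
  have "fs.independent (?c ` set bs)"
  proof (rule fs.independent_if_scalars_zero)
    fix u x assume z: "(\<Sum>x\<in>?c ` set bs. fscale (u x) x) = 0" and "x \<in> ?c ` set bs"
    then obtain b where b: "b \<in> set bs" "x = ?c b" by blast
    have "0 = (\<Sum>a\<in>set bs. fscale (u (?c a)) (?c a)) b"
      using z by (simp add: sum.reindex[OF inj])
    also have "\<dots> = (\<Sum>a\<in>set bs. if a = b then u (?c b) else 0)"
      by (simp add: sum_fun_apply fscale_def c[OF b(1)] if_distrib cong: if_cong sum.cong)
    also have "\<dots> = u x" using b by simp
    finally show "u x = 0" by simp
  qed simp
  moreover have "fs.span (?c ` set bs) = dual scale X"
  proof
    show "fs.span (?c ` set bs) \<subseteq> dual scale X"
      using coordinate_in_dual[OF bs] by (intro fs.span_minimal subspace_dual) auto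
    show "dual scale X \<subseteq> fs.span (?c ` set bs)"
    proof
      fix f assume "f \<in> dual scale X"
      from dual_expand[OF bs this] show "f \<in> fs.span (?c ` set bs)"
        by (metis (no_types, lifting) fs.span_base fs.span_scale fs.span_sum imageI)
    qed
  qed
  moreover have "distinct (map ?c bs)" using bs inj by (simp add: basis_list_def distinct_map)
  ultimately show ?thesis unfolding basis_list_def by simp
qed

lemma dim_dual: "basis_list scale X bs \<Longrightarrow> fs.dim (dual scale X) = dim X"
  using fs.basis_list_dim[OF basis_list_dual, of X bs] basis_list_dim[of X bs] by simp

subsection \<open>Contraction of tensors of functionals\<close>

lemma bilinear_evaluation: "bilinear_map X Y (\<lambda>g r. fscale (g d) r)"
  unfolding bilinear_map_def linear_on_def by (auto simp: fun_eq_iff fscale_def algebra_simps)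

text \<open>A tensor of functionals is the sum of the dual basis vectors tensored with its
  contractions against the basis of \<open>D\<close>, so it is determined by these contractions. On
  a pure tensor this is the expansion of its first factor in the dual basis.\<close>

lemma tensor_dual_expand:
  assumes ds: "basis_list scale D ds" and t: "t \<in> tensor (dual scale D) (dual s' P)"
  shows "t = (\<Sum>d\<in>set ds. pure (dual scale D) (dual s' P) (coordinate scale D ds d)
    (tlift (\<lambda>g r. fscale (g d) r) t))"
proof -
  let ?X = "dual scale D" and ?Y = "dual s' P"
  let ?p = "pure ?X ?Y" and ?q = "\<lambda>d. tlift (\<lambda>g r. fscale (g d) r)"
  have q: "?q d t \<in> ?Y" if "t \<in> tensor ?X ?Y" for d t
    by (rule tlift_mem[OF that bilinear_evaluation subspace_dual])
      (simp add: fs.subspace_scale[OF subspace_dual])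
  have lin: "linear_on fscale fscale ?Y (?p x)" if "x \<in> ?X" for x
    using bilinear_map_pure[of ?X ?Y] that by (simp add: bilinear_map_def)
  have linX: "linear_on fscale fscale ?X (\<lambda>x. ?p x y)" if "y \<in> ?Y" for y
    using bilinear_map_pure[of ?X ?Y] that by (simp add: bilinear_map_def)
  note c = coordinate_in_dual[OF ds]
  show ?thesis
  proof (rule linear_on_span_eq[OF vector_space_fscale vector_space_fscale, of _ "\<lambda>t. t"
        "\<lambda>t. \<Sum>d\<in>set ds. ?p (coordinate scale D ds d) (?q d t)" t])
    show "linear_on fscale fscale (fspan {?p x y |x y. x \<in> ?X \<and> y \<in> ?Y}) (\<lambda>t. t)"
      by (simp add: linear_on_def)
    have "linear_on fscale fscale (tensor ?X ?Y) (\<lambda>t. ?p (coordinate scale D ds d) (?q d t))" for d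
      by (rule linear_on_compose[OF linear_tlift lin[OF c]]) (use q in blast)
    then show "linear_on fscale fscale (fspan {?p x y |x y. x \<in> ?X \<and> y \<in> ?Y})
        (\<lambda>t. \<Sum>d\<in>set ds. ?p (coordinate scale D ds d) (?q d t))"
      unfolding tensor_def linear_on_def by (simp add: sum.distrib fs.scale_sum_right)
    show "t \<in> fspan {?p x y |x y. x \<in> ?X \<and> y \<in> ?Y}" using t by (simp add: tensor_def)
    fix b assume "b \<in> {?p x y |x y. x \<in> ?X \<and> y \<in> ?Y}"
    then obtain g r where b: "b = ?p g r" "g \<in> ?X" "r \<in> ?Y" by blast
    have "b = ?p (\<Sum>d\<in>set ds. fscale (g d) (coordinate scale D ds d)) r"
      using dual_expand[OF ds b(2)] b(1) by simp
    also have "\<dots> = (\<Sum>d\<in>set ds. ?p (fscale (g d) (coordinate scale D ds d)) r)"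
      by (rule linear_on_sum[OF vector_space_fscale vector_space_fscale linX[OF b(3)] subspace_dual])
        (rule fs.subspace_scale[OF subspace_dual c])
    also have "\<dots> = (\<Sum>d\<in>set ds. fscale (g d) (?p (coordinate scale D ds d) r))"
      using linX[OF b(3)] c by (simp add: linear_on_def)
    also have "\<dots> = (\<Sum>d\<in>set ds. ?p (coordinate scale D ds d) (?q d b))"
      unfolding b(1) tlift_pure[OF bilinear_evaluation]
      using lin[OF c] b(3) by (simp add: linear_on_def)
    finally show "b = (\<Sum>d\<in>set ds. ?p (coordinate scale D ds d) (?q d b))" .
  qed
qed

text \<open>The tensor product of the duals is the space of bilinear forms on \<open>D\<close> and
  \<open>P\<close>, because \<open>D\<close> has a finite basis. The tensor of the form
  \<open>B\<close> is the sum over the basis of the dual vector of \<open>d\<close> tensored with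
  \<open>B d\<close>; uniqueness holds because a tensor is determined by its contractions.\<close>

lemma tensor_dual_ex1:
  assumes ds: "basis_list scale D ds" and P: "vector_space s'" "Modules.module.subspace s' P"
    and B1: "\<And>x. x \<in> D \<Longrightarrow> linear_on s' (*) P (B x)"
    and B2: "\<And>p. p \<in> P \<Longrightarrow> linear_on scale (*) D (\<lambda>x. B x p)"
  shows "\<exists>!t. t \<in> tensor (dual scale D) (dual s' P) \<and> (\<forall>x\<in>D. \<forall>p\<in>P. t (\<lambda>g q. g x * q p) = B x p)"
proof (rule ex_ex1I)
  let ?X = "dual scale D" and ?Y = "dual s' P"
  let ?t = "\<Sum>d\<in>set ds. pure ?X ?Y (coordinate scale D ds d) (res P (B d))"
  have resB: "res P (B d) \<in> ?Y" if "d \<in> set ds" for d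
    using vector_space.res_in_dual[OF P B1] basis_list_subset[OF ds] that by blast
  have "?t \<in> tensor ?X ?Y"
    by (intro fs.subspace_sum subspace_tensor pure_in_tensor coordinate_in_dual[OF ds] resB)
  moreover have "?t (\<lambda>g q. g x * q p) = B x p" if "x \<in> D" "p \<in> P" for x p
  proof -
    have "bilinear_form ?X ?Y (\<lambda>g q. g x * q p)"
      unfolding bilinear_form_def linear_on_def by (simp add: fscale_def algebra_simps)
    then have "?t (\<lambda>g q. g x * q p) = (\<Sum>d\<in>set ds. coordinate scale D ds d x * B d p)"
      using that by (simp add: sum_fun_apply pure_def res_def)
    also have "\<dots> = B x p" using linear_form_expand[OF ds B2[OF that(2)] that(1)] by simp
    finally show ?thesis .
  qed
  ultimately show "\<exists>t. t \<in> tensor ?X ?Y \<and> (\<forall>x\<in>D. \<forall>p\<in>P. t (\<lambda>g q. g x * q p) = B x p)" by blast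
next
  let ?X = "dual scale D" and ?Y = "dual s' P"
  fix t t'
  assume t: "t \<in> tensor ?X ?Y \<and> (\<forall>x\<in>D. \<forall>p\<in>P. t (\<lambda>g q. g x * q p) = B x p)"
    and t': "t' \<in> tensor ?X ?Y \<and> (\<forall>x\<in>D. \<forall>p\<in>P. t' (\<lambda>g q. g x * q p) = B x p)"
  have "tlift (\<lambda>g r. fscale (g d) r) t = tlift (\<lambda>g r. fscale (g d) r) t'" if "d \<in> set ds" for d
  proof
    fix p
    \<comment> \<open>Functionals vanish outside \<open>P\<close> by convention, so agreement of the
      contractions on \<open>P\<close> is agreement everywhere.\<close>
    have z: "u \<in> ?Y \<Longrightarrow> p \<notin> P \<Longrightarrow> u p = 0" for u by (simp add: dual_def)
    have mem: "tlift (\<lambda>g r. fscale (g d) r) u \<in> ?Y" if "u \<in> tensor ?X ?Y" for u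
      by (rule tlift_mem[OF that bilinear_evaluation subspace_dual])
        (simp add: fs.subspace_scale[OF subspace_dual])
    show "tlift (\<lambda>g r. fscale (g d) r) t p = tlift (\<lambda>g r. fscale (g d) r) t' p"
    proof (cases "p \<in> P")
      case True
      then show ?thesis using t t' that basis_list_subset[OF ds] by (auto simp: tlift_def fscale_def)
    next
      case False
      from z[OF mem[OF conjunct1[OF t]] False] z[OF mem[OF conjunct1[OF t']] False]
      show ?thesis by (rule trans[OF _ sym])
    qed
  qed
  then show "t = t'"
    using tensor_dual_expand[OF ds conjunct1[OF t]] tensor_dual_expand[OF ds conjunct1[OF t']]
    by (metis (no_types, lifting) sum.cong)
qed

end

section \<open>The components of the structure maps\<close>

lemma linear_line_bij:
  assumes "A = fspan {a}" "C = fspan {w}" "linear_on fscale fscale A f" "f a = w" "w \<noteq> 0"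
  shows "bij_betw f A C"
  using linear_inj_on_line[of a f] assms unfolding bij_betw_def by simp

lemma bij_betw_ex1: "bij_betw f A C \<Longrightarrow> w \<in> C \<Longrightarrow> \<exists>!u. u \<in> A \<and> f u = w"
  unfolding bij_betw_def inj_on_def by blast

lemma inv_tlift_line:
  assumes A: "A = fspan {a}" and B: "B = fspan {b}" and C: "C = fspan {w}"
    and bil: "bilinear_map A B \<beta>" and w: "\<beta> a b = w" "w \<noteq> 0"
  shows "linear_on fscale fscale C (inv_into (tensor A B) (tlift \<beta>))"
    and "inv_into (tensor A B) (tlift \<beta>) ` C \<subseteq> tensor A B"
proof -
  have "\<beta> a b \<noteq> 0" using w by simp
  note * = inv_tlift_lines[of a b \<beta>, OF bil[unfolded A B] this]
  show "linear_on fscale fscale C (inv_into (tensor A B) (tlift \<beta>))"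
    using *(1) unfolding w(1) A B C .
  show "inv_into (tensor A B) (tlift \<beta>) ` C \<subseteq> tensor A B"
    using *(2) unfolding w(1) A B C .
qed

subsection \<open>Splitting the exterior power of a coordinate space\<close>

lemma unit_vec_inj: "inj unit_vec"
  by (rule injI) (metis unit_vec_def zero_neq_one)

lemma basis_list_U:
  assumes "distinct as" "set as = A"
  shows "basis_list fscale (U A :: ('a \<Rightarrow> 'k::field) set) (map unit_vec as)"
proof -
  have inj: "inj_on (unit_vec :: 'a \<Rightarrow> 'a \<Rightarrow> 'k) A" for A using unit_vec_inj by (rule inj_on_subset) simp
  have "fs.independent ((unit_vec :: 'a \<Rightarrow> 'a \<Rightarrow> 'k) ` A)"
  proof (rule fs.independent_if_scalars_zero)
    fix u :: "('a \<Rightarrow> 'k) \<Rightarrow> 'k" and x :: "'a \<Rightarrow> 'k"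
    assume z: "(\<Sum>x\<in>unit_vec ` A. fscale (u x) x) = 0" and "x \<in> unit_vec ` A"
    then obtain b where b: "b \<in> A" "x = unit_vec b" by blast
    have "(\<Sum>a\<in>A. fscale (u (unit_vec a)) (unit_vec a)) = 0"
      using z unfolding sum.reindex[OF inj] comp_def .
    from fun_cong[OF this, of b] have "0 = (\<Sum>a\<in>A. fscale (u (unit_vec a)) (unit_vec a)) b"
      by simp
    also have "\<dots> = (\<Sum>a\<in>A. if a = b then u (unit_vec b) else 0)"
      unfolding sum_fun_apply by (rule sum.cong) (auto simp: fscale_def unit_vec_def)
    also have "\<dots> = u x" using b assms(2)[symmetric] by simp
    finally show "u x = 0" by simp
  qed (use assms(2)[symmetric] in simp)
  then show ?thesis
    using assms inj[of "set as"] by (simp add: basis_list_def U_def distinct_map)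
qed

lemma U_mono: "A \<subseteq> B \<Longrightarrow> U A \<subseteq> U B"
  unfolding U_def by (intro fs.span_mono) blast

lemma subspace_U [simp]: "fs.subspace (U A)"
  by (simp add: U_def)

lemma dim_U: "finite A \<Longrightarrow> fs.dim (U A :: ('a \<Rightarrow> 'k::field) set) = card A"
  using finite_distinct_list[of A] fs.basis_list_dim[OF basis_list_U, where ?'a = 'k]
  by (metis distinct_card length_map)

lemma Lam_U_line:
  assumes "distinct as" "set as = A"
  shows "Lam fscale (U A :: ('a \<Rightarrow> 'k::field) set) = fspan {wedge fscale (U A) (map unit_vec as)}"
  by (rule fs.Lam_eq_line[OF basis_list_U[OF assms]])

lemma ext_mult_U_wedge:
  assumes as: "set as = A" "length as = p" and bs: "set bs = B" "length bs = q" and AB: "A \<subseteq> C" "B \<subseteq> C"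
  shows "ext_mult fscale (U C) p q (wedge fscale (U A) (map unit_vec as))
    (wedge fscale (U B) (map unit_vec bs)) =
    wedge fscale (U C :: ('a \<Rightarrow> 'k::field) set) (map unit_vec (as @ bs))"
  unfolding map_append
  by (rule fs.ext_mult_wedge[OF subspace_U U_mono subspace_U U_mono subspace_U])
    (use assms in \<open>auto simp: U_def intro!: fs.span_base\<close>)

lemma delta_linear_into:
  fixes I J :: "'a set"
  assumes I: "finite I" and J: "J \<subseteq> I"
  shows "linear_on fscale fscale (Lam fscale (U I :: ('a \<Rightarrow> 'k::field) set)) (delta I J)"
    and "delta I J ` Lam fscale (U I :: ('a \<Rightarrow> 'k) set) \<subseteq>
      tensor (Lam fscale (U (I - J))) (Lam fscale (U J))"
proof -
  have fin: "finite J" "finite (I - J)" using finite_subset[OF J I] I by auto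
  obtain as bs where as: "set as = I - J" "distinct as" and bs: "set bs = J" "distinct bs"
    using fin finite_distinct_list by metis
  let ?w = "\<lambda>A as. wedge fscale (U A :: ('a \<Rightarrow> 'k) set) (map unit_vec as)"
  let ?\<beta> = "ext_mult fscale (U I :: ('a \<Rightarrow> 'k) set) (card (I - J)) (card J)"
  have abs: "distinct (as @ bs)" "set (as @ bs) = I" using as bs J by auto
  note lines = Lam_U_line[OF as(2,1), where ?'k = 'k] Lam_U_line[OF bs(2,1), where ?'k = 'k]
    Lam_U_line[OF abs, where ?'k = 'k]
  have card: "length as = card (I - J)" "length bs = card J"
    using distinct_card[OF as(2)] distinct_card[OF bs(2)] as bs by auto
  have eq: "?\<beta> (?w (I - J) as) (?w J bs) = ?w I (as @ bs)"
    by (rule ext_mult_U_wedge[OF as(1) card(1) bs(1) card(2)]) (use J in auto)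
  have bil: "bilinear_map (Lam fscale (U (I - J))) (Lam fscale (U J)) ?\<beta>"
    unfolding Lam_def dim_U[OF fin(1)] dim_U[OF fin(2)]
    by (rule fs.bilinear_ext_mult[OF subspace_U U_mono subspace_U U_mono subspace_U]) (use J in auto)
  have nz: "?w I (as @ bs) \<noteq> 0" by (rule fs.wedge_basis_nonzero[OF basis_list_U[OF abs]])
  show "linear_on fscale fscale (Lam fscale (U I :: ('a \<Rightarrow> 'k) set)) (delta I J)"
    and "delta I J ` Lam fscale (U I :: ('a \<Rightarrow> 'k) set) \<subseteq>
      tensor (Lam fscale (U (I - J))) (Lam fscale (U J))"
    unfolding delta_def by (rule inv_tlift_line[of _ "?w (I - J) as" _ "?w J bs" _ "?w I (as @ bs)" ?\<beta>, OF lines bil eq nz])+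
qed

text \<open>Makes the definite description in \<open>phi0\<close> meaningful: multiplication by
  \<open>unit_vec a\<close> from the left carries the wedge of the unit vectors of
  \<open>I - {a}\<close> to a generator of the top power of \<open>U I\<close>, and thus is a
  bijection of lines.\<close>

lemma head_ex1:
  fixes \<omega> :: "('k::field, 'a \<Rightarrow> 'k) ext"
  assumes I: "finite I" and a: "a \<in> I" and \<omega>: "\<omega> \<in> Lam fscale (U I)"
  shows "\<exists>!u. u \<in> Lam fscale (U (I - {a})) \<and>
    ext_mult fscale (U I) 1 (card (I - {a})) (wedge fscale (U {a}) [unit_vec a]) u = \<omega>"
proof -
  obtain bs where bs: "set bs = I - {a}" "distinct bs" using I finite_distinct_list[of "I - {a}"] by auto
  let ?w = "\<lambda>A as. wedge fscale (U A :: ('a \<Rightarrow> 'k) set) (map unit_vec as)"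
  let ?m = "ext_mult fscale (U I) 1 (card (I - {a})) (?w {a} [a])"
  have abs: "distinct ([a] @ bs)" "set ([a] @ bs) = I" using bs a by auto
  have card: "length bs = card (I - {a})" using distinct_card[OF bs(2)] bs by auto
  have eq: "?m (?w (I - {a}) bs) = ?w I ([a] @ bs)"
    by (rule ext_mult_U_wedge[OF _ _ bs(1) card(1)]) (use a in auto)
  have "?w {a} [a] \<in> ext_power fscale 1 (U {a})"
    using fs.wedge_in_ext_power[of "map unit_vec [a]" "U {a} :: ('a \<Rightarrow> 'k) set"]
    by (simp add: U_def fs.span_base)
  moreover have "bilinear_map (ext_power fscale 1 (U {a}))
      (ext_power fscale (card (I - {a})) (U (I - {a})))
      (ext_mult fscale (U I :: ('a \<Rightarrow> 'k) set) 1 (card (I - {a})))"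
    by (rule fs.bilinear_ext_mult[OF subspace_U U_mono subspace_U U_mono subspace_U]) (use a in auto)
  moreover have "Lam fscale (U (I - {a}) :: ('a \<Rightarrow> 'k) set) = ext_power fscale (card (I - {a})) (U (I - {a}))"
    unfolding Lam_def using dim_U[of "I - {a}", where ?'k = 'k] I by simp
  ultimately have lin: "linear_on fscale fscale (Lam fscale (U (I - {a}))) ?m"
    unfolding bilinear_map_def by simp
  have nz: "?w I ([a] @ bs) \<noteq> 0" by (rule fs.wedge_basis_nonzero[OF basis_list_U[OF abs]])
  have "bij_betw ?m (Lam fscale (U (I - {a}))) (Lam fscale (U I))"
    by (rule linear_line_bij[of _ "?w (I - {a}) bs" _ "?w I ([a] @ bs)" ?m, OF Lam_U_line[OF bs(2,1)] Lam_U_line[OF abs] lin eq nz])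
  from bij_betw_ex1[OF this \<omega>] show ?thesis unfolding list.map .
qed

subsection \<open>Splitting the exterior power of a dual space\<close>

lemma coset_eq_iff:
  assumes "vector_space s" "Modules.module.subspace s N"
  shows "coset N x = coset N y \<longleftrightarrow> x - y \<in> N"
proof -
  interpret m: vector_space s by fact
  have N: "0 \<in> N" "\<And>u v. u \<in> N \<Longrightarrow> v \<in> N \<Longrightarrow> u + v \<in> N" "\<And>u. u \<in> N \<Longrightarrow> - u \<in> N"
    using assms(2) m.subspace_0 m.subspace_add m.subspace_neg by auto
  have mem: "z \<in> coset N x \<longleftrightarrow> z - x \<in> N" for z x
    unfolding coset_def image_iff by (metis add_diff_cancel_left' diff_add_cancel add.commute)
  show ?thesis
  proof
    assume "coset N x = coset N y"
    then show "x - y \<in> N" using mem[of x x] mem[of x y] N(1) by simp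
  next
    assume *: "x - y \<in> N"
    show "coset N x = coset N y"
    proof (rule Set.set_eqI)
      fix z
      have "z - y = (z - x) + (x - y)" "z - x = (z - y) + - (x - y)" by simp_all
      then show "z \<in> coset N x \<longleftrightarrow> z \<in> coset N y" unfolding mem using N(2,3) * by metis
    qed
  qed
qed

lemma linear_quot_pull: "linear_on fscale fscale A (quot_pull X N)"
  unfolding linear_on_def quot_pull_def by (auto simp: fun_eq_iff fscale_def)

lemma inj_on_quot_pull: "inj_on (quot_pull X N) (quot_dual s X N)"
proof (rule inj_onI, rule ext)
  fix \<kappa> \<kappa>' C
  assume *: "\<kappa> \<in> quot_dual s X N" "\<kappa>' \<in> quot_dual s X N" "quot_pull X N \<kappa> = quot_pull X N \<kappa>'"
  show "\<kappa> C = \<kappa>' C"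
  proof (cases "C \<in> coset N ` X")
    case True
    then obtain x where "x \<in> X" "C = coset N x" by blast
    then show ?thesis using fun_cong[OF *(3), of x] by (simp add: quot_pull_def)
  next
    case False
    then show ?thesis using * by (simp add: quot_dual_def)
  qed
qed

lemma subspace_quot_dual: "fs.subspace (quot_dual s X N)"
  by (rule fs.subspaceI) (auto simp: quot_dual_def linear_on_def fscale_def algebra_simps)

text \<open>The dual of the quotient is identified with the annihilator of \<open>N\<close>.
  Conversely, a functional in the annihilator is evaluated on a coset at a chosen representative;
  since it vanishes on \<open>N\<close>, the choice does not affect the value.\<close>

lemma quot_pull_image:
  assumes s: "vector_space s" and N: "Modules.module.subspace s N" "N \<subseteq> X"
    and X: "Modules.module.subspace s X"
  shows "quot_pull X N ` quot_dual s X N = {f \<in> dual s X. \<forall>x\<in>N. f x = 0}"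
proof -
  interpret m: vector_space s by fact
  have "quot_pull X N \<kappa> \<in> {f \<in> dual s X. \<forall>x\<in>N. f x = 0}" if \<kappa>: "\<kappa> \<in> quot_dual s X N" for \<kappa>
  proof -
    have lin: "linear_on s (*) X (\<lambda>x. \<kappa> (coset N x))" using \<kappa> by (simp add: quot_dual_def)
    have "\<kappa> (coset N 0) = 0"
      using lin m.subspace_0[OF X] unfolding linear_on_def by (metis m.scale_zero_left mult_zero_left)
    moreover have "coset N x = coset N 0" if "x \<in> N" for x
      using coset_eq_iff[OF s N(1)] that by simp
    moreover have "quot_pull X N \<kappa> = res X (\<lambda>x. \<kappa> (coset N x))" by (simp add: quot_pull_def res_def)
    ultimately show ?thesis using m.res_in_dual[OF X lin] N(2) by (auto simp: res_def)
  qed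
  moreover have "f \<in> quot_pull X N ` quot_dual s X N" if f: "f \<in> dual s X" "\<forall>x\<in>N. f x = 0" for f
  proof -
    define \<kappa> where "\<kappa> C = (if C \<in> coset N ` X then f (SOME x. x \<in> X \<and> coset N x = C) else 0)" for C
    have lin: "linear_on s (*) X f" and out: "\<And>x. x \<notin> X \<Longrightarrow> f x = 0" using f by (auto simp: dual_def)
    have \<kappa>: "\<kappa> (coset N x) = f x" if x: "x \<in> X" for x
    proof -
      define y where "y = (SOME y. y \<in> X \<and> coset N y = coset N x)"
      have y: "y \<in> X" "coset N y = coset N x"
        unfolding y_def using someI[of "\<lambda>y. y \<in> X \<and> coset N y = coset N x" x] x by blast+
      then have "y - x \<in> N" using coset_eq_iff[OF s N(1)] by blast
      then have "f (y - x) = 0" "y - x \<in> X" using f N(2) by auto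
      moreover from this have "f ((y - x) + x) = f (y - x) + f x"
        using lin x unfolding linear_on_def by blast
      moreover have "\<kappa> (coset N x) = f y" using x by (simp add: \<kappa>_def y_def)
      ultimately show ?thesis by simp
    qed
    have "linear_on s (*) X (\<lambda>x. \<kappa> (coset N x))"
      using lin linear_on_cong[OF X s, of "\<lambda>x. \<kappa> (coset N x)" f] \<kappa> by blast
    then have "\<kappa> \<in> quot_dual s X N" by (auto simp: quot_dual_def \<kappa>_def)
    moreover have "quot_pull X N \<kappa> = f" using \<kappa> out by (auto simp: quot_pull_def fun_eq_iff)
    ultimately show ?thesis by blast
  qed
  ultimately show ?thesis by blast
qed

text \<open>A linear projection onto \<open>N\<close> turns restriction of functionals into a split surjection.\<close>

lemma dual_section_exists:
  assumes s: "vector_space s" and N: "Modules.module.subspace s N" "N \<subseteq> X"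
    and X: "Modules.module.subspace s X"
  obtains \<sigma> where "linear_on fscale fscale (dual s N) \<sigma>" "\<sigma> ` dual s N \<subseteq> dual s X"
    "\<And>f. f \<in> dual s N \<Longrightarrow> res N (\<sigma> f) = f"
proof -
  interpret m: vector_space s by fact
  interpret vector_space_pair s s by unfold_locales
  obtain \<pi> where \<pi>: "\<pi> ` UNIV \<subseteq> N" "Vector_Spaces.linear s s \<pi>" "\<forall>v\<in>N. \<pi> v = v"
    using linear_exists_left_inverse_on[of "\<lambda>x. x" N] m.linear_id N(1) m.module_hom_ident by auto
  have lin: "linear_on s s X \<pi>"
    using module_hom.add module_hom.scale \<pi>(2) unfolding linear_on_def linear_iff_module_hom by metis
  let ?\<sigma> = "\<lambda>f. res X (\<lambda>x. f (\<pi> x))"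
  show thesis
  proof (rule that[of ?\<sigma>])
    show "linear_on fscale fscale (dual s N) ?\<sigma>"
      by (auto simp: linear_on_def res_def fun_eq_iff fscale_def)
    show "?\<sigma> ` dual s N \<subseteq> dual s X"
    proof (intro image_subsetI m.res_in_dual[OF X])
      fix f assume "f \<in> dual s N"
      then have "linear_on s (*) N f" by (simp add: dual_def)
      then show "linear_on s (*) X (\<lambda>x. f (\<pi> x))"
        by (rule linear_on_compose[OF lin]) (use \<pi>(1) in blast)
    qed
    show "res N (?\<sigma> f) = f" if "f \<in> dual s N" for f
      using that \<pi>(3) N(2) by (auto simp: res_def dual_def fun_eq_iff)
  qed
qed

text \<open>The vectors \<open>us\<close> span everything that \<rho> kills, so a product with their
  wedge depends on \<open>F\<close> only through its image under \<rho>. Indeed, after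
  \<open>us\<close> each argument \<open>x\<close> of a form may be replaced by
  \<open>\<sigma> (\<rho> x)\<close>: the difference is a combination of \<open>us\<close> and
  produces repeated arguments. Applied to the restriction of functionals, this is the independence
  of the lift used for \<open>amap\<close>.\<close>

lemma ext_mult_restrict_eq:
  fixes s :: "'a::field \<Rightarrow> 'b::ab_group_add \<Rightarrow> 'b" and s' :: "'a \<Rightarrow> 'c::ab_group_add \<Rightarrow> 'c"
  assumes s: "vector_space s" and X: "Modules.module.subspace s X"
    and s': "vector_space s'" and Y: "Modules.module.subspace s' Y"
    and \<rho>: "linear_on s s' X \<rho>" "\<rho> ` X \<subseteq> Y"
    and \<sigma>: "linear_on s' s Y \<sigma>" "\<sigma> ` Y \<subseteq> X" "\<And>y. y \<in> Y \<Longrightarrow> \<rho> (\<sigma> y) = y"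
    and us: "set us \<subseteq> X" "length us = p" "\<And>x. x \<in> X \<Longrightarrow> \<rho> x = 0 \<Longrightarrow> x \<in> Modules.module.span s (set us)"
    and F: "F \<in> ext_power s r X" and G: "G \<in> ext_power s r X"
    and eq: "ext_map s' Y r \<rho> F = ext_map s' Y r \<rho> G"
  shows "ext_mult s X p r (wedge s X us) F = ext_mult s X p r (wedge s X us) G"
proof
  interpret m: vector_space s by fact
  interpret m': vector_space s' by fact
  interpret k: vector_space "(*) :: 'a \<Rightarrow> 'a \<Rightarrow> 'a" by (rule vector_space_mult)
  fix \<alpha>
  show "ext_mult s X p r (wedge s X us) F \<alpha> = ext_mult s X p r (wedge s X us) G \<alpha>"
  proof (cases "alternating_form s X (p + r) \<alpha>")
    case True
    have lin: "linear_on s (*) X (\<lambda>x. \<alpha> (us @ ps @ x # qs))"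
      if "set ps \<subseteq> X" "set qs \<subseteq> X" "r = Suc (length ps + length qs)" for ps qs
      using m.multilinear_form_linear[OF _ X, of "p + r" \<alpha> "us @ ps" qs] True us that
      by (auto simp: alternating_form_def)
    have \<sigma>\<rho>: "\<sigma> (\<rho> x) \<in> X" if "x \<in> X" for x using that \<rho>(2) \<sigma>(2) by auto
    have slot: "\<alpha> (us @ ps @ x # qs) = \<alpha> (us @ ps @ \<sigma> (\<rho> x) # qs)"
      if x: "x \<in> X" and pq: "set ps \<subseteq> X" "set qs \<subseteq> X" "r = Suc (length ps + length qs)" for x ps qs
    proof -
      let ?z = "x - \<sigma> (\<rho> x)"
      have z: "?z \<in> X" using x \<sigma>\<rho> m.subspace_diff[OF X] by blast
      have "\<rho> x = \<rho> (?z + \<sigma> (\<rho> x))" by simp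
      also have "\<dots> = \<rho> ?z + \<rho> (\<sigma> (\<rho> x))"
        using \<rho>(1) z \<sigma>\<rho>[OF x] unfolding linear_on_def by blast
      also have "\<rho> (\<sigma> (\<rho> x)) = \<rho> x" using \<sigma>(3) \<rho>(2) x by blast
      finally have zu: "?z \<in> m.span (set us)" using us(3)[OF z] by simp
      have "\<alpha> (us @ ps @ ?z # qs) \<in> {0}"
      proof (rule linear_on_span_mem[OF s vector_space_mult _ _ _ zu])
        show "linear_on s (*) (m.span (set us)) (\<lambda>x. \<alpha> (us @ ps @ x # qs))"
          using linear_on_subset[OF lin[OF pq]] m.span_minimal[OF us(1) X] by blast
        fix u assume "u \<in> set us"
        then have "length (us @ ps @ u # qs) = p + r \<and> set (us @ ps @ u # qs) \<subseteq> X \<and> \<not> distinct (us @ ps @ u # qs)"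
          using us pq by auto
        then show "\<alpha> (us @ ps @ u # qs) \<in> {0}" using True unfolding alternating_form_def by blast
      qed (rule k.subspace_single_0)
      moreover have "\<alpha> (us @ ps @ (?z + \<sigma> (\<rho> x)) # qs) =
          \<alpha> (us @ ps @ ?z # qs) + \<alpha> (us @ ps @ \<sigma> (\<rho> x) # qs)"
        using lin[OF pq] z \<sigma>\<rho>[OF x] unfolding linear_on_def by blast
      ultimately show ?thesis by simp
    qed
    have all: "\<alpha> (us @ map (\<lambda>x. \<sigma> (\<rho> x)) ps @ qs) = \<alpha> (us @ ps @ qs)"
      if "set ps \<subseteq> X" "set qs \<subseteq> X" "r = length ps + length qs" for ps qs
      using that
    proof (induction ps arbitrary: qs rule: rev_induct)
      case (snoc x ps)
      then show ?case using slot[of x ps qs] \<sigma>\<rho>[of x] by simp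
    qed simp
    \<comment> \<open>A form on \<open>Y\<close> whose pullback along \<rho> agrees on
      \<open>X\<close> with \<alpha> after \<open>us\<close>; evaluating at it uses only the image
      of \<open>F\<close>.\<close>
    let ?\<gamma> = "\<lambda>zs. \<alpha> (us @ map \<sigma> zs)"
    have alt: "alternating_form s X r (\<lambda>ys. \<alpha> (us @ ys))"
      unfolding alternating_form_def
    proof (intro conjI allI impI m.multilinear_formI lin)
      fix xs assume "length xs = r \<and> set xs \<subseteq> X \<and> \<not> distinct xs"
      then have "length (us @ xs) = p + r \<and> set (us @ xs) \<subseteq> X \<and> \<not> distinct (us @ xs)"
        using us by auto
      then show "\<alpha> (us @ xs) = 0" using True unfolding alternating_form_def by blast
    qed
    have alt': "alternating_form s' Y r ?\<gamma>" by (rule alternating_form_map[OF \<sigma>(1,2) alt])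
    have part: "H (\<lambda>ys. \<alpha> (us @ ys)) = ext_map s' Y r \<rho> H ?\<gamma>" if H: "H \<in> ext_power s r X" for H
    proof -
      have "H (\<lambda>ys. \<alpha> (us @ ys)) = H (\<lambda>ys. \<alpha> (us @ map \<sigma> (map \<rho> ys)))"
        by (rule m.ext_power_apply_cong[OF H X]) (use all[of _ "[]"] in \<open>simp add: comp_def\<close>)
      then show ?thesis using alt' by (simp add: ext_map_def)
    qed
    have val: "ext_mult s X p r (wedge s X us) H \<alpha> = H (\<lambda>ys. \<alpha> (us @ ys))" if H: "H \<in> ext_power s r X" for H
      using m.alternating_form_partial[OF X subset_refl X subset_refl X H True] True us(2)
      by (simp add: ext_mult_def wedge_def)
    show ?thesis unfolding val[OF F] val[OF G] part[OF F] part[OF G] eq ..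
  qed (simp add: ext_mult_def)
qed

text \<open>The dual of \<open>V \<phi> I\<close> is the direct sum of the annihilator
  \<open>A\<close> of \<open>V \<phi> J\<close>, which is the image of \<open>K_dual\<close>, and of
  the image of a linear section \<sigma> of restriction. Concatenated bases of the two summands give
  a generator of the top power, which the product hits.\<close>

lemma amap_linear_into:
  assumes s: "vector_space s" and VI: "Modules.module.subspace s (V \<phi> I)"
    and VJ: "Modules.module.subspace s (V \<phi> J)" "V \<phi> J \<subseteq> V \<phi> I"
    and fin: "V \<phi> I \<subseteq> Modules.module.span s B" "finite B"
  shows "linear_on fscale fscale (Lam fscale (dual s (V \<phi> I))) (amap s \<phi> I J)"
    and "amap s \<phi> I J ` Lam fscale (dual s (V \<phi> I)) \<subseteq>
      tensor (Lam fscale (K_dual s \<phi> I J)) (Lam fscale (dual s (V \<phi> J)))"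
proof -
  interpret m: vector_space s by fact
  let ?X = "dual s (V \<phi> I)" and ?Y = "dual s (V \<phi> J)" and ?K = "K_dual s \<phi> I J"
  let ?pull = "quot_pull (V \<phi> I) (V \<phi> J)" and ?res = "res (V \<phi> J) :: ('b \<Rightarrow> 'a) \<Rightarrow> _"
  define A where "A = {f \<in> ?X. \<forall>x\<in>V \<phi> J. f x = 0}"
  obtain \<sigma> where \<sigma>: "linear_on fscale fscale ?Y \<sigma>" "\<sigma> ` ?Y \<subseteq> ?X"
    "\<And>f. f \<in> ?Y \<Longrightarrow> ?res (\<sigma> f) = f"
    using dual_section_exists[OF s VJ VI] by blast
  obtain bI where bI: "basis_list s (V \<phi> I) bI" using m.basis_list_exists[OF VI fin] .
  obtain bJ where bJ: "basis_list s (V \<phi> J) bJ"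
    using m.basis_list_exists[OF VJ(1) _ fin(2)] VJ(2) fin(1) by blast
  have pullA: "?pull ` ?K = A" unfolding A_def K_dual_def by (rule quot_pull_image[OF s VJ VI])
  have subK: "fs.subspace ?K" unfolding K_dual_def by (rule subspace_quot_dual)
  have injK: "inj_on ?pull ?K" unfolding K_dual_def by (rule inj_on_quot_pull)
  have subA: "fs.subspace A"
    using linear_on_subspace_image[OF vector_space_fscale vector_space_fscale linear_quot_pull subK] pullA
    by metis
  note bX = m.basis_list_dual[OF bI]
  obtain as where as: "basis_list fscale A as"
  proof (rule fs.basis_list_exists[OF subA])
    show "A \<subseteq> fs.span (set (map (coordinate s (V \<phi> I) bI) bI))"
      using bX by (auto simp: A_def basis_list_def)
  qed auto
  \<comment> \<open>The basis of \<open>K_dual\<close> is carried over from \<open>A\<close>, whose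
    finite dimension is visible inside the dual of \<open>V \<phi> I\<close>; it is chosen so that
    its pullback is exactly \<open>as\<close>.\<close>
  define ks where "ks = map (inv_into ?K ?pull) as"
  have ks: "basis_list fscale ?K ks"
  proof -
    have "basis_list fscale (inv_into ?K ?pull ` A) ks"
      unfolding ks_def
    proof (rule basis_list_image[OF vector_space_fscale vector_space_fscale _ _ as])
      show "linear_on fscale fscale A (inv_into ?K ?pull)"
        using linear_inv_into[OF vector_space_fscale vector_space_fscale linear_quot_pull injK subK] pullA
        by metis
      show "inj_on (inv_into ?K ?pull) A" using inj_on_inv_into pullA by blast
    qed
    moreover have "inv_into ?K ?pull ` A = ?K" using injK pullA by (metis bij_betw_def bij_betw_inv_into)
    ultimately show ?thesis by simp
  qed
  have map_ks: "map ?pull ks = as"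
  proof -
    have "?pull (inv_into ?K ?pull x) = x" if "x \<in> set as" for x
    proof -
      have "x \<in> ?pull ` ?K" using fs.basis_list_subset[OF as] that unfolding pullA by blast
      then show ?thesis by (rule f_inv_into_f[of x ?pull ?K])
    qed
    then show ?thesis unfolding ks_def map_map comp_def by (rule map_idI)
  qed
  define gs where "gs = map (coordinate s (V \<phi> J) bJ) bJ"
  have gs: "basis_list fscale ?Y gs" unfolding gs_def by (rule m.basis_list_dual[OF bJ])
  have res_mem: "?res f \<in> ?Y" if "f \<in> ?X" for f
    using that VJ(2) m.res_in_dual[OF VJ(1), of f] by (auto simp: dual_def intro: linear_on_subset)
  have \<sigma>gs: "basis_list fscale (\<sigma> ` ?Y) (map \<sigma> gs)"
    by (rule basis_list_image[OF vector_space_fscale vector_space_fscale \<sigma>(1) _ gs])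
      (use \<sigma>(3) in \<open>metis inj_onI\<close>)
  have all: "basis_list fscale ?X (as @ map \<sigma> gs)"
  proof (rule fs.basis_list_append[OF as \<sigma>gs])
    show "A \<inter> \<sigma> ` ?Y \<subseteq> {0}"
    proof
      fix f assume "f \<in> A \<inter> \<sigma> ` ?Y"
      then obtain g where g: "g \<in> ?Y" "f = \<sigma> g" and fA: "f \<in> A" by blast
      have "?res f = 0" using fA by (auto simp: A_def res_def fun_eq_iff)
      then have "g = 0" using \<sigma>(3)[OF g(1)] g(2) by simp
      then have "f = fscale 0 (\<sigma> g)" using \<sigma>(1) g unfolding linear_on_def by (metis fs.scale_zero_left)
      then show "f \<in> {0}" by (simp only: fs.scale_zero_left singleton_iff)
    qed
    show "?X = {x + y |x y. x \<in> A \<and> y \<in> \<sigma> ` ?Y}"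
    proof
      show "{x + y |x y. x \<in> A \<and> y \<in> \<sigma> ` ?Y} \<subseteq> ?X"
      proof clarify
        fix x y assume "x \<in> A" "y \<in> ?Y"
        then have "x \<in> ?X" "\<sigma> y \<in> ?X" using \<sigma>(2) by (auto simp: A_def)
        then show "x + \<sigma> y \<in> ?X" by (rule fs.subspace_add[OF subspace_dual])
      qed
      show "?X \<subseteq> {x + y |x y. x \<in> A \<and> y \<in> \<sigma> ` ?Y}"
      proof
        fix f assume f: "f \<in> ?X"
        let ?g = "\<sigma> (?res f)"
        have g: "?g \<in> \<sigma> ` ?Y" "?g \<in> ?X" using res_mem[OF f] \<sigma>(2) by auto
        have "(f - ?g) x = 0" if "x \<in> V \<phi> J" for x
          using fun_cong[OF \<sigma>(3)[OF res_mem[OF f]], of x] that by (simp add: res_def)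
        then have "f - ?g \<in> A" using fs.subspace_diff[OF subspace_dual f g(2)] by (simp add: A_def)
        then show "f \<in> {x + y |x y. x \<in> A \<and> y \<in> \<sigma> ` ?Y}"
          using g(1) by (intro CollectI exI[of _ "f - ?g"] exI[of _ ?g]) simp
      qed
    qed
  qed
  let ?p = "fs.dim ?K" and ?r = "m.dim (V \<phi> J)"
  have p: "length ks = ?p" using fs.basis_list_dim[OF ks] by simp
  have r: "fs.dim ?Y = ?r" "length gs = ?r" using m.dim_dual[OF bJ] fs.basis_list_dim[OF gs] by auto
  have asX: "set as \<subseteq> ?X" using fs.basis_list_subset[OF as] by (auto simp: A_def)
  have pullX: "?pull ` ?K \<subseteq> ?X" using pullA by (auto simp: A_def)
  let ?ek = "ext_map fscale ?X ?p ?pull" and ?e\<sigma> = "ext_map fscale ?X ?r \<sigma>"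
  let ?m = "ext_mult fscale ?X ?p ?r"
  have LY: "Lam fscale ?Y = ext_power fscale ?r ?Y" unfolding Lam_def r ..
  note lineK = fs.Lam_eq_line[OF ks] and lineY = fs.Lam_eq_line[OF gs] and lineX = fs.Lam_eq_line[OF all]
  have resl: "linear_on fscale fscale ?X ?res" "?res ` ?X \<subseteq> ?Y" using res_linear res_mem by auto
  have e\<sigma>: "?e\<sigma> f \<in> ext_power fscale ?r ?X" if "f \<in> Lam fscale ?Y" for f
    using ext_map_mem[OF vector_space_fscale \<sigma>(1,2)] that LY by blast
  have ek: "?ek k \<in> ext_power fscale ?p ?X" if "k \<in> Lam fscale ?K" for k
    using ext_map_mem[OF vector_space_fscale linear_quot_pull pullX] that unfolding Lam_def by blast
  have res_e\<sigma>: "ext_map fscale ?Y ?r ?res (?e\<sigma> f) = f" if f: "f \<in> Lam fscale ?Y" for f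
  proof (rule linear_on_span_eq[OF vector_space_fscale vector_space_fscale, of _ _ "\<lambda>f. f"])
    show "f \<in> fspan {wedge fscale ?Y gs}" using f lineY by simp
    show "linear_on fscale fscale (fspan {wedge fscale ?Y gs}) (\<lambda>f. ext_map fscale ?Y ?r ?res (?e\<sigma> f))"
      by (rule linear_on_compose[OF linear_ext_map linear_ext_map subset_UNIV])
    show "linear_on fscale fscale (fspan {wedge fscale ?Y gs}) (\<lambda>f. f)" by (simp add: linear_on_def)
    fix b assume "b \<in> {wedge fscale ?Y gs}"
    then have b: "b = wedge fscale ?Y gs" by simp
    have "map ?res (map \<sigma> gs) = gs"
      unfolding map_map by (rule map_idI) (use fs.basis_list_subset[OF gs] \<sigma>(3) in auto)
    then show "ext_map fscale ?Y ?r ?res (?e\<sigma> b) = b"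
      unfolding b using ext_map_wedge[OF \<sigma>(1,2) r(2)] ext_map_wedge[OF resl, of "map \<sigma> gs" ?r] r(2) by simp
  qed
  have lift: "lift_a s \<phi> I J f \<in> ext_power fscale ?r ?X \<and>
      ext_map fscale ?Y ?r ?res (lift_a s \<phi> I J f) = f" if f: "f \<in> Lam fscale ?Y" for f
    unfolding lift_a_def Let_def by (rule someI[of _ "?e\<sigma> f"]) (use e\<sigma>[OF f] res_e\<sigma>[OF f] in blast)
  \<comment> \<open>\<open>lift_a\<close> picks a lift for each \<open>f\<close> separately and is
    not visibly linear. In a product with the pulled back top power of \<open>K_dual\<close> it may
    be traded for the linear lift induced by \<sigma>, as the vectors \<open>as\<close> span the
    kernel of restriction.\<close>
  have eq_lift: "?m (?ek k) (lift_a s \<phi> I J f) = ?m (?ek k) (?e\<sigma> f)"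
    if k: "k \<in> Lam fscale ?K" and f: "f \<in> Lam fscale ?Y" for k f
  proof (rule linear_on_span_eq[OF vector_space_fscale vector_space_fscale,
        where B = "{wedge fscale ?K ks}" and f = "\<lambda>k. ?m (?ek k) (lift_a s \<phi> I J f)"
          and g = "\<lambda>k. ?m (?ek k) (?e\<sigma> f)"])
    show "k \<in> fspan {wedge fscale ?K ks}" using k lineK by simp
    have lin: "linear_on fscale fscale Z (\<lambda>k. ?m (?ek k) F)" for F Z
      unfolding linear_on_def ext_mult_def ext_map_def by (auto simp: fun_eq_iff fscale_def)
    show "linear_on fscale fscale (fspan {wedge fscale ?K ks}) (\<lambda>k. ?m (?ek k) (lift_a s \<phi> I J f))"
      and "linear_on fscale fscale (fspan {wedge fscale ?K ks}) (\<lambda>k. ?m (?ek k) (?e\<sigma> f))" by (rule lin)+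
    fix b assume "b \<in> {wedge fscale ?K ks}"
    then have "?ek b = wedge fscale ?X as"
      using ext_map_wedge[OF linear_quot_pull pullX p] map_ks by simp
    moreover have "?m (wedge fscale ?X as) (lift_a s \<phi> I J f) = ?m (wedge fscale ?X as) (?e\<sigma> f)"
    proof (rule ext_mult_restrict_eq[OF vector_space_fscale subspace_dual vector_space_fscale subspace_dual
          resl \<sigma> asX])
      show "length as = ?p" using p map_ks by (metis length_map)
      show "x \<in> fspan (set as)" if "x \<in> ?X" "?res x = 0" for x
      proof -
        have "x y = 0" if "y \<in> V \<phi> J" for y
          using fun_cong[OF \<open>?res x = 0\<close>, of y] that by (simp add: res_def)
        then show ?thesis using \<open>x \<in> ?X\<close> as by (simp add: A_def basis_list_def)
      qed
    qed (use lift[OF f] e\<sigma>[OF f] res_e\<sigma>[OF f] in auto)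
    ultimately show "?m (?ek b) (lift_a s \<phi> I J f) = ?m (?ek b) (?e\<sigma> f)" by simp
  qed
  let ?\<beta> = "\<lambda>k f. ?m (?ek k) (lift_a s \<phi> I J f)"
  have "bilinear_map (Lam fscale ?K) (Lam fscale ?Y) (\<lambda>k f. ?m (?ek k) (?e\<sigma> f))"
    by (rule bilinear_map_compose[of _ _ ?m _ ?ek _ ?e\<sigma>, OF fs.bilinear_ext_mult[OF subspace_dual subset_refl
            subspace_dual subset_refl subspace_dual] linear_ext_map _ linear_ext_map])
      (use ek e\<sigma> in auto)
  then have bil: "bilinear_map (Lam fscale ?K) (Lam fscale ?Y) ?\<beta>"
    using bilinear_map_cong[of "Lam fscale ?K" "Lam fscale ?Y" ?\<beta> "\<lambda>k f. ?m (?ek k) (?e\<sigma> f)"] eq_lift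
    by (simp add: lineK lineY)
  have gsX: "set (map \<sigma> gs) \<subseteq> ?X" using fs.basis_list_subset[OF gs] \<sigma>(2) by auto
  have lens: "length as = ?p" "length (map \<sigma> gs) = ?r" using p r(2) map_ks by (metis length_map)+
  have val: "?\<beta> (wedge fscale ?K ks) (wedge fscale ?Y gs) = wedge fscale ?X (as @ map \<sigma> gs)"
  proof -
    have "wedge fscale ?K ks \<in> Lam fscale ?K" "wedge fscale ?Y gs \<in> Lam fscale ?Y"
      by (auto simp: lineK lineY intro: fs.span_base)
    from eq_lift[OF this] show ?thesis
      unfolding ext_map_wedge[OF linear_quot_pull pullX p] ext_map_wedge[OF \<sigma>(1,2) r(2)] map_ks
      by (rule trans[OF _ fs.ext_mult_wedge[OF subspace_dual subset_refl subspace_dual subset_refl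
              subspace_dual asX lens(1) gsX lens(2)]])
  qed
  note nz = fs.wedge_basis_nonzero[OF all]
  note * = inv_tlift_line[of _ "wedge fscale ?K ks" _ "wedge fscale ?Y gs" _ "wedge fscale ?X (as @ map \<sigma> gs)" ?\<beta>,
      OF lineK lineY lineX bil val nz]
  show "linear_on fscale fscale (Lam fscale ?X) (amap s \<phi> I J)"
    and "amap s \<phi> I J ` Lam fscale ?X \<subseteq> tensor (Lam fscale ?K) (Lam fscale ?Y)"
    unfolding amap_def by (rule *)+
qed

subsection \<open>Multiplication of multiplicity spaces\<close>

lemma symmetric_form_Cons:
  fixes s :: "'k::field \<Rightarrow> 'w::ab_group_add \<Rightarrow> 'w"
  assumes "symmetric_form s (Suc m) \<sigma>"
  shows "symmetric_form s m (\<lambda>xs. \<sigma> (x # xs))"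
  unfolding symmetric_form_def multilinear_form_def
proof (intro conjI allI impI)
  fix xs :: "'w list" and i assume "length xs = m \<and> set xs \<subseteq> UNIV \<and> i < m"
  then have "length (x # xs) = Suc m \<and> set (x # xs) \<subseteq> UNIV \<and> Suc i < Suc m" by simp
  then have "linear_on s (*) UNIV (\<lambda>y. \<sigma> ((x # xs)[Suc i := y]))"
    using assms unfolding symmetric_form_def multilinear_form_def by blast
  then show "linear_on s (*) UNIV (\<lambda>y. \<sigma> (x # xs[i := y]))" by simp
next
  fix xs ys :: "'w list" assume "length xs = m \<and> mset xs = mset ys"
  then show "\<sigma> (x # xs) = \<sigma> (x # ys)" using assms unfolding symmetric_form_def by simp
qed

lemma sym_mult_prod:
  assumes "length xs = m"
  shows "sym_mult s m x (sym_prod s xs) = sym_prod s (x # xs)"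
proof
  fix \<sigma>
  show "sym_mult s m x (sym_prod s xs) \<sigma> = sym_prod s (x # xs) \<sigma>"
    using symmetric_form_Cons[of s m \<sigma> x] assms by (simp add: sym_mult_def sym_prod_def)
qed

lemma sym_prod_permute:
  assumes "mset xs = mset ys"
  shows "sym_prod s xs = sym_prod s ys"
proof
  fix \<sigma>
  have len: "length xs = length ys" by (rule mset_eq_length[OF assms])
  have "\<sigma> xs = \<sigma> ys" if "symmetric_form s (length ys) \<sigma>"
    using that len assms unfolding symmetric_form_def by blast
  then show "sym_prod s xs \<sigma> = sym_prod s ys \<sigma>" unfolding sym_prod_def len by simp
qed

lemma linear_sym_mult_right: "linear_on fscale fscale P (sym_mult s m x)"
  unfolding linear_on_def sym_mult_def by (auto simp: fun_eq_iff fscale_def)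

text \<open>A function on forms need not be additive. For a combination of \<open>m\<close>-fold
  products the value is governed by the numbers \<open>\<sigma> (x # xs)\<close>, which are linear
  in \<open>x\<close>; \<open>mult_space_subset\<close> puts the elements of multiplicity spaces
  into this shape.\<close>

lemma linear_sym_mult_left:
  assumes p: "p \<in> fspan {sym_prod s xs | xs. length xs = m}"
  shows "linear_on s fscale UNIV (\<lambda>x. sym_mult s m x p)"
  unfolding linear_on_fun_iff
proof
  fix \<sigma>
  show "linear_on s (*) UNIV (\<lambda>x. sym_mult s m x p \<sigma>)"
  proof (cases "symmetric_form s (Suc m) \<sigma>")
    case True
    have lin: "linear_on s (*) UNIV (\<lambda>x. \<sigma> (x # xs))" if "length xs = m" for xs
    proof -
      have "length (undefined # xs) = Suc m \<and> set (undefined # xs) \<subseteq> UNIV \<and> 0 < Suc m" using that by simp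
      then have "linear_on s (*) UNIV (\<lambda>y. \<sigma> ((undefined # xs)[0 := y]))"
        using True unfolding symmetric_form_def multilinear_form_def by blast
      then show ?thesis by simp
    qed
    have "p (\<lambda>xs. \<sigma> ((x + y) # xs)) = 1 * p (\<lambda>xs. \<sigma> (x # xs)) + 1 * p (\<lambda>xs. \<sigma> (y # xs))" for x y
      by (rule fspan_apply_combination[OF p])
        (use lin symmetric_form_Cons[OF True] in \<open>auto simp: sym_prod_def linear_on_def\<close>)
    moreover have "p (\<lambda>xs. \<sigma> (s c x # xs)) = c * p (\<lambda>xs. \<sigma> (x # xs)) + 0 * p (\<lambda>xs. \<sigma> (x # xs))" for c x
      by (rule fspan_apply_combination[OF p])
        (use lin symmetric_form_Cons[OF True] in \<open>auto simp: sym_prod_def linear_on_def\<close>)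
    ultimately show ?thesis using True by (simp add: linear_on_def sym_mult_def)
  qed (simp add: linear_on_def sym_mult_def)
qed

lemma subspace_mult_space: "fs.subspace (mult_space s S \<I> \<phi> I)"
  by (simp add: mult_space_def)

lemma Tchains_length:
  assumes "J \<in> Tflats S \<I> m" "Is \<in> Tchains S \<I> J"
  shows "length Is = Suc m"
proof -
  have Is: "Is \<noteq> []" "last Is = J" "\<forall>i<length Is. Is ! i \<in> Tflats S \<I> i"
    using assms(2) by (auto simp: Tchains_def)
  then have "Is ! (length Is - 1) = J" "length Is - 1 < length Is" by (auto simp: last_conv_nth)
  then have "J \<in> Tflats S \<I> (length Is - 1)" using Is(3) by blast
  then have "length Is - 1 = m" using assms(1) by (simp add: Tflats_def)
  then show ?thesis using Is(1) by (cases Is) auto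
qed

lemma Tchains_snoc:
  assumes Is: "Is \<in> Tchains S \<I> J" and J: "J \<in> Tflats S \<I> m" and I: "I \<in> Tflats S \<I> (Suc m)"
    and sub: "J \<subseteq> I"
  shows "Is @ [I] \<in> Tchains S \<I> I"
proof -
  have len: "length Is = Suc m" by (rule Tchains_length[OF J Is])
  have "J \<noteq> I" using I J by (auto simp: Tflats_def)
  moreover have "Is ! m = J" using Is len by (auto simp: Tchains_def last_conv_nth)
  ultimately show ?thesis
    using Is I sub len unfolding Tchains_def
    by (auto simp: nth_append less_Suc_eq)
qed

lemma mult_space_subset:
  assumes "J \<in> Tflats S \<I> m"
  shows "mult_space s S \<I> \<phi> J \<subseteq> fspan {sym_prod s xs | xs. length xs = m}"
  unfolding mult_space_def
proof (intro fs.span_minimal fs.subspace_span UN_least)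
  fix Is assume "Is \<in> Tchains S \<I> J"
  then show "chain_space s \<phi> Is \<subseteq> fspan {sym_prod s xs | xs. length xs = m}"
    using Tchains_length[OF assms] unfolding chain_space_def by (intro fs.span_mono) auto
qed

text \<open>Extending a chain that ends in \<open>J\<close> by \<open>I\<close> adds just the factor
  space \<open>D_space \<phi> I J\<close> to the product. \<open>sym_mult\<close> puts
  \<open>x\<close> in front, whereas the factor of the last step of a chain comes last; hence the
  permutation.\<close>

lemma sym_mult_mem:
  assumes J: "J \<in> Tflats S \<I> m" and I: "I \<in> Tflats S \<I> (Suc m)" and sub: "J \<subseteq> I"
    and x: "x \<in> D_space \<phi> I J" and p: "p \<in> mult_space s S \<I> \<phi> J"
  shows "sym_mult s m x p \<in> mult_space s S \<I> \<phi> I"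
proof (rule linear_on_span_mem[OF vector_space_fscale vector_space_fscale linear_sym_mult_right _
      subspace_mult_space p[unfolded mult_space_def]])
  fix q assume "q \<in> (\<Union>Is\<in>Tchains S \<I> J. chain_space s \<phi> Is)"
  then obtain Is where Is: "Is \<in> Tchains S \<I> J" and q: "q \<in> chain_space s \<phi> Is" by blast
  have len: "length Is = Suc m" by (rule Tchains_length[OF J Is])
  have last: "Is ! m = J" using Is len by (auto simp: Tchains_def last_conv_nth)
  show "sym_mult s m x q \<in> mult_space s S \<I> \<phi> I"
  proof (rule linear_on_span_mem[OF vector_space_fscale vector_space_fscale linear_sym_mult_right _
      subspace_mult_space q[unfolded chain_space_def]])
    fix b assume "b \<in> {sym_prod s xs |xs. length xs = length Is - 1 \<and>
        (\<forall>i<length xs. xs ! i \<in> V \<phi> (Is ! Suc i - Is ! i) \<inter> V \<phi> (Is ! i))}"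
    then obtain xs where xs: "b = sym_prod s xs" "length xs = m"
      "\<forall>i<m. xs ! i \<in> V \<phi> (Is ! Suc i - Is ! i) \<inter> V \<phi> (Is ! i)" using len by auto
    have "sym_mult s m x b = sym_prod s (xs @ [x])"
      using sym_mult_prod[OF xs(2), of s x] sym_prod_permute[of "x # xs" "xs @ [x]" s] xs(1) by simp
    moreover have "sym_prod s (xs @ [x]) \<in> chain_space s \<phi> (Is @ [I])"
      unfolding chain_space_def
    proof (rule fs.span_base, intro CollectI exI conjI allI impI)
      fix i assume "i < length (xs @ [x])"
      then consider "i < m" | "i = m" using xs(2) by fastforce
      then show "(xs @ [x]) ! i \<in> V \<phi> ((Is @ [I]) ! Suc i - (Is @ [I]) ! i) \<inter> V \<phi> ((Is @ [I]) ! i)"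
        by cases (use xs len last x in \<open>auto simp: nth_append D_space_def\<close>)
    qed (use len xs in auto)
    ultimately show "sym_mult s m x b \<in> mult_space s S \<I> \<phi> I"
      using Tchains_snoc[OF Is J I sub] unfolding mult_space_def by (auto intro: fs.span_base)
  qed
qed

text \<open>The bilinear form \<open>h (sym_mult s m x p)\<close> on \<open>D_space\<close> and the
  multiplicity space of \<open>J\<close> corresponds to a unique tensor, because
  \<open>D_space\<close> lies in the finitely spanned \<open>V \<phi> J\<close>. The conditions
  defining this tensor are linear in \<open>h\<close>, so uniqueness gives linearity of
  \<open>Delta\<close>.\<close>

lemma Delta_linear_into:
  assumes s: "vector_space s"
    and J: "J \<in> Tflats S \<I> m" and I: "I \<in> Tflats S \<I> (Suc m)" and sub: "J \<subseteq> I"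
    and VJ: "Modules.module.subspace s (V \<phi> J)" "Modules.module.subspace s (V \<phi> (I - J))"
    and fin: "V \<phi> J \<subseteq> Modules.module.span s B" "finite B"
  shows "linear_on fscale fscale (dual fscale (mult_space s S \<I> \<phi> I)) (Delta s S \<I> \<phi> I J m)"
    and "Delta s S \<I> \<phi> I J m ` dual fscale (mult_space s S \<I> \<phi> I) \<subseteq>
      tensor (dual s (D_space \<phi> I J)) (dual fscale (mult_space s S \<I> \<phi> J))"
proof -
  interpret m: vector_space s by fact
  let ?D = "D_space \<phi> I J" and ?P = "mult_space s S \<I> \<phi> J" and ?Q = "mult_space s S \<I> \<phi> I"
  let ?T = "tensor (dual s ?D) (dual fscale ?P)" and ?\<Delta> = "Delta s S \<I> \<phi> I J m"
  have "m.subspace ?D" unfolding D_space_def by (intro m.subspace_inter VJ)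
  then obtain ds where ds: "basis_list s ?D ds"
    using m.basis_list_exists[OF _ _ fin(2), of ?D] fin(1) by (auto simp: D_space_def)
  have ex1: "\<exists>!t. t \<in> ?T \<and> (\<forall>x\<in>?D. \<forall>p\<in>?P. t (\<lambda>g q. g x * q p) = h (sym_mult s m x p))"
    if h: "h \<in> dual fscale ?Q" for h
  proof (rule m.tensor_dual_ex1[OF ds vector_space_fscale subspace_mult_space])
    have hl: "linear_on fscale (*) ?Q h" using h by (simp add: dual_def)
    show "linear_on fscale (*) ?P (\<lambda>p. h (sym_mult s m x p))" if "x \<in> ?D" for x
      by (rule linear_on_compose[OF linear_sym_mult_right hl]) (use sym_mult_mem[OF J I sub that] in blast)
    show "linear_on s (*) ?D (\<lambda>x. h (sym_mult s m x p))" if p: "p \<in> ?P" for p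
    proof (rule linear_on_compose[OF _ hl])
      show "linear_on s fscale ?D (\<lambda>x. sym_mult s m x p)"
        by (rule linear_on_subset[OF linear_sym_mult_left[OF subsetD[OF mult_space_subset[OF J] p]] subset_UNIV])
    qed (use sym_mult_mem[OF J I sub _ p] in blast)
  qed
  have spec: "?\<Delta> h \<in> ?T \<and> (\<forall>x\<in>?D. \<forall>p\<in>?P. ?\<Delta> h (\<lambda>g q. g x * q p) = h (sym_mult s m x p))"
    if "h \<in> dual fscale ?Q" for h
    unfolding Delta_def by (rule theI'[OF ex1[OF that]])
  have uniq: "?\<Delta> h = t"
    if "h \<in> dual fscale ?Q" "t \<in> ?T" "\<forall>x\<in>?D. \<forall>p\<in>?P. t (\<lambda>g q. g x * q p) = h (sym_mult s m x p)" for h t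
    unfolding Delta_def by (rule the1_equality[OF ex1[OF that(1)]]) (use that in blast)
  show "?\<Delta> ` dual fscale ?Q \<subseteq> ?T" using spec by blast
  show "linear_on fscale fscale (dual fscale ?Q) ?\<Delta>"
    unfolding linear_on_def
  proof (intro conjI ballI allI)
    fix h h' assume h: "h \<in> dual fscale ?Q" "h' \<in> dual fscale ?Q"
    show "?\<Delta> (h + h') = ?\<Delta> h + ?\<Delta> h'"
      by (rule uniq) (use spec[OF h(1)] spec[OF h(2)] fs.subspace_add[OF subspace_tensor]
          fs.subspace_add[OF subspace_dual h] in auto)
  next
    fix c h assume h: "h \<in> dual fscale ?Q"
    show "?\<Delta> (fscale c h) = fscale c (?\<Delta> h)"
      by (rule uniq) (use spec[OF h] fs.subspace_scale[OF subspace_tensor]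
          fs.subspace_scale[OF subspace_dual h] in \<open>auto simp: fscale_def\<close>)
  qed
qed

subsection \<open>The permutation of tensor factors\<close>

lemma linear_pure_left: "y \<in> Y \<Longrightarrow> linear_on fscale fscale X (\<lambda>x. pure X Y x y)"
  using bilinear_map_pure[of X Y] by (simp add: bilinear_map_def)

lemma linear_pure_right: "x \<in> X \<Longrightarrow> linear_on fscale fscale Y (pure X Y x)"
  using bilinear_map_pure[of X Y] by (simp add: bilinear_map_def)

text \<open>The permutation is a map linear in six variables, integrated over one tensor pair after
  another. \<open>P1\<close>, \<open>P2\<close> and \<open>P3\<close> are the partial integrals over
  \<open>kf\<close>, then \<open>uv\<close>, then \<open>gq\<close>; each must be shown linear in
  all variables still free before the next \<open>tlift\<close> has its values in
  \<open>Z\<close>.\<close>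

lemma tlift_permute_mem:
  fixes P :: "('d \<Rightarrow> 'k::field) \<Rightarrow> ('s \<Rightarrow> 'k) \<Rightarrow> ('u \<Rightarrow> 'k) \<Rightarrow> ('v \<Rightarrow> 'k) \<Rightarrow> ('x \<Rightarrow> 'k) \<Rightarrow> ('f \<Rightarrow> 'k) \<Rightarrow> 'z \<Rightarrow> 'k"
  assumes sub: "fs.subspace D" "fs.subspace S" "fs.subspace A" "fs.subspace B" "fs.subspace K" "fs.subspace F"
    and lin: "\<And>q u v k f. q \<in> S \<Longrightarrow> u \<in> A \<Longrightarrow> v \<in> B \<Longrightarrow> k \<in> K \<Longrightarrow> f \<in> F \<Longrightarrow>
        linear_on fscale fscale D (\<lambda>g. P g q u v k f)"
      "\<And>g u v k f. g \<in> D \<Longrightarrow> u \<in> A \<Longrightarrow> v \<in> B \<Longrightarrow> k \<in> K \<Longrightarrow> f \<in> F \<Longrightarrow>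
        linear_on fscale fscale S (\<lambda>q. P g q u v k f)"
      "\<And>g q v k f. g \<in> D \<Longrightarrow> q \<in> S \<Longrightarrow> v \<in> B \<Longrightarrow> k \<in> K \<Longrightarrow> f \<in> F \<Longrightarrow>
        linear_on fscale fscale A (\<lambda>u. P g q u v k f)"
      "\<And>g q u k f. g \<in> D \<Longrightarrow> q \<in> S \<Longrightarrow> u \<in> A \<Longrightarrow> k \<in> K \<Longrightarrow> f \<in> F \<Longrightarrow>
        linear_on fscale fscale B (\<lambda>v. P g q u v k f)"
      "\<And>g q u v f. g \<in> D \<Longrightarrow> q \<in> S \<Longrightarrow> u \<in> A \<Longrightarrow> v \<in> B \<Longrightarrow> f \<in> F \<Longrightarrow>
        linear_on fscale fscale K (\<lambda>k. P g q u v k f)"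
      "\<And>g q u v k. g \<in> D \<Longrightarrow> q \<in> S \<Longrightarrow> u \<in> A \<Longrightarrow> v \<in> B \<Longrightarrow> k \<in> K \<Longrightarrow>
        linear_on fscale fscale F (\<lambda>f. P g q u v k f)"
    and mem: "\<And>g q u v k f. g \<in> D \<Longrightarrow> q \<in> S \<Longrightarrow> u \<in> A \<Longrightarrow> v \<in> B \<Longrightarrow> k \<in> K \<Longrightarrow> f \<in> F \<Longrightarrow>
        P g q u v k f \<in> Z" and Z: "fs.subspace Z"
    and t: "t \<in> tensor (tensor D S) (tensor (tensor A B) (tensor K F))"
  shows "tlift (\<lambda>gq. tlift (\<lambda>uv kf. tlift (\<lambda>g q. tlift (\<lambda>u v. tlift (P g q u v) kf) uv) gq)) t \<in> Z"
proof -
  define P1 where "P1 g q u v kf = tlift (P g q u v) kf" for g q u v kf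
  define P2 where "P2 g q uv kf = tlift (\<lambda>u v. P1 g q u v kf) uv" for g q uv kf
  define P3 where "P3 gq uv kf = tlift (\<lambda>g q. P2 g q uv kf) gq" for gq uv kf
  have bil0: "bilinear_map K F (P g q u v)" if "g \<in> D" "q \<in> S" "u \<in> A" "v \<in> B" for g q u v
    by (rule bilinear_mapI) (use that lin(5,6) in auto)
  have lin1: "linear_on fscale fscale D (\<lambda>g. P1 g q u v kf)"
    if "q \<in> S" "u \<in> A" "v \<in> B" "kf \<in> tensor K F" for q u v kf
    unfolding P1_def
    by (rule linear_tlift_parameter[OF that(4) sub(5,6,1)]) (use that bil0 lin(1) in auto)
  have lin2: "linear_on fscale fscale S (\<lambda>q. P1 g q u v kf)"
    if "g \<in> D" "u \<in> A" "v \<in> B" "kf \<in> tensor K F" for g u v kf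
    unfolding P1_def
    by (rule linear_tlift_parameter[OF that(4) sub(5,6,2)]) (use that bil0 lin(2) in auto)
  have lin3: "linear_on fscale fscale A (\<lambda>u. P1 g q u v kf)"
    if "g \<in> D" "q \<in> S" "v \<in> B" "kf \<in> tensor K F" for g q v kf
    unfolding P1_def
    by (rule linear_tlift_parameter[OF that(4) sub(5,6,3)]) (use that bil0 lin(3) in auto)
  have lin4: "linear_on fscale fscale B (\<lambda>v. P1 g q u v kf)"
    if "g \<in> D" "q \<in> S" "u \<in> A" "kf \<in> tensor K F" for g q u kf
    unfolding P1_def
    by (rule linear_tlift_parameter[OF that(4) sub(5,6,4)]) (use that bil0 lin(4) in auto)
  have lin5: "linear_on fscale fscale (tensor K F) (\<lambda>kf. P1 g q u v kf)" for g q u v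
    unfolding P1_def by (rule linear_tlift)
  have mem1: "P1 g q u v kf \<in> Z" if "g \<in> D" "q \<in> S" "u \<in> A" "v \<in> B" "kf \<in> tensor K F" for g q u v kf
    unfolding P1_def by (rule tlift_mem[OF that(5) bil0 Z mem]) (use that in auto)
  have bil1: "bilinear_map A B (\<lambda>u v. P1 g q u v kf)" if "g \<in> D" "q \<in> S" "kf \<in> tensor K F" for g q kf
    by (rule bilinear_mapI) (use that lin3 lin4 in auto)
  have linD: "linear_on fscale fscale D (\<lambda>g. P2 g q uv kf)"
    if "q \<in> S" "uv \<in> tensor A B" "kf \<in> tensor K F" for q uv kf
    unfolding P2_def
    by (rule linear_tlift_parameter[OF that(2) sub(3,4,1)]) (use that bil1 lin1 in auto)
  have linS: "linear_on fscale fscale S (\<lambda>q. P2 g q uv kf)"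
    if "g \<in> D" "uv \<in> tensor A B" "kf \<in> tensor K F" for g uv kf
    unfolding P2_def
    by (rule linear_tlift_parameter[OF that(2) sub(3,4,2)]) (use that bil1 lin2 in auto)
  have linKF: "linear_on fscale fscale (tensor K F) (\<lambda>kf. P2 g q uv kf)"
    if "g \<in> D" "q \<in> S" "uv \<in> tensor A B" for g q uv
    unfolding P2_def
    by (rule linear_tlift_parameter[OF that(3) sub(3,4) subspace_tensor]) (use that bil1 lin5 in auto)
  have linAB: "linear_on fscale fscale (tensor A B) (\<lambda>uv. P2 g q uv kf)" for g q kf
    unfolding P2_def by (rule linear_tlift)
  have mem2: "P2 g q uv kf \<in> Z" if "g \<in> D" "q \<in> S" "uv \<in> tensor A B" "kf \<in> tensor K F" for g q uv kf
    unfolding P2_def by (rule tlift_mem[OF that(3) bil1 Z mem1]) (use that in auto)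
  have bil2: "bilinear_map D S (\<lambda>g q. P2 g q uv kf)" if "uv \<in> tensor A B" "kf \<in> tensor K F" for uv kf
    by (rule bilinear_mapI) (use that linD linS in auto)
  have bil3: "bilinear_map (tensor A B) (tensor K F) (P3 gq)" if "gq \<in> tensor D S" for gq
  proof (rule bilinear_mapI)
    show "linear_on fscale fscale (tensor K F) (P3 gq uv)" if "uv \<in> tensor A B" for uv
      unfolding P3_def
      by (rule linear_tlift_parameter[OF \<open>gq \<in> tensor D S\<close> sub(1,2) subspace_tensor])
        (use that bil2 linKF in auto)
    show "linear_on fscale fscale (tensor A B) (\<lambda>uv. P3 gq uv kf)" if "kf \<in> tensor K F" for kf
      unfolding P3_def
      by (rule linear_tlift_parameter[OF \<open>gq \<in> tensor D S\<close> sub(1,2) subspace_tensor])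
        (use that bil2 linAB in auto)
  qed
  have mem3: "P3 gq uv kf \<in> Z" if "gq \<in> tensor D S" "uv \<in> tensor A B" "kf \<in> tensor K F" for gq uv kf
    unfolding P3_def by (rule tlift_mem[OF that(1) bil2 Z mem2]) (use that in auto)
  have lin3': "linear_on fscale fscale (tensor D S) (\<lambda>gq. P3 gq uv kf)" for uv kf
    unfolding P3_def by (rule linear_tlift)
  have "bilinear_map (tensor D S) (tensor (tensor A B) (tensor K F)) (\<lambda>gq. tlift (P3 gq))"
  proof (rule bilinear_mapI)
    show "linear_on fscale fscale (tensor D S) (\<lambda>gq. tlift (P3 gq) r)"
      if "r \<in> tensor (tensor A B) (tensor K F)" for r
      by (rule linear_tlift_parameter[OF that subspace_tensor subspace_tensor subspace_tensor bil3 lin3'])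
  qed (rule linear_tlift)
  from tlift_mem[OF t this Z] have "tlift (\<lambda>gq. tlift (P3 gq)) t \<in> Z"
    using tlift_mem[OF _ bil3 Z mem3] by blast
  then show ?thesis unfolding P3_def P2_def P1_def .
qed

text \<open>Evaluation of the first factor at \<open>e\<close> followed by scaling of the second is
  bilinear for every \<open>e\<close>, so it passes the test in \<open>pure\<close>; mapping and
  pairing then merge into a single contraction with the scalar \<open>f x e\<close>.\<close>

lemma contraction_eq:
  "tlift (\<lambda>z y. fscale (z e) y) (tmap A Y f (\<lambda>y. y) t) = tlift (\<lambda>x y. fscale (f x e) y) t"
proof
  fix \<gamma>
  have "bilinear_form A Y (\<lambda>z y. z e * y \<gamma>)"
    by (simp add: bilinear_form_def linear_on_def fscale_def algebra_simps)
  then show "tlift (\<lambda>z y. fscale (z e) y) (tmap A Y f (\<lambda>y. y) t) \<gamma> = tlift (\<lambda>x y. fscale (f x e) y) t \<gamma>"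
    by (simp add: tlift_def tmap_def pure_def fscale_apply)
qed

lemma contraction_mem:
  assumes t: "t \<in> tensor X Y" and Y: "fs.subspace Y" and f: "linear_on fscale fscale X f"
  shows "tlift (\<lambda>x y. fscale (f x e) y) t \<in> Y"
proof (rule tlift_mem[OF t _ Y])
  show "bilinear_map X Y (\<lambda>x y. fscale (f x e) y)"
    using f unfolding bilinear_map_def linear_on_def
    by (auto simp: fun_eq_iff fscale_def algebra_simps)
  show "fscale (f x e) y \<in> Y" if "y \<in> Y" for x y using fs.subspace_scale[OF Y that] .
qed

subsection \<open>The maps between T-spaces\<close>

text \<open>Each stage is a substitution in the argument, which gives linearity on the whole ambient
  type and not just on the T-space of \<open>I\<close>. In particular a zero component always
  contributes zero.\<close>

lemma linear_phi_IJ: "linear_on fscale fscale X (phi_IJ s S \<I> \<phi> I J m)"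
  unfolding phi_IJ_def tlift_def tmap_def linear_on_def by (auto simp: fun_eq_iff fscale_def)

lemma subspace_Lam [simp]: "fs.subspace (Lam s X)"
  by (simp add: Lam_def ext_power_def)

lemma subspace_Tspace: "fs.subspace (Tspace s S \<I> \<phi> I)"
  by (simp add: Tspace_def)

context
  fixes s :: "'k::field \<Rightarrow> 'w::ab_group_add \<Rightarrow> 'w" and S :: "'a set" and \<I> :: "'a set set"
    and \<phi> :: "('a \<Rightarrow> 'k) \<Rightarrow> 'w" and I J :: "'a set" and m :: nat
  assumes s: "vector_space s" and S: "finite S" and \<phi>: "linear_on fscale s (U S) \<phi>"
    and I: "I \<in> Tflats S \<I> (Suc m)" and J: "J \<in> Tflats S \<I> m" and JI: "J \<subseteq> I"
begin

lemma V_facts: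
  assumes "A \<subseteq> S"
  shows "Modules.module.subspace s (V \<phi> A)" "V \<phi> A = Modules.module.span s (\<phi> ` unit_vec ` A)"
proof -
  interpret m: vector_space s by (rule s)
  have "linear_on fscale s (fspan (unit_vec ` A)) \<phi>"
    using linear_on_subset[OF \<phi> U_mono[OF assms]] by (simp add: U_def)
  from linear_on_span_image[OF vector_space_fscale s this]
  show "V \<phi> A = m.span (\<phi> ` unit_vec ` A)" by (simp add: V_def U_def)
  then show "m.subspace (V \<phi> A)" by simp
qed

private lemma subsets: "I \<subseteq> S" "J \<subseteq> S" "I - J \<subseteq> S" "finite I" "finite J"
proof -
  show *: "I \<subseteq> S" using I by (simp add: Tflats_def Tflat_def)
  then show "J \<subseteq> S" "I - J \<subseteq> S" using JI by auto
  then show "finite I" "finite J" using * S finite_subset by blast+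
qed

private abbreviation "src \<equiv> tensor
    (tensor (dual s (D_space \<phi> I J)) (dual fscale (mult_space s S \<I> \<phi> J)))
    (tensor (tensor (Lam fscale (U (I - J))) (Lam fscale (U J)))
            (tensor (Lam fscale (K_dual s \<phi> I J)) (Lam fscale (dual s (V \<phi> J)))))"

lemma split_map_mem:
  assumes "t \<in> Tspace s S \<I> \<phi> I"
  shows "tmap
    (tensor (dual s (D_space \<phi> I J)) (dual fscale (mult_space s S \<I> \<phi> J)))
    (tensor (tensor (Lam fscale (U (I - J))) (Lam fscale (U J)))
            (tensor (Lam fscale (K_dual s \<phi> I J)) (Lam fscale (dual s (V \<phi> J)))))
    (Delta s S \<I> \<phi> I J m)
    (tmap
      (tensor (Lam fscale (U (I - J))) (Lam fscale (U J)))
      (tensor (Lam fscale (K_dual s \<phi> I J)) (Lam fscale (dual s (V \<phi> J))))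
      (delta I J) (amap s \<phi> I J)) t \<in> src"
proof -
  interpret m: vector_space s by (rule s)
  have VJI: "V \<phi> J \<subseteq> V \<phi> I" unfolding V_def using U_mono[OF JI] by blast
  have finV: "V \<phi> A \<subseteq> m.span (\<phi> ` unit_vec ` A)" if "A \<subseteq> S" for A using V_facts(2)[OF that] by simp
  have fin: "finite (\<phi> ` unit_vec ` I)" "finite (\<phi> ` unit_vec ` J)" using subsets by auto
  note D = Delta_linear_into[OF s J I JI V_facts(1)[OF subsets(2)] V_facts(1)[OF subsets(3)] finV[OF subsets(2)] fin(2)]
  note d = delta_linear_into[OF subsets(4) JI, where ?'k = 'k]
  note a = amap_linear_into[OF s V_facts(1)[OF subsets(1)] V_facts(1)[OF subsets(2)] VJI finV[OF subsets(1)] fin(1)]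
  show ?thesis
    using tmap_mem[OF D linear_tmap tmap_mem[OF d a]] assms unfolding Tspace_def by blast
qed

lemma perm_map_mem:
  assumes "t \<in> src"
  shows "tlift (\<lambda>gq. tlift (\<lambda>uv kf.
    tlift (\<lambda>g q. tlift (\<lambda>u v. tlift (\<lambda>k f.
      pure (tensor (tensor (dual s (D_space \<phi> I J)) (Lam fscale (K_dual s \<phi> I J))) (Lam fscale (U (I - J))))
           (Tspace s S \<I> \<phi> J)
        (pure (tensor (dual s (D_space \<phi> I J)) (Lam fscale (K_dual s \<phi> I J))) (Lam fscale (U (I - J)))
           (pure (dual s (D_space \<phi> I J)) (Lam fscale (K_dual s \<phi> I J)) g k) u)
        (pure (dual fscale (mult_space s S \<I> \<phi> J)) (UV_space s \<phi> J) q
           (pure (Lam fscale (U J)) (Lam fscale (dual s (V \<phi> J))) v f)))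
    kf) uv) gq)) t \<in> tensor
      (tensor (tensor (dual s (D_space \<phi> I J)) (Lam fscale (K_dual s \<phi> I J))) (Lam fscale (U (I - J))))
      (Tspace s S \<I> \<phi> J)"
proof (rule tlift_permute_mem[OF subspace_dual subspace_dual subspace_Lam subspace_Lam subspace_Lam
      subspace_Lam _ _ _ _ _ _ _ subspace_tensor assms])
  let ?D = "dual s (D_space \<phi> I J)" and ?K = "Lam fscale (K_dual s \<phi> I J)"
    and ?A = "Lam fscale (U (I - J)) :: (('k, 'a \<Rightarrow> 'k) ext) set"
    and ?B = "Lam fscale (U J) :: (('k, 'a \<Rightarrow> 'k) ext) set"
    and ?Q = "dual fscale (mult_space s S \<I> \<phi> J)" and ?F = "Lam fscale (dual s (V \<phi> J))"
  have T: "Tspace s S \<I> \<phi> J = tensor ?Q (tensor ?B ?F)" by (simp add: Tspace_def)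
  show "linear_on fscale fscale ?D (\<lambda>g. pure (tensor (tensor ?D ?K) ?A) (Tspace s S \<I> \<phi> J)
      (pure (tensor ?D ?K) ?A (pure ?D ?K g k) u) (pure ?Q (tensor ?B ?F) q (pure ?B ?F v f)))"
    if "q \<in> ?Q" "u \<in> ?A" "v \<in> ?B" "k \<in> ?K" "f \<in> ?F" for q u v k f
    by (rule linear_on_compose[OF linear_on_compose[OF linear_pure_left linear_pure_left] linear_pure_left])
      (use that T in \<open>auto intro!: pure_in_tensor\<close>)
  show "linear_on fscale fscale ?Q (\<lambda>q. pure (tensor (tensor ?D ?K) ?A) (Tspace s S \<I> \<phi> J)
      (pure (tensor ?D ?K) ?A (pure ?D ?K g k) u) (pure ?Q (tensor ?B ?F) q (pure ?B ?F v f)))"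
    if "g \<in> ?D" "u \<in> ?A" "v \<in> ?B" "k \<in> ?K" "f \<in> ?F" for g u v k f
    by (rule linear_on_compose[OF linear_pure_left linear_pure_right])
      (use that T in \<open>auto intro!: pure_in_tensor\<close>)
  show "linear_on fscale fscale ?A (\<lambda>u. pure (tensor (tensor ?D ?K) ?A) (Tspace s S \<I> \<phi> J)
      (pure (tensor ?D ?K) ?A (pure ?D ?K g k) u) (pure ?Q (tensor ?B ?F) q (pure ?B ?F v f)))"
    if "g \<in> ?D" "q \<in> ?Q" "v \<in> ?B" "k \<in> ?K" "f \<in> ?F" for g q v k f
    by (rule linear_on_compose[OF linear_pure_right linear_pure_left])
      (use that T in \<open>auto intro!: pure_in_tensor\<close>)
  show "linear_on fscale fscale ?B (\<lambda>v. pure (tensor (tensor ?D ?K) ?A) (Tspace s S \<I> \<phi> J)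
      (pure (tensor ?D ?K) ?A (pure ?D ?K g k) u) (pure ?Q (tensor ?B ?F) q (pure ?B ?F v f)))"
    if "g \<in> ?D" "q \<in> ?Q" "u \<in> ?A" "k \<in> ?K" "f \<in> ?F" for g q u k f
    by (rule linear_on_compose[OF linear_on_compose[OF linear_pure_left linear_pure_right] linear_pure_right])
      (use that T in \<open>auto intro!: pure_in_tensor\<close>)
  show "linear_on fscale fscale ?K (\<lambda>k. pure (tensor (tensor ?D ?K) ?A) (Tspace s S \<I> \<phi> J)
      (pure (tensor ?D ?K) ?A (pure ?D ?K g k) u) (pure ?Q (tensor ?B ?F) q (pure ?B ?F v f)))"
    if "g \<in> ?D" "q \<in> ?Q" "u \<in> ?A" "v \<in> ?B" "f \<in> ?F" for g q u v f
    by (rule linear_on_compose[OF linear_on_compose[OF linear_pure_right linear_pure_left] linear_pure_left])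
      (use that T in \<open>auto intro!: pure_in_tensor\<close>)
  show "linear_on fscale fscale ?F (\<lambda>f. pure (tensor (tensor ?D ?K) ?A) (Tspace s S \<I> \<phi> J)
      (pure (tensor ?D ?K) ?A (pure ?D ?K g k) u) (pure ?Q (tensor ?B ?F) q (pure ?B ?F v f)))"
    if "g \<in> ?D" "q \<in> ?Q" "u \<in> ?A" "v \<in> ?B" "k \<in> ?K" for g q u v k
    by (rule linear_on_compose[OF linear_on_compose[OF linear_pure_right linear_pure_right] linear_pure_right])
      (use that T in \<open>auto intro!: pure_in_tensor\<close>)
  show "pure (tensor (tensor ?D ?K) ?A) (Tspace s S \<I> \<phi> J)
      (pure (tensor ?D ?K) ?A (pure ?D ?K g k) u) (pure ?Q (tensor ?B ?F) q (pure ?B ?F v f))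
      \<in> tensor (tensor (tensor ?D ?K) ?A) (Tspace s S \<I> \<phi> J)"
    if "g \<in> ?D" "q \<in> ?Q" "u \<in> ?A" "v \<in> ?B" "k \<in> ?K" "f \<in> ?F" for g q u v k f
    using that T by (auto intro!: pure_in_tensor)
qed

lemma phi_IJ_mem:
  assumes "t \<in> Tspace s S \<I> \<phi> I"
  shows "phi_IJ s S \<I> \<phi> I J m t \<in> Tspace s S \<I> \<phi> J"
  unfolding phi_IJ_def contraction_eq
  by (rule contraction_mem[OF perm_map_mem[OF split_map_mem[OF assms]] subspace_Tspace linear_tmap])

text \<open>Of the ingredients of \<open>phi_IJ\<close> only \<open>wphi\<close> refers to values of \<open>\<phi>\<close> rather than to its images.\<close>

lemma phi_IJ_cong:
  assumes t: "t \<in> Tspace s S \<I> \<phi> I"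
    and V: "V \<phi>' I = V \<phi> I" "V \<phi>' J = V \<phi> J" "V \<phi>' (I - J) = V \<phi> (I - J)"
    and M: "mult_space s S' \<I>' \<phi>' J = mult_space s S \<I> \<phi> J"
    and ind: "I - J \<in> \<I>' \<longleftrightarrow> I - J \<in> \<I>"
    and eq: "\<And>u. u \<in> U (I - J) \<Longrightarrow> \<phi>' u = \<phi> u"
  shows "phi_IJ s S' \<I>' \<phi>' I J m t = phi_IJ s S \<I> \<phi> I J m t"
proof -
  have D: "D_space \<phi>' I J = D_space \<phi> I J" by (simp add: D_space_def V)
  have K: "K_dual s \<phi>' I J = K_dual s \<phi> I J" by (simp add: K_dual_def V)
  have T: "Tspace s S' \<I>' \<phi>' J = Tspace s S \<I> \<phi> J" by (simp add: Tspace_def V M)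
  have \<Delta>: "Delta s S' \<I>' \<phi>' I J m = Delta s S \<I> \<phi> I J m" by (simp add: Delta_def D M fun_eq_iff)
  have a: "amap s \<phi>' I J = amap s \<phi> I J" by (simp add: amap_def lift_a_def V K)
  have b: "bmap s \<phi>' I J = bmap s \<phi> I J" by (simp add: bmap_def lift_b_def D V K)
  have fin: "finite (I - J)" using subsets by simp
  have w: "wphi s \<I>' \<phi>' I J u = wphi s \<I> \<phi> I J u" if "u \<in> Lam fscale (U (I - J))" for u
    using ext_map_cong[OF vector_space_fscale subspace_U, of u "card (I - J)" "I - J" \<phi>' \<phi>] that eq
    by (simp add: wphi_def ind V Lam_def dim_U[OF fin])
  show ?thesis
    \<comment> \<open>After this rewriting all index spaces are identical and the two sides differ
      in \<open>wphi\<close> only, which is compared on the top power of \<open>U (I - J)\<close> by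
      locality of tensors.\<close>
    unfolding phi_IJ_def contraction_eq D K T \<Delta> a b V M
    by (rule tlift_cong[OF perm_map_mem[OF split_map_mem[OF t]] subspace_tensor subspace_Tspace])
      (simp only: tmap_cong[OF _ subspace_tensor subspace_Lam refl w])
qed

end

section \<open>T-flats of a restriction\<close>

lemma matroidD:
  assumes "matroid S \<I>"
  shows "finite S" "A \<in> \<I> \<Longrightarrow> A \<subseteq> S" "{} \<in> \<I>" "A \<in> \<I> \<Longrightarrow> B \<subseteq> A \<Longrightarrow> B \<in> \<I>"
    "A \<in> \<I> \<Longrightarrow> B \<in> \<I> \<Longrightarrow> card A < card B \<Longrightarrow> \<exists>x\<in>B - A. insert x A \<in> \<I>"
    "finite \<I>" "A \<in> \<I> \<Longrightarrow> finite A"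
proof -
  show fin: "finite S" and "{} \<in> \<I>"
    and sub: "A \<in> \<I> \<Longrightarrow> A \<subseteq> S" and "A \<in> \<I> \<Longrightarrow> B \<subseteq> A \<Longrightarrow> B \<in> \<I>"
    and "A \<in> \<I> \<Longrightarrow> B \<in> \<I> \<Longrightarrow> card A < card B \<Longrightarrow> \<exists>x\<in>B - A. insert x A \<in> \<I>"
    using assms unfolding matroid_def by blast+
  show "finite \<I>" using assms fin unfolding matroid_def by (meson finite_Pow_iff finite_subset)
  show "finite A" if "A \<in> \<I>" using sub[OF that] fin by (rule finite_subset)
qed

lemma matroid_restrict:
  assumes M: "matroid S \<I>" and Y: "Y \<subseteq> S"
  shows "matroid Y (mrestrict \<I> Y)"
  unfolding matroid_def mrestrict_def
proof (intro conjI ballI allI impI)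
  show "finite Y" using Y matroidD(1)[OF M] by (rule finite_subset)
  fix A B assume "A \<in> {A \<in> \<I>. A \<subseteq> Y}" "B \<in> {A \<in> \<I>. A \<subseteq> Y}" "card A < card B"
  moreover from this obtain x where "x \<in> B - A" "insert x A \<in> \<I>"
    using matroidD(5)[OF M] by blast
  ultimately show "\<exists>x\<in>B - A. insert x A \<in> {A \<in> \<I>. A \<subseteq> Y}" by auto
qed (use matroidD(3,4)[OF M] in auto)

lemma mrank_eqI:
  assumes "finite F" "B \<in> F" "B \<subseteq> A" "card B = n" "\<And>C. C \<in> F \<Longrightarrow> C \<subseteq> A \<Longrightarrow> card C \<le> n"
  shows "mrank F A = n"
  unfolding mrank_def by (rule Max_eqI) (use assms in auto)

lemma mrank_attained:
  assumes "matroid S \<I>"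
  obtains B where "B \<in> \<I>" "B \<subseteq> A" "card B = mrank \<I> A"
proof -
  have "mrank \<I> A \<in> card ` {B \<in> \<I>. B \<subseteq> A}"
    unfolding mrank_def by (rule Max_in) (use matroidD[OF assms] in auto)
  then show thesis using that by auto
qed

lemma card_le_mrank: "matroid S \<I> \<Longrightarrow> B \<in> \<I> \<Longrightarrow> B \<subseteq> A \<Longrightarrow> card B \<le> mrank \<I> A"
  unfolding mrank_def by (rule Max_ge) (auto simp: matroidD(6))

lemma mrank_restrict: "A \<subseteq> Y \<Longrightarrow> mrank (mrestrict \<I> Y) A = mrank \<I> A"
  unfolding mrank_def mrestrict_def by (rule arg_cong[of _ _ "\<lambda>X. Max (card ` X)"]) auto

lemma mbases_card:
  assumes M: "matroid S \<I>" and B: "B \<in> mbases \<I>"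
  shows "card B = mrank \<I> S"
proof -
  have BI: "B \<in> \<I>" using B by (simp add: mbases_def)
  obtain C where C: "C \<in> \<I>" "card C = mrank \<I> S" using mrank_attained[OF M] .
  have "\<not> card B < card C"
  proof
    assume "card B < card C"
    then obtain x where "x \<in> C - B" "insert x B \<in> \<I>" using matroidD(5)[OF M BI C(1)] by blast
    then show False using B unfolding mbases_def by blast
  qed
  then show ?thesis using C card_le_mrank[OF M BI matroidD(2)[OF M BI]] by simp
qed

lemma mbases_extend:
  assumes M: "matroid S \<I>" and A: "A \<in> \<I>"
  obtains B where "B \<in> mbases \<I>" "A \<subseteq> B"
proof -
  have "finite {B \<in> \<I>. A \<subseteq> B}" using matroidD(6)[OF M] by simp
  moreover have "{B \<in> \<I>. A \<subseteq> B} \<noteq> {}" using A by blast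
  ultimately obtain B where B: "B \<in> {B \<in> \<I>. A \<subseteq> B}" "\<forall>C\<in>{B \<in> \<I>. A \<subseteq> B}. B \<subseteq> C \<longrightarrow> B = C"
    using finite_has_maximal[of "{B \<in> \<I>. A \<subseteq> B}"] by blast
  then have "B \<in> mbases \<I>" unfolding mbases_def by blast
  then show thesis using that B(1) by blast
qed

text \<open>The dual rank of \<open>X\<close> is the maximum of \<open>card (X - B)\<close> over
  bases \<open>B\<close>. As all bases have the same cardinality, \<open>card (X - B)\<close>
  differs from \<open>card (B - X)\<close> by a constant, and the latter is at most the rank of
  \<open>S - X\<close>.\<close>

lemma mrank_dual:
  assumes M: "matroid S \<I>" and X: "X \<subseteq> S"
  shows "mrank (mdual S \<I>) X + mrank \<I> S = card X + mrank \<I> (S - X)"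
proof -
  note finS = matroidD(1)[OF M]
  have split: "card B = card (B \<inter> X) + card (B - X)" "card X = card (B \<inter> X) + card (X - B)"
    if "B \<in> \<I>" for B
    using matroidD(7)[OF M that] finite_subset[OF X finS]
    by (metis card_Int_Diff, metis card_Int_Diff Int_commute)
  have le: "card (B - X) \<le> mrank \<I> (S - X)" if "B \<in> \<I>" for B
    using matroidD(2,4)[OF M that] by (intro card_le_mrank[OF M]) auto
  \<comment> \<open>The maximum is attained at a basis extending a largest independent subset of
    \<open>S - X\<close>.\<close>
  obtain I0 where I0: "I0 \<in> \<I>" "I0 \<subseteq> S - X" "card I0 = mrank \<I> (S - X)" using mrank_attained[OF M] .
  obtain B where B: "B \<in> mbases \<I>" "I0 \<subseteq> B" using mbases_extend[OF M I0(1)] .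
  have BI: "B \<in> \<I>" using B by (simp add: mbases_def)
  have "card I0 \<le> card (B - X)"
    using I0(2) B(2) matroidD(7)[OF M BI] by (intro card_mono) auto
  then have BX: "card (B - X) = mrank \<I> (S - X)" using le[OF BI] I0(3) by simp
  have "mrank (mdual S \<I>) X = card (X - B)"
  proof (rule mrank_eqI)
    have "mdual S \<I> \<subseteq> Pow S" by (auto simp: mdual_def)
    then show "finite (mdual S \<I>)" using finS by (meson finite_Pow_iff finite_subset)
    show "X - B \<in> mdual S \<I>" using B(1) X by (auto simp: mdual_def)
    fix C assume "C \<in> mdual S \<I>" "C \<subseteq> X"
    then obtain B' where B': "B' \<in> mbases \<I>" "C \<subseteq> S - B'" by (auto simp: mdual_def)
    have B'I: "B' \<in> \<I>" using B' by (simp add: mbases_def)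
    have "card C \<le> card (X - B')"
      using B'(2) \<open>C \<subseteq> X\<close> finite_subset[OF X finS] by (intro card_mono) auto
    moreover have "card B' = card B" using mbases_card[OF M] B(1) B'(1) by simp
    ultimately show "card C \<le> card (X - B)" using split[OF BI] split[OF B'I] le[OF B'I] BX by linarith
  qed auto
  then show ?thesis using split[OF BI] BX mbases_card[OF M B(1)] by simp
qed

text \<open>By the corank formula, moving \<open>x\<close> from \<open>A\<close> into its complement
  changes the dual rank of the complement by \<open>1 + r(A - x) - r(A)\<close>, where
  \<open>r\<close> is the rank. Flatness requires this to be positive for each \<open>x\<close> in
  \<open>A\<close>, and properness means that \<open>A\<close> is nonempty.\<close>

lemma Tflat_iff:
  assumes M: "matroid S \<I>"
  shows "Tflat S \<I> A \<longleftrightarrow> A \<subseteq> S \<and> A \<noteq> {} \<and> (\<forall>x\<in>A. mrank \<I> A \<le> mrank \<I> (A - {x}))"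
proof (cases "A \<subseteq> S")
  case True
  note finS = matroidD(1)[OF M]
  have "mrank (mdual S \<I>) (S - A) < mrank (mdual S \<I>) (insert x (S - A)) \<longleftrightarrow>
      mrank \<I> A \<le> mrank \<I> (A - {x})" if x: "x \<in> A" for x
  proof -
    have 1: "mrank (mdual S \<I>) (S - A) + mrank \<I> S = card (S - A) + mrank \<I> A"
      using mrank_dual[OF M, of "S - A"] True by (simp add: double_diff)
    have "S - insert x (S - A) = A - {x}" using True by blast
    then have "mrank (mdual S \<I>) (insert x (S - A)) + mrank \<I> S = card (insert x (S - A)) + mrank \<I> (A - {x})"
      using mrank_dual[OF M, of "insert x (S - A)"] True x by auto
    moreover have "card (insert x (S - A)) = Suc (card (S - A))" using x finS by simp
    ultimately show ?thesis using 1 by linarith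
  qed
  then show ?thesis
    using True unfolding Tflat_def mflat_def by (auto simp: double_diff)
qed (simp add: Tflat_def)

lemma level_restrict: "A \<subseteq> Y \<Longrightarrow> level (mrestrict \<I> Y) A = level \<I> A"
  by (simp add: level_def mrank_restrict)

lemma Tflats_restrict:
  assumes M: "matroid S \<I>" and Y: "Y \<subseteq> S"
  shows "Tflats Y (mrestrict \<I> Y) n = {I \<in> Tflats S \<I> n. I \<subseteq> Y}"
proof -
  have eq: "Tflat Y (mrestrict \<I> Y) A \<longleftrightarrow> Tflat S \<I> A" if "A \<subseteq> Y" for A
  proof -
    have "A - {x} \<subseteq> Y" for x using that by blast
    then show ?thesis
      unfolding Tflat_iff[OF M] Tflat_iff[OF matroid_restrict[OF M Y]]
      using that Y by (simp add: mrank_restrict) blast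
  qed
  show ?thesis
  proof (rule Set.set_eqI)
    fix A
    show "A \<in> Tflats Y (mrestrict \<I> Y) n \<longleftrightarrow> A \<in> {I \<in> Tflats S \<I> n. I \<subseteq> Y}"
    proof (cases "A \<subseteq> Y")
      case True
      then show ?thesis by (simp add: Tflats_def eq level_restrict)
    next
      case False
      then show ?thesis by (simp add: Tflats_def Tflat_def[of Y])
    qed
  qed
qed

text \<open>A largest independent subset of \<open>B\<close> loses at most
  \<open>card (B - A)\<close> points when it is intersected with \<open>A\<close>. The inequality is
  used to compare the truncation at the level of \<open>Y\<close> with that at the level of
  \<open>S\<close>.\<close>

lemma level_mono:
  assumes M: "matroid S \<I>" and A: "A \<subseteq> B" "B \<subseteq> S"
  shows "level \<I> A \<le> level \<I> B"
proof -
  have fin: "finite B" using finite_subset[OF A(2) matroidD(1)[OF M]] .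
  obtain C where C: "C \<in> \<I>" "C \<subseteq> B" "card C = mrank \<I> B" using mrank_attained[OF M] .
  have "card C = card (C \<inter> A) + card (C - A)" using matroidD(7)[OF M C(1)] by (metis card_Int_Diff)
  moreover have "card (C \<inter> A) \<le> mrank \<I> A"
    using matroidD(4)[OF M C(1), of "C \<inter> A"] by (intro card_le_mrank[OF M]) auto
  moreover have "card (C - A) \<le> card (B - A)" using C(2) fin by (intro card_mono) auto
  moreover have "card B = card A + card (B - A)"
    using A(1) fin by (metis Int_absorb1 card_Int_Diff)
  ultimately show ?thesis using C(3) unfolding level_def by linarith
qed

section \<open>Compatibility with restriction\<close>

lemma V_restrict: "A \<subseteq> Y \<Longrightarrow> V (restrict \<phi> (U Y)) A = V \<phi> A"
  unfolding V_def by (rule image_cong) (use U_mono in auto)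

lemma Tchains_nth_subset:
  assumes "Is \<in> Tchains S \<I> I" "i < length Is"
  shows "Is ! i \<subseteq> I"
proof -
  have Is: "Is \<noteq> []" "last Is = I" "\<And>i. Suc i < length Is \<Longrightarrow> Is ! i \<subset> Is ! Suc i"
    using assms(1) by (auto simp: Tchains_def)
  have "i \<le> length Is - 1" using assms(2) by simp
  then show ?thesis
  proof (induction i rule: inc_induct)
    case base
    show ?case using Is(1,2) by (simp add: last_conv_nth)
  next
    case (step i)
    from step(2) have "Suc i < length Is" by simp
    from Is(3)[OF this] step(3) show ?case by blast
  qed
qed

lemma Tchains_restrict:
  assumes M: "matroid S \<I>" and Y: "Y \<subseteq> S" and I: "I \<subseteq> Y"
  shows "Tchains Y (mrestrict \<I> Y) I = Tchains S \<I> I"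
proof
  show "Tchains Y (mrestrict \<I> Y) I \<subseteq> Tchains S \<I> I"
    unfolding Tchains_def Tflats_restrict[OF M Y] by blast
  show "Tchains S \<I> I \<subseteq> Tchains Y (mrestrict \<I> Y) I"
  proof
    fix Is assume Is: "Is \<in> Tchains S \<I> I"
    from Tchains_nth_subset[OF this] I have "\<forall>i<length Is. Is ! i \<subseteq> Y" by blast
    then show "Is \<in> Tchains Y (mrestrict \<I> Y) I"
      using Is unfolding Tchains_def Tflats_restrict[OF M Y] by blast
  qed
qed

lemma mult_space_restrict:
  assumes M: "matroid S \<I>" and Y: "Y \<subseteq> S" and I: "I \<subseteq> Y"
  shows "mult_space s Y (mrestrict \<I> Y) (restrict \<phi> (U Y)) I = mult_space s S \<I> \<phi> I"
proof -
  have "chain_space s (restrict \<phi> (U Y)) Is = chain_space s \<phi> Is" if Is: "Is \<in> Tchains S \<I> I" for Is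
  proof -
    have sub: "Is ! i \<subseteq> Y" if "i < length Is" for i using Tchains_nth_subset[OF Is that] I by blast
    have "(\<forall>i<length xs. xs ! i \<in> V (restrict \<phi> (U Y)) (Is ! Suc i - Is ! i) \<inter> V (restrict \<phi> (U Y)) (Is ! i))
        \<longleftrightarrow> (\<forall>i<length xs. xs ! i \<in> V \<phi> (Is ! Suc i - Is ! i) \<inter> V \<phi> (Is ! i))"
      if "length xs = length Is - 1" for xs
    proof (intro all_cong)
      fix i assume "i < length xs"
      then have "Is ! i \<subseteq> Y" "Is ! Suc i \<subseteq> Y" using sub that by auto
      then have "Is ! i \<subseteq> Y" "Is ! Suc i - Is ! i \<subseteq> Y" by auto
      then show "xs ! i \<in> V (restrict \<phi> (U Y)) (Is ! Suc i - Is ! i) \<inter> V (restrict \<phi> (U Y)) (Is ! i)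
        \<longleftrightarrow> xs ! i \<in> V \<phi> (Is ! Suc i - Is ! i) \<inter> V \<phi> (Is ! i)" by (simp only: V_restrict)
    qed
    then show ?thesis unfolding chain_space_def by (intro arg_cong[of _ _ fspan]) blast
  qed
  then show ?thesis unfolding mult_space_def Tchains_restrict[OF assms] by simp
qed

lemma Tspace_restrict:
  assumes "matroid S \<I>" "Y \<subseteq> S" "I \<subseteq> Y"
  shows "Tspace s Y (mrestrict \<I> Y) (restrict \<phi> (U Y)) I = Tspace s S \<I> \<phi> I"
  by (simp add: Tspace_def mult_space_restrict[OF assms] V_restrict[OF assms(3)])

section \<open>The map from circuits to points\<close>

lemma linear_phi0: "linear_on fscale fscale X (phi0 s \<phi> I a)"
  unfolding phi0_def Let_def by (rule linear_tlift)

text \<open>Read off coordinatewise: at \<open>x \<noteq> a\<close> every value of the integrand has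
  the factor \<open>unit_vec a x = 0\<close>, and a tensor vanishes at the zero form. This avoids
  proving the integrand bilinear, which would involve the definite description in it.\<close>

lemma phi0_mem:
  assumes t: "t \<in> Tspace s S \<I> \<phi> I"
  shows "phi0 s \<phi> I a t \<in> U {a}"
proof -
  have z: "r (\<lambda>x y. 0) = 0" if "r \<in> tensor X Y" for X Y r
  proof -
    have "r (\<lambda>x y. 0) = 0 * r (\<lambda>x y. 0) + 0 * r (\<lambda>x y. 0)"
      by (rule fspan_apply_combination[OF that[unfolded tensor_def]]) (auto simp: pure_def)
    then show ?thesis by simp
  qed
  have "phi0 s \<phi> I a t x = 0" if "x \<noteq> a" for x
  proof -
    have "phi0 s \<phi> I a t x = t (\<lambda>h r. r (\<lambda>\<omega> F. 0))"
      using that by (simp add: phi0_def Let_def tlift_def fscale_def unit_vec_def)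
    also have "\<dots> = t (\<lambda>h r. 0)"
      using t unfolding Tspace_def by (rule tensor_apply_cong) (auto simp: subspace_dual z)
    also have "\<dots> = 0" using t unfolding Tspace_def by (rule z)
    finally show ?thesis .
  qed
  then have "phi0 s \<phi> I a t = fscale (phi0 s \<phi> I a t a) (unit_vec a)"
    by (auto simp: fun_eq_iff fscale_def unit_vec_def)
  moreover have "fscale c (unit_vec a) \<in> U {a}" for c
    by (simp add: U_def fs.span_scale fs.span_base)
  ultimately show ?thesis by metis
qed

text \<open>Apart from the image space, \<open>\<phi>\<close> acts only on the cofactor
  \<open>head \<omega>\<close>. Existence and uniqueness of the cofactor place it in the top power
  of \<open>U (I - {a})\<close>, where \<open>\<phi>\<close> and its restriction induce the same
  map.\<close>

lemma phi0_restrict: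
  fixes s :: "'k::field \<Rightarrow> 'w::ab_group_add \<Rightarrow> 'w" and \<phi> :: "('a \<Rightarrow> 'k) \<Rightarrow> 'w"
  assumes t: "t \<in> Tspace s S \<I> \<phi> I" and I: "finite I" "I \<subseteq> Y" and a: "a \<in> I"
  shows "phi0 s (restrict \<phi> (U Y)) I a t = phi0 s \<phi> I a t"
proof -
  let ?d = "card (I - {a})"
  define head where "head \<omega> = (THE u. u \<in> Lam fscale (U (I - {a})) \<and>
      ext_mult fscale (U I) 1 ?d (wedge fscale (U {a}) [unit_vec a]) u = \<omega>)" for \<omega> :: "('k, 'a \<Rightarrow> 'k) ext"
  have eq: "ext_map s (V \<phi> I) ?d (restrict \<phi> (U Y)) (head \<omega>) = ext_map s (V \<phi> I) ?d \<phi> (head \<omega>)"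
    if \<omega>: "\<omega> \<in> Lam fscale (U I)" for \<omega>
  proof (rule ext_map_cong[OF vector_space_fscale subspace_U])
    have "head \<omega> \<in> Lam fscale (U (I - {a}))"
      unfolding head_def using theI'[OF head_ex1[OF I(1) a \<omega>]] by blast
    then show "head \<omega> \<in> ext_power fscale ?d (U (I - {a}))"
      using I(1) by (simp add: Lam_def dim_U)
    show "restrict \<phi> (U Y) u = \<phi> u" if "u \<in> U (I - {a})" for u
      using that U_mono[of "I - {a}" Y] I(2) by auto
  qed
  show ?thesis
    unfolding phi0_def Let_def V_restrict[OF I(2)] head_def[symmetric]
    using t unfolding Tspace_def
  proof (rule tlift_cong[OF _ subspace_dual subspace_tensor], goal_cases)
    case (1 h r)
    show ?case by (rule tlift_cong[OF 1(2) subspace_Lam subspace_Lam]) (simp only: eq)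
  qed
qed

section \<open>The complexes\<close>

lemma vector_space_dscale: "vector_space (dscale :: 'k::field \<Rightarrow> ('i \<Rightarrow> 'z \<Rightarrow> 'k) \<Rightarrow> _)"
  by unfold_locales (auto simp: dscale_def fscale_def fun_eq_iff algebra_simps)

interpretation ds: vector_space dscale
  by (rule vector_space_dscale)

lemma vector_space_plus_scale:
  assumes "vector_space s"
  shows "vector_space (plus_scale s :: 'k::field \<Rightarrow> ('k, 'a, 'w::ab_group_add) plus_space \<Rightarrow> _)"
proof -
  interpret m: vector_space s by fact
  show ?thesis
    by unfold_locales
      (auto simp: plus_scale_def m.scale_right_distrib m.scale_left_distrib fs.scale_right_distrib
        fs.scale_left_distrib ds.scale_right_distrib ds.scale_left_distrib split: prod.splits)
qed

lemma subspace_dsum: "(\<And>i. i \<in> F \<Longrightarrow> fs.subspace (X i)) \<Longrightarrow> ds.subspace (dsum F X)"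
  by (rule ds.subspaceI)
    (auto simp: dsum_def dscale_def fs.subspace_0 fs.subspace_add fs.subspace_scale split: if_splits)

lemma subspace_T_on: "ds.subspace (T_on s S \<I> \<phi> Y n)"
  unfolding T_on_def by (rule subspace_dsum) (rule subspace_Tspace)

lemma T_on_mono: "Y \<subseteq> Y' \<Longrightarrow> T_on s S \<I> \<phi> Y n \<subseteq> T_on s S \<I> \<phi> Y' n"
proof
  fix x assume Y: "Y \<subseteq> Y'" and x: "x \<in> T_on s S \<I> \<phi> Y n"
  have "0 \<in> Tspace s S \<I> \<phi> I" for I by (rule fs.subspace_0[OF subspace_Tspace])
  then show "x \<in> T_on s S \<I> \<phi> Y' n"
    using x Y unfolding T_on_def dsum_def by (auto split: if_splits)
qed

lemma T_full_eq: "T_full s S \<I> \<phi> n = T_on s S \<I> \<phi> S n"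
  unfolding T_full_def T_on_def by (rule arg_cong[of _ _ "\<lambda>F. dsum F _"]) (auto simp: Tflats_def Tflat_def)

text \<open>Components at T-flats outside \<open>Y\<close> are 0 and hence still lie in their
  T-spaces, so the first statement holds for all T-flats and sums over them can be treated
  uniformly.\<close>

lemma T_onD:
  assumes "x \<in> T_on s S \<I> \<phi> Y n"
  shows "I \<in> Tflats S \<I> n \<Longrightarrow> x I \<in> Tspace s S \<I> \<phi> I" "\<not> I \<subseteq> Y \<Longrightarrow> x I = 0"
proof -
  have "0 \<in> Tspace s S \<I> \<phi> I" by (rule fs.subspace_0[OF subspace_Tspace])
  then show "I \<in> Tflats S \<I> n \<Longrightarrow> x I \<in> Tspace s S \<I> \<phi> I" "\<not> I \<subseteq> Y \<Longrightarrow> x I = 0"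
    using assms unfolding T_on_def dsum_def by (auto split: if_splits)
qed

lemma phi_IJ_zero: "phi_IJ s S \<I> \<phi> I J m 0 = 0"
  using linear_phi_IJ[of UNIV s S \<I> \<phi> I J m] unfolding linear_on_def
  by (metis UNIV_I fs.scale_zero_left)

lemma phi0_zero: "phi0 s \<phi> I a 0 = 0"
  using linear_phi0[of UNIV s \<phi> I a] unfolding linear_on_def
  by (metis UNIV_I fs.scale_zero_left)

lemma linear_phi_Suc: "linear_on dscale dscale X (phi_Suc s S \<I> \<phi> m)"
proof -
  have *: "phi_IJ s S \<I> \<phi> I J m (x + y) = phi_IJ s S \<I> \<phi> I J m x + phi_IJ s S \<I> \<phi> I J m y"
    "phi_IJ s S \<I> \<phi> I J m (fscale c x) = fscale c (phi_IJ s S \<I> \<phi> I J m x)" for I J x y c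
    using linear_phi_IJ[of UNIV s S \<I> \<phi> I J m] unfolding linear_on_def by auto
  have "phi_Suc s S \<I> \<phi> m (x + y) J = (phi_Suc s S \<I> \<phi> m x + phi_Suc s S \<I> \<phi> m y) J" for x y J
    by (cases "J \<in> Tflats S \<I> m")
      (simp_all only: phi_Suc_def if_True if_False plus_fun_apply * fs.scale_right_distrib sum.distrib add_0)
  moreover have "phi_Suc s S \<I> \<phi> m (dscale c x) J = dscale c (phi_Suc s S \<I> \<phi> m x) J" for c x J
    by (cases "J \<in> Tflats S \<I> m")
      (simp_all only: phi_Suc_def if_True if_False dscale_def * fs.scale_sum_right
        fs.scale_left_commute[of c] fs.scale_zero_right)
  ultimately show ?thesis
    unfolding linear_on_def by blast
qed

lemma linear_phi_zero: "linear_on dscale fscale X (phi_zero s S \<I> \<phi>)"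
proof -
  have "phi0 s \<phi> I a (x + y) = phi0 s \<phi> I a x + phi0 s \<phi> I a y"
    "phi0 s \<phi> I a (fscale c x) = fscale c (phi0 s \<phi> I a x)" for I a x y c
    using linear_phi0[of UNIV s \<phi> I a] unfolding linear_on_def by auto
  then show ?thesis
    unfolding linear_on_def phi_zero_def dscale_def
    by (auto simp: fs.scale_right_distrib sum.distrib fs.scale_sum_right mult.commute)
qed

section \<open>The differentials on families supported in Y\<close>

context
  fixes s :: "'k::field \<Rightarrow> 'w::ab_group_add \<Rightarrow> 'w" and S :: "'a set" and \<I> :: "'a set set"
    and \<phi> :: "('a \<Rightarrow> 'k) \<Rightarrow> 'w"
  assumes s: "vector_space s" and M: "matroid S \<I>" and \<phi>: "linear_on fscale s (U S) \<phi>"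
begin

private lemma finS: "finite S" by (rule matroidD(1)[OF M])

lemma phi_Suc_mem:
  assumes x: "x \<in> T_on s S \<I> \<phi> Y (Suc m)"
  shows "phi_Suc s S \<I> \<phi> m x \<in> T_on s S \<I> \<phi> Y m"
  unfolding T_on_def dsum_def
proof (intro CollectI allI)
  fix J
  show "if J \<in> {I \<in> Tflats S \<I> m. I \<subseteq> Y} then phi_Suc s S \<I> \<phi> m x J \<in> Tspace s S \<I> \<phi> J
    else phi_Suc s S \<I> \<phi> m x J = 0"
  proof (cases "J \<in> Tflats S \<I> m")
    case J: True
    show ?thesis
    proof (cases "J \<subseteq> Y")
      case True
      have "phi_Suc s S \<I> \<phi> m x J \<in> Tspace s S \<I> \<phi> J"
        unfolding phi_Suc_def if_P[OF J]
      proof (rule fs.subspace_sum[OF subspace_Tspace], rule fs.subspace_scale[OF subspace_Tspace])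
        fix I assume "I \<in> {I \<in> Tflats S \<I> (Suc m). J \<subseteq> I}"
        then have I: "I \<in> Tflats S \<I> (Suc m)" "J \<subseteq> I" by auto
        show "phi_IJ s S \<I> \<phi> I J m (x I) \<in> Tspace s S \<I> \<phi> J"
          by (rule phi_IJ_mem[OF s finS \<phi> I(1) J I(2) T_onD(1)[OF x I(1)]])
      qed
      with J True show ?thesis by simp
    next
      case False
      \<comment> \<open>Every \<open>I\<close> containing such a \<open>J\<close> also fails to lie
        in \<open>Y\<close>, so all components entering the sum are 0.\<close>
      have "phi_Suc s S \<I> \<phi> m x J = 0"
        unfolding phi_Suc_def if_P[OF J]
      proof (intro sum.neutral ballI)
        fix I assume "I \<in> {I \<in> Tflats S \<I> (Suc m). J \<subseteq> I}"
        then have "\<not> I \<subseteq> Y" using False by blast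
        then show "fscale ((- 1) ^ card J) (phi_IJ s S \<I> \<phi> I J m (x I)) = 0"
          by (simp only: T_onD(2)[OF x] not_False_eq_True phi_IJ_zero fs.scale_zero_right)
      qed
      with False show ?thesis by simp
    qed
  qed (simp add: phi_Suc_def)
qed

lemma phi_zero_mem:
  assumes x: "x \<in> T_on s S \<I> \<phi> Y 0"
  shows "phi_zero s S \<I> \<phi> x \<in> U Y"
  unfolding phi_zero_def
proof (rule fs.subspace_sum[OF subspace_U], rule fs.subspace_sum[OF subspace_U],
    rule fs.subspace_scale[OF subspace_U])
  fix I J assume I: "I \<in> Tflats S \<I> 0" and J: "J \<in> {J \<in> singles S. J \<subseteq> I}"
  then obtain a where a: "J = {a}" "a \<in> I" by (auto simp: singles_def)
  show "phi0 s \<phi> I (the_elem J) (x I) \<in> U Y"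
  proof (cases "I \<subseteq> Y")
    case True
    then show ?thesis
      using phi0_mem[OF T_onD(1)[OF x I], of a] U_mono[of "{a}" Y] a by auto
  next
    case False
    then show ?thesis using T_onD(2)[OF x] phi0_zero fs.subspace_0[OF subspace_U] by metis
  qed
qed

context
  fixes Y :: "'a set"
  assumes Y: "Y \<subseteq> S"
begin

lemma T_on_restrict: "T_full s Y (mrestrict \<I> Y) (restrict \<phi> (U Y)) n = T_on s S \<I> \<phi> Y n"
  unfolding T_full_def T_on_def dsum_def Tflats_restrict[OF M Y]
  using Tspace_restrict[OF M Y] by (intro Collect_cong all_cong1) auto

text \<open>The differential of the restriction has fewer components \<open>J\<close> and fewer
  summands \<open>I\<close>. For a missing \<open>J\<close> the value is 0 on both sides, by
  stability under the differential; a missing \<open>I\<close> is not contained in \<open>Y\<close>,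
  so its component of \<open>x\<close> is 0. The remaining summands agree by
  \<open>phi_IJ_cong\<close>.\<close>

lemma phi_Suc_restrict:
  assumes x: "x \<in> T_on s S \<I> \<phi> Y (Suc m)"
  shows "phi_Suc s Y (mrestrict \<I> Y) (restrict \<phi> (U Y)) m x = phi_Suc s S \<I> \<phi> m x"
proof
  fix J
  show "phi_Suc s Y (mrestrict \<I> Y) (restrict \<phi> (U Y)) m x J = phi_Suc s S \<I> \<phi> m x J"
  proof (cases "J \<in> Tflats S \<I> m \<and> J \<subseteq> Y")
    case False
    then have "phi_Suc s Y (mrestrict \<I> Y) (restrict \<phi> (U Y)) m x J = 0"
      by (auto simp: phi_Suc_def Tflats_restrict[OF M Y])
    moreover have "phi_Suc s S \<I> \<phi> m x J = 0"
      using phi_Suc_mem[OF x] False unfolding T_on_def dsum_def by (auto split: if_splits)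
    ultimately show ?thesis by (rule trans[OF _ sym])
  next
    case True
    then have J: "J \<in> Tflats S \<I> m" "J \<in> Tflats Y (mrestrict \<I> Y) m" "J \<subseteq> Y"
      by (auto simp: Tflats_restrict[OF M Y])
    have fin: "finite {I \<in> Tflats S \<I> (Suc m). J \<subseteq> I}"
      by (rule finite_subset[of _ "Pow S"]) (use finS in \<open>auto simp: Tflats_def Tflat_def\<close>)
    show ?thesis
      unfolding phi_Suc_def if_P[OF J(1)] if_P[OF J(2)]
    proof (rule sum.mono_neutral_cong_left[OF fin])
      show "{I \<in> Tflats Y (mrestrict \<I> Y) (Suc m). J \<subseteq> I} \<subseteq> {I \<in> Tflats S \<I> (Suc m). J \<subseteq> I}"
        by (auto simp: Tflats_restrict[OF M Y])
      show "\<forall>I\<in>{I \<in> Tflats S \<I> (Suc m). J \<subseteq> I} - {I \<in> Tflats Y (mrestrict \<I> Y) (Suc m). J \<subseteq> I}.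
          fscale ((- 1) ^ card J) (phi_IJ s S \<I> \<phi> I J m (x I)) = 0"
      proof
        fix I assume "I \<in> {I \<in> Tflats S \<I> (Suc m). J \<subseteq> I} - {I \<in> Tflats Y (mrestrict \<I> Y) (Suc m). J \<subseteq> I}"
        then have "\<not> I \<subseteq> Y" by (auto simp: Tflats_restrict[OF M Y])
        then show "fscale ((- 1) ^ card J) (phi_IJ s S \<I> \<phi> I J m (x I)) = 0"
          by (simp only: T_onD(2)[OF x] not_False_eq_True phi_IJ_zero fs.scale_zero_right)
      qed
      fix I assume "I \<in> {I \<in> Tflats Y (mrestrict \<I> Y) (Suc m). J \<subseteq> I}"
      then have I: "I \<in> Tflats S \<I> (Suc m)" "I \<subseteq> Y" "J \<subseteq> I" by (auto simp: Tflats_restrict[OF M Y])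
      then have IJ: "I - J \<subseteq> Y" by blast
      have "phi_IJ s Y (mrestrict \<I> Y) (restrict \<phi> (U Y)) I J m (x I) = phi_IJ s S \<I> \<phi> I J m (x I)"
        by (rule phi_IJ_cong[OF s finS \<phi> I(1) J(1) I(3) T_onD(1)[OF x I(1)]
              V_restrict[OF I(2)] V_restrict[OF J(3)] V_restrict[OF IJ] mult_space_restrict[OF M Y J(3)]])
          (use IJ U_mono[OF IJ] in \<open>auto simp: mrestrict_def\<close>)
      then show "fscale ((- 1) ^ card J) (phi_IJ s Y (mrestrict \<I> Y) (restrict \<phi> (U Y)) I J m (x I)) =
          fscale ((- 1) ^ card J) (phi_IJ s S \<I> \<phi> I J m (x I))" by simp
    qed
  qed
qed

lemma phi_zero_restrict:
  assumes x: "x \<in> T_on s S \<I> \<phi> Y 0"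
  shows "phi_zero s Y (mrestrict \<I> Y) (restrict \<phi> (U Y)) x = phi_zero s S \<I> \<phi> x"
  unfolding phi_zero_def
proof (rule sum.mono_neutral_cong_left)
  show "finite (Tflats S \<I> 0)"
    by (rule finite_subset[of _ "Pow S"]) (use finS in \<open>auto simp: Tflats_def Tflat_def\<close>)
  show "Tflats Y (mrestrict \<I> Y) 0 \<subseteq> Tflats S \<I> 0" by (auto simp: Tflats_restrict[OF M Y])
  show "\<forall>I\<in>Tflats S \<I> 0 - Tflats Y (mrestrict \<I> Y) 0.
      (\<Sum>J | J \<in> singles S \<and> J \<subseteq> I. fscale ((- 1) ^ card J) (phi0 s \<phi> I (the_elem J) (x I))) = 0"
  proof
    fix I assume "I \<in> Tflats S \<I> 0 - Tflats Y (mrestrict \<I> Y) 0"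
    then have "\<not> I \<subseteq> Y" by (auto simp: Tflats_restrict[OF M Y])
    then show "(\<Sum>J | J \<in> singles S \<and> J \<subseteq> I. fscale ((- 1) ^ card J) (phi0 s \<phi> I (the_elem J) (x I))) = 0"
      by (intro sum.neutral ballI) (simp only: T_onD(2)[OF x] not_False_eq_True phi0_zero fs.scale_zero_right)
  qed
  fix I assume "I \<in> Tflats Y (mrestrict \<I> Y) 0"
  then have I: "I \<in> Tflats S \<I> 0" "I \<subseteq> Y" by (auto simp: Tflats_restrict[OF M Y])
  have fin: "finite I" using I(2) Y finS by (meson finite_subset)
  show "(\<Sum>J | J \<in> singles Y \<and> J \<subseteq> I.
      fscale ((- 1) ^ card J) (phi0 s (restrict \<phi> (U Y)) I (the_elem J) (x I))) =
    (\<Sum>J | J \<in> singles S \<and> J \<subseteq> I. fscale ((- 1) ^ card J) (phi0 s \<phi> I (the_elem J) (x I)))"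
  proof (rule sum.cong)
    show "{J \<in> singles Y. J \<subseteq> I} = {J \<in> singles S. J \<subseteq> I}" using I(2) Y by (auto simp: singles_def)
    fix J assume "J \<in> {J \<in> singles S. J \<subseteq> I}"
    then obtain a where a: "J = {a}" "a \<in> I" by (auto simp: singles_def)
    have "phi0 s (restrict \<phi> (U Y)) I a (x I) = phi0 s \<phi> I a (x I)"
      by (rule phi0_restrict[OF T_onD(1)[OF x I(1)] fin I(2) a(2)])
    then show "fscale ((- 1) ^ card J) (phi0 s (restrict \<phi> (U Y)) I (the_elem J) (x I)) =
        fscale ((- 1) ^ card J) (phi0 s \<phi> I (the_elem J) (x I))" using a(1) by simp
  qed
qed

end

end

section \<open>Assembling the sequences\<close>

lemma vs_sequence_restrict:
  assumes sc: "vector_space sc" and C: "\<And>n. Modules.module.subspace sc (C n)"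
    and lin: "\<And>n. linear_on sc sc (C (Suc n)) (d n)" and d: "\<And>n. d n ` C (Suc n) \<subseteq> C n"
  shows "vs_sequence sc \<lparr>chain = C, bdry = (\<lambda>n. restrict (d n) (C (Suc n)))\<rparr>"
proof -
  have "linear_on sc sc (C (Suc n)) (restrict (d n) (C (Suc n)))" for n
    using lin[of n] linear_on_cong[OF C sc, of "Suc n" "restrict (d n) (C (Suc n))" "d n" sc] by simp
  then show ?thesis using C d unfolding vs_sequence_def by simp
qed

lemma subcomplex_restrict:
  assumes "vs_sequence sc \<lparr>chain = A, bdry = (\<lambda>n. restrict (d n) (A (Suc n)))\<rparr>"
    and "vs_sequence sc \<lparr>chain = C, bdry = (\<lambda>n. restrict (d n) (C (Suc n)))\<rparr>"
    and sub: "\<And>n. A n \<subseteq> C n"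
  shows "subcomplex sc \<lparr>chain = A, bdry = (\<lambda>n. restrict (d n) (A (Suc n)))\<rparr>
    \<lparr>chain = C, bdry = (\<lambda>n. restrict (d n) (C (Suc n)))\<rparr>"
proof -
  have "restrict (d n) (A (Suc n)) x = restrict (d n) (C (Suc n)) x" if "x \<in> A (Suc n)" for n x
    using that sub[of "Suc n"] by auto
  then show ?thesis using assms unfolding subcomplex_def by simp
qed

lemma subspace_Times:
  assumes s: "vector_space s" and Z: "Modules.module.subspace s W" "fs.subspace Z" "ds.subspace C"
  shows "Modules.module.subspace (plus_scale s) (W \<times> Z \<times> C)"
proof -
  interpret m: vector_space s by fact
  interpret p: vector_space "plus_scale s" by (rule vector_space_plus_scale[OF s])
  show ?thesis
    by (rule p.subspaceI)
      (use m.subspace_0[OF Z(1)] m.subspace_add[OF Z(1)] m.subspace_scale[OF Z(1)]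
        fs.subspace_0[OF Z(2)] fs.subspace_add[OF Z(2)] fs.subspace_scale[OF Z(2)]
        ds.subspace_0[OF Z(3)] ds.subspace_add[OF Z(3)] ds.subspace_scale[OF Z(3)]
        in \<open>auto simp: plus_scale_def zero_prod_def\<close>)
qed

text \<open>Keeping \<open>Z\<close> and \<open>C\<close> general lets the statement serve both the
  augmented sequence of \<open>S\<close> and its part over \<open>Y\<close>. The degrees 0, 1 and at
  least 2 are separate because each uses a different factor of the ambient product.\<close>

lemma vs_sequence_plus:
  assumes s: "vector_space s" and Z: "fs.subspace Z" and C: "\<And>n. ds.subspace (C n)"
    and \<phi>: "linear_on fscale s Z \<phi>"
    and zero: "phi_zero s S \<I> \<phi> ` C 0 \<subseteq> Z" and Suc: "\<And>m. phi_Suc s S \<I> \<phi> m ` C (Suc m) \<subseteq> C m"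
  shows "vs_sequence (plus_scale s) \<lparr>chain = plus_chain Z C,
    bdry = (\<lambda>n. restrict (plus_bdry s S \<I> \<phi> n) (plus_chain Z C (Suc n)))\<rparr>"
proof (rule vs_sequence_restrict[OF vector_space_plus_scale[OF s]])
  interpret m: vector_space s by fact
  note sub = subspace_Times[OF s]
  show "Modules.module.subspace (plus_scale s) (plus_chain Z C n)" for n
  proof -
    consider "n = 0" | "n = Suc 0" | k where "n = Suc (Suc k)" by (metis nat.exhaust)
    then show ?thesis by cases
      (simp_all only: plus_chain.simps sub Z C m.subspace_UNIV m.subspace_single_0
        fs.subspace_single_0 ds.subspace_single_0)
  qed
  show "linear_on (plus_scale s) (plus_scale s) (plus_chain Z C (Suc n)) (plus_bdry s S \<I> \<phi> n)" for n
  proof -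
    consider "n = 0" | "n = Suc 0" | k where "n = Suc (Suc k)" by (metis nat.exhaust)
    then show ?thesis
    proof cases
      case 1
      then show ?thesis using \<phi> by (auto simp: linear_on_def plus_scale_def)
    next
      case 2
      then show ?thesis
        using linear_phi_zero[of UNIV s S \<I> \<phi>] by (auto simp: linear_on_def plus_scale_def)
    next
      case 3
      then show ?thesis
        using linear_phi_Suc[of UNIV s S \<I> \<phi>] by (auto simp: linear_on_def plus_scale_def)
    qed
  qed
  show "plus_bdry s S \<I> \<phi> n ` plus_chain Z C (Suc n) \<subseteq> plus_chain Z C n" for n
  proof -
    consider "n = 0" | "n = Suc 0" | k where "n = Suc (Suc k)" by (metis nat.exhaust)
    then show ?thesis by cases (use zero Suc in \<open>auto simp: image_subset_iff\<close>)
  qed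
qed

lemma plus_chain_mono:
  assumes "Z \<subseteq> Z'" "\<And>n. C n \<subseteq> C' n"
  shows "plus_chain Z C n \<subseteq> plus_chain Z' C' n"
proof -
  consider "n = 0" | "n = Suc 0" | k where "n = Suc (Suc k)" by (metis nat.exhaust)
  then show ?thesis by cases (use assms in auto)
qed

context
  fixes s :: "'k::field \<Rightarrow> 'w::ab_group_add \<Rightarrow> 'w" and S :: "'a set" and \<I> :: "'a set set"
    and \<phi> :: "('a \<Rightarrow> 'k) \<Rightarrow> 'w" and Y :: "'a set"
  assumes s: "vector_space s" and M: "matroid S \<I>" and \<phi>: "linear_on fscale s (U S) \<phi>" and Y: "Y \<subseteq> S"
begin

text \<open>The cut-off is the level of \<open>S\<close> for every \<open>X\<close>, as in
  \<open>T_complex_on\<close>; it is reconciled with the level of \<open>Y\<close> in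
  \<open>chain_T_complex_restrict\<close>.\<close>

abbreviation (input) "T_trunc X n \<equiv> if int n \<le> level \<I> S then T_on s S \<I> \<phi> X n else {0}"

lemma T_complex_eq:
  "T_complex s S \<I> \<phi> = \<lparr>chain = T_trunc S, bdry = (\<lambda>m. restrict (phi_Suc s S \<I> \<phi> m) (T_trunc S (Suc m)))\<rparr>"
  unfolding T_complex_def T_full_eq Let_def ..

lemma T_complex_on_eq:
  "T_complex_on s S \<I> \<phi> X =
    \<lparr>chain = T_trunc X, bdry = (\<lambda>m. restrict (phi_Suc s S \<I> \<phi> m) (T_trunc X (Suc m)))\<rparr>"
  unfolding T_complex_on_def Let_def ..

lemma subspace_T_trunc: "ds.subspace (T_trunc X n)"
  by (simp add: subspace_T_on)

lemma T_trunc_subset: "T_trunc X n \<subseteq> T_on s S \<I> \<phi> X n"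
  using ds.subspace_0[OF subspace_T_on] by auto

lemma phi_Suc_T_trunc: "phi_Suc s S \<I> \<phi> m ` T_trunc X (Suc m) \<subseteq> T_trunc X m"
proof (cases "int (Suc m) \<le> level \<I> S")
  case True
  then show ?thesis using phi_Suc_mem[OF s M \<phi>, of _ X m] by auto
next
  case False
  \<comment> \<open>Above the top degree the source is \<open>{0}\<close>, and homogeneity with the
    scalar 0 sends 0 to 0.\<close>
  have "phi_Suc s S \<I> \<phi> m (dscale 0 0) = dscale 0 (phi_Suc s S \<I> \<phi> m 0)"
    using linear_phi_Suc[of UNIV s S \<I> \<phi> m] unfolding linear_on_def by blast
  then have "phi_Suc s S \<I> \<phi> m 0 = 0" by (simp only: ds.scale_zero_left)
  then show ?thesis
    using False ds.subspace_0[OF subspace_T_trunc[of m X]] by auto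
qed

lemma vs_sequence_T_complex_on: "vs_sequence dscale (T_complex_on s S \<I> \<phi> X)"
  unfolding T_complex_on_eq
  by (rule vs_sequence_restrict[OF vector_space_dscale])
    (rule subspace_T_trunc linear_phi_Suc phi_Suc_T_trunc)+

lemma T_trunc_mono: "T_trunc Y n \<subseteq> T_trunc S n"
  by (simp add: T_on_mono[OF Y])

lemma subcomplex_T_complex_on: "subcomplex dscale (T_complex_on s S \<I> \<phi> Y) (T_complex s S \<I> \<phi>)"
  using vs_sequence_T_complex_on[of Y] vs_sequence_T_complex_on[of S]
  unfolding T_complex_eq T_complex_on_eq
  by (rule subcomplex_restrict) (rule T_trunc_mono)

text \<open>The left side is cut off at the level of \<open>Y\<close>, the right side at the
  possibly larger level of \<open>S\<close>. In the degrees between them there is no T-flat inside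
  \<open>Y\<close>, since its level would exceed that of \<open>Y\<close>; the direct sum is empty
  and equals \<open>{0}\<close>.\<close>

lemma chain_T_complex_restrict:
  "(if int n \<le> level (mrestrict \<I> Y) Y then T_full s Y (mrestrict \<I> Y) (restrict \<phi> (U Y)) n else {0}) =
    T_trunc Y n"
proof (cases "int n \<le> level \<I> Y")
  case True
  moreover from this have "int n \<le> level \<I> S" using level_mono[OF M Y subset_refl] by simp
  ultimately show ?thesis by (simp add: level_restrict T_on_restrict[OF s M \<phi> Y])
next
  case False
  have "I \<notin> Tflats S \<I> n" if "I \<subseteq> Y" for I
    using False level_mono[OF M that Y] by (auto simp: Tflats_def)
  then have "{I \<in> Tflats S \<I> n. I \<subseteq> Y} = {}" by blast
  then have "T_on s S \<I> \<phi> Y n = {0}"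
    unfolding T_on_def by (auto simp: dsum_def fun_eq_iff)
  then show ?thesis using False by (simp add: level_restrict)
qed

lemma T_complex_restrict:
  "T_complex s Y (mrestrict \<I> Y) (restrict \<phi> (U Y)) = T_complex_on s S \<I> \<phi> Y"
proof -
  \<comment> \<open>Off its domain \<open>restrict\<close> gives \<open>undefined\<close> on both
    sides, so agreement on the chain space suffices for equality of functions.\<close>
  have "restrict (phi_Suc s Y (mrestrict \<I> Y) (restrict \<phi> (U Y)) m) (T_trunc Y (Suc m)) =
      restrict (phi_Suc s S \<I> \<phi> m) (T_trunc Y (Suc m))" for m
    using phi_Suc_restrict[OF s M \<phi> Y] T_trunc_subset[of "Suc m" Y] by (intro restrict_ext) blast
  then show ?thesis
    unfolding T_complex_def[of s Y] T_complex_on_eq Let_def chain_T_complex_restrict by simp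
qed

lemma phi_zero_T_trunc: "phi_zero s S \<I> \<phi> ` T_trunc X 0 \<subseteq> U X"
  using phi_zero_mem[OF s M \<phi>] T_trunc_subset[of 0 X] by blast

lemma subcomplex_T_plus_on: "subcomplex (plus_scale s) (T_plus_on s S \<I> \<phi> Y) (T_plus s S \<I> \<phi>)"
  unfolding T_plus_def T_plus_on_def T_complex_eq T_complex_on_eq Let_def sequence.simps
  by (intro subcomplex_restrict vs_sequence_plus s subspace_U subspace_T_trunc phi_zero_T_trunc
      phi_Suc_T_trunc plus_chain_mono U_mono Y T_trunc_mono \<phi> linear_on_subset[OF \<phi>])

lemma T_plus_restrict: "T_plus s Y (mrestrict \<I> Y) (restrict \<phi> (U Y)) = T_plus_on s S \<I> \<phi> Y"
proof -
  have "restrict (plus_bdry s Y (mrestrict \<I> Y) (restrict \<phi> (U Y)) n) (plus_chain (U Y) (T_trunc Y) (Suc n)) =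
      restrict (plus_bdry s S \<I> \<phi> n) (plus_chain (U Y) (T_trunc Y) (Suc n))" for n
  proof (rule restrict_ext)
    fix x assume x: "x \<in> plus_chain (U Y) (T_trunc Y) (Suc n)"
    have on: "y \<in> T_on s S \<I> \<phi> Y k" if "y \<in> T_trunc Y k" for y k
      using T_trunc_subset that by blast
    consider "n = 0" | "n = Suc 0" | k where "n = Suc (Suc k)" by (metis nat.exhaust)
    then show "plus_bdry s Y (mrestrict \<I> Y) (restrict \<phi> (U Y)) n x = plus_bdry s S \<I> \<phi> n x"
    proof cases
      \<comment> \<open>The differential is \<open>restrict \<phi> (U Y)\<close> on one side and
        \<open>\<phi>\<close> on the other, applied to an element of \<open>U Y\<close>.\<close>
      case 1
      then show ?thesis using x by auto
    next
      case 2
      then show ?thesis using x on[of _ 0] phi_zero_restrict[OF s M \<phi> Y] by (auto simp del: if_split)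
    next
      case (3 k)
      then show ?thesis using x on[of _ "Suc k"] phi_Suc_restrict[OF s M \<phi> Y] by (auto simp del: if_split)
    qed
  qed
  then show ?thesis
    unfolding T_plus_def T_plus_on_def T_complex_restrict T_complex_on_eq Let_def sequence.simps by simp
qed

end

theorem theorem6p2:
  fixes s :: "'k::field \<Rightarrow> 'w::ab_group_add \<Rightarrow> 'w"
    and S Y :: "'a set" and \<I> :: "'a set set"
    and \<phi> :: "('a \<Rightarrow> 'k) \<Rightarrow> 'w"
  assumes "vector_space s"
    and "matroid S \<I>"
    and "is_representation s S \<I> \<phi>"
    and "Y \<subseteq> S"
  shows "(subcomplex dscale (T_complex_on s S \<I> \<phi> Y) (T_complex s S \<I> \<phi>)
       \<and> T_complex s Y (mrestrict \<I> Y) (restrict \<phi> (U Y)) = T_complex_on s S \<I> \<phi> Y)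
     \<and> (subcomplex (plus_scale s) (T_plus_on s S \<I> \<phi> Y) (T_plus s S \<I> \<phi>)
       \<and> T_plus s Y (mrestrict \<I> Y) (restrict \<phi> (U Y)) = T_plus_on s S \<I> \<phi> Y)"
proof -
  have "linear_on fscale s (U S) \<phi>" using assms(3) by (simp add: is_representation_def)
  note * = assms(1,2) this assms(4)
  show ?thesis
    by (intro conjI subcomplex_T_complex_on[OF *] T_complex_restrict[OF *]
        subcomplex_T_plus_on[OF *] T_plus_restrict[OF *])
qed

end
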